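(* Let $q\ge 2$ be an integer, let $T_{q+1}$ be the $(q+1)$-homogeneous tree with distinguished vertex $v_0$, and let $\operatorname{D}(T_{q+1})$ be its dynamic graph. The set $\operatorname{Erg}(\operatorname{D}(T_{q+1}))$ of all ergodic central measures on the space $\mathscr{P}(\operatorname{D}(T_{q+1}))$ of infinite paths in $\operatorname{D}(T_{q+1})$ coincides with the family of Markov measures $$\Lambda_q:=\{\lambda_{\omega,r}\mid \omega\in\partial T_{q+1},\ r\in[1/2,1]\}.$$ Thus $\operatorname{Erg}(\operatorname{D}(T_{q+1}))$, equipped with the weak topology, is homeomorphic to the product $\partial T_{q+1}\times[1/2,1]$.
   Context: The tree $T_{q+1}$ is the infinite tree in which every vertex has valency $q+1$; $v_0$ is a fixed vertex. $\partial T_{q+1}$ is the space of ends of $T_{q+1}$ with its usual topology (a Cantor set for $q\ge2$). Dynamic graph. $\operatorname{D}(T_{q+1})$ is the $\mathbb{N}_0$-graded graph whose $n$th level is a copy of the set of vertices of $T_{q+1}$ that are connected with $v_0$ by a walk of length $n$ (equivalently, vertices at distance at most $n$ from $v_0$ and of the same parity as $n$). The unique vertex of level $0$ is denoted by $\varnothing$. Two vertices of $\operatorname{D}(T_{q+1})$ are adjacent if and only if they lie at adjacent levels and the corresponding vertices of $T_{q+1}$ are joined by an edge. The natural projection is $\pi:\operatorname{D}(T_{q+1})\to T_{q+1}$, so $\pi(\varnothing)=v_0$. For adjacent vertices write $v\prec w$ if $w$ lies at level $n+1$ and $v$ at level $n$ for some $n$; edges are written $(v,w)$ with $v\prec w$.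 Path space. $\mathscr{P}(\operatorname{D}(T_{q+1}))$ is the compact space of all infinite paths $(w_i)_{i\ge 0}$ with $w_0=\varnothing$ and $w_i\prec w_{i+1}$ for all $i$, with the topology generated by cylinder sets. Measures are Borel probability measures; the weak topology is the topology of weak convergence of measures. Central and ergodic measures. A measure on $\mathscr{P}(\operatorname{D}(T_{q+1}))$ is central if for every vertex $v$ the conditional measure on the set of finite paths from $\varnothing$ to $v$ is uniform (i.e., any two finite paths from $\varnothing$ to the same vertex define cylinders of equal measure). Central measures form a compact convex set (a simplex); a central measure is ergodic if it is an extreme point of this set. Measures $\lambda_{\omega,r}$. For an end $\omega\in\partial T_{q+1}$, an edge $(v,w)$ with $v\prec w$ is $\omega$-directed if $\pi(w)$ is the neighbor of $\pi(v)$ lying on the geodesic ray from $\pi(v)$ to $\omega$. Every vertex has exactly one outgoing $\omega$-directed edge. For $r\in[0,1]$, $\lambda_{\omega,r}$ is the law on $\mathscr{P}(\operatorname{D}(T_{q+1}))$ of the Markov chain started at $\varnothing$ whose transition probability is $r$ along each $\omega$-directed edge and $\frac{1-r}{q}$ along every other edge. *)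

theory Defs
  imports "HOL-Probability.Probability"
begin

text \<open>
  A simple graph is given by its adjacency relation; the vertices are all elements of the type.
\<close>

definition homogeneous_tree :: "nat \<Rightarrow> ('v \<Rightarrow> 'v \<Rightarrow> bool) \<Rightarrow> bool" where
  "homogeneous_tree d E \<longleftrightarrow>
     symp E \<and> irreflp E \<and>
     (\<forall>u v. rtranclp E u v) \<and>
     (\<nexists>c. 3 \<le> length c \<and> distinct c \<and> successively E c \<and> E (last c) (hd c)) \<and>
     (\<forall>v. finite {w. E v w} \<and> card {w. E v w} = d)"

definition rays :: "('v \<Rightarrow> 'v \<Rightarrow> bool) \<Rightarrow> (nat \<Rightarrow> 'v) set" where
  "rays E = {x. inj x \<and> (\<forall>i. E (x i) (x (Suc i)))}"

definition cofinal_rays :: "('v \<Rightarrow> 'v \<Rightarrow> bool) \<Rightarrow> ((nat \<Rightarrow> 'v) \<times> (nat \<Rightarrow> 'v)) set" where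
  "cofinal_rays E = {(x, y). x \<in> rays E \<and> y \<in> rays E \<and> (\<exists>m n. \<forall>k. x (m + k) = y (n + k))}"

definition ends :: "('v \<Rightarrow> 'v \<Rightarrow> bool) \<Rightarrow> (nat \<Rightarrow> 'v) set set" where
  "ends E = rays E // cofinal_rays E"

text \<open>
  An end is a class of rays, and in a tree every ray is geodesic. So the geodesic ray from \<open>u\<close> to
  the end \<open>\<omega>\<close> is the member of \<open>\<omega>\<close> that starts at \<open>u\<close>, and \<open>end_directed \<omega> u v\<close> says that
  \<open>v\<close> is its second vertex. The ends \<open>\<omega>\<close> with \<open>end_directed \<omega> u v\<close>, for \<open>(u, v)\<close> an edge, are those
  of the component of \<open>v\<close> after that edge is removed.
\<close>

definition end_directed :: "(nat \<Rightarrow> 'v) set \<Rightarrow> 'v \<Rightarrow> 'v \<Rightarrow> bool" where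
  "end_directed \<omega> u v \<longleftrightarrow> (\<exists>x\<in>\<omega>. x 0 = u \<and> x 1 = v)"

definition ends_topology :: "('v \<Rightarrow> 'v \<Rightarrow> bool) \<Rightarrow> (nat \<Rightarrow> 'v) set topology" where
  "ends_topology E = topology_generated_by {{\<omega> \<in> ends E. end_directed \<omega> u v} | u v. E u v}"

text \<open>
  The copy of \<open>v\<close> at level \<open>n\<close> of the dynamic graph is the pair \<open>(n, v)\<close>; the projection to the tree
  is \<open>snd\<close>, and the root is \<open>(0, v0)\<close>.
\<close>

definition dyn_verts :: "('v \<Rightarrow> 'v \<Rightarrow> bool) \<Rightarrow> 'v \<Rightarrow> (nat \<times> 'v) set" where
  "dyn_verts E v0 = {(n, v). (E ^^ n) v0 v}"

definition dyn_prec :: "('v \<Rightarrow> 'v \<Rightarrow> bool) \<Rightarrow> 'v \<Rightarrow> nat \<times> 'v \<Rightarrow> nat \<times> 'v \<Rightarrow> bool" where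
  "dyn_prec E v0 a b \<longleftrightarrow>
     a \<in> dyn_verts E v0 \<and> b \<in> dyn_verts E v0 \<and> fst b = Suc (fst a) \<and> E (snd a) (snd b)"

definition paths :: "('v \<Rightarrow> 'v \<Rightarrow> bool) \<Rightarrow> 'v \<Rightarrow> (nat \<Rightarrow> nat \<times> 'v) set" where
  "paths E v0 = {w. w 0 = (0, v0) \<and> (\<forall>i. dyn_prec E v0 (w i) (w (Suc i)))}"

definition finite_paths :: "('v \<Rightarrow> 'v \<Rightarrow> bool) \<Rightarrow> 'v \<Rightarrow> (nat \<times> 'v) list set" where
  "finite_paths E v0 = {p. p \<noteq> [] \<and> hd p = (0, v0) \<and> successively (dyn_prec E v0) p}"

definition cylinder :: "('v \<Rightarrow> 'v \<Rightarrow> bool) \<Rightarrow> 'v \<Rightarrow> (nat \<times> 'v) list \<Rightarrow> (nat \<Rightarrow> nat \<times> 'v) set" where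
  "cylinder E v0 p = {w \<in> paths E v0. \<forall>i<length p. w i = p ! i}"

definition path_topology :: "('v \<Rightarrow> 'v \<Rightarrow> bool) \<Rightarrow> 'v \<Rightarrow> (nat \<Rightarrow> nat \<times> 'v) topology" where
  "path_topology E v0 = topology_generated_by (cylinder E v0 ` finite_paths E v0)"

definition borel_prob_measures :: "'a topology \<Rightarrow> 'a measure set" where
  "borel_prob_measures X =
     {M. prob_space M \<and> sets M = sets (sigma (topspace X) {U. openin X U})}"

text \<open>
  The coarsest topology for which \<open>M \<mapsto> \<integral> f dM\<close> is continuous for every bounded continuous \<open>f\<close>.
\<close>

definition weak_topology :: "'a topology \<Rightarrow> 'a measure topology" where
  "weak_topology X = topology_generated_by
     {{M \<in> borel_prob_measures X. integral\<^sup>L M f \<in> U} | (f :: 'a \<Rightarrow> real) U.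
        continuous_map X euclideanreal f \<and> bounded (f ` topspace X) \<and> open U}"

definition central_measures :: "('v \<Rightarrow> 'v \<Rightarrow> bool) \<Rightarrow> 'v \<Rightarrow> (nat \<Rightarrow> nat \<times> 'v) measure set" where
  "central_measures E v0 =
     {M \<in> borel_prob_measures (path_topology E v0).
        \<forall>p \<in> finite_paths E v0. \<forall>p' \<in> finite_paths E v0.
          last p = last p' \<longrightarrow> measure M (cylinder E v0 p) = measure M (cylinder E v0 p')}"

text \<open>
  Measures on a fixed space do not form a vector space type, so extreme points of a set of
  measures are spelled out.
\<close>

definition extreme_measures :: "'a measure set \<Rightarrow> 'a measure set" where
  "extreme_measures K =
     {M \<in> K. \<forall>M1 \<in> K. \<forall>M2 \<in> K. \<forall>t \<in> {0<..<1::real}.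
        (\<forall>A \<in> sets M. measure M A = t * measure M1 A + (1 - t) * measure M2 A)
        \<longrightarrow> M1 = M \<and> M2 = M}"

definition ergodic_central_measures ::
    "('v \<Rightarrow> 'v \<Rightarrow> bool) \<Rightarrow> 'v \<Rightarrow> (nat \<Rightarrow> nat \<times> 'v) measure set" where
  "ergodic_central_measures E v0 = extreme_measures (central_measures E v0)"

definition markov_law ::
    "('v \<Rightarrow> 'v \<Rightarrow> bool) \<Rightarrow> 'v \<Rightarrow> (nat \<times> 'v \<Rightarrow> nat \<times> 'v \<Rightarrow> real) \<Rightarrow> (nat \<Rightarrow> nat \<times> 'v) measure \<Rightarrow> bool" where
  "markov_law E v0 P M \<longleftrightarrow>
     M \<in> borel_prob_measures (path_topology E v0) \<and>
     (\<forall>p \<in> finite_paths E v0.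
        measure M (cylinder E v0 p) = (\<Prod>i<length p - 1. P (p ! i) (p ! Suc i)))"

definition lambda_transition ::
    "nat \<Rightarrow> (nat \<Rightarrow> 'v) set \<Rightarrow> real \<Rightarrow> nat \<times> 'v \<Rightarrow> nat \<times> 'v \<Rightarrow> real" where
  "lambda_transition q \<omega> r a b = (if end_directed \<omega> (snd a) (snd b) then r else (1 - r) / real q)"

text \<open>
  In a \<open>(q + 1)\<close>-homogeneous tree, for \<open>0 \<le> r \<le> 1\<close>, the outgoing transition probabilities at every
  vertex of the dynamic graph sum to 1. Exactly one measure then has the prescribed values on
  cylinders.
\<close>

definition lambda_measure ::
    "nat \<Rightarrow> ('v \<Rightarrow> 'v \<Rightarrow> bool) \<Rightarrow> 'v \<Rightarrow> (nat \<Rightarrow> 'v) set \<Rightarrow> real \<Rightarrow> (nat \<Rightarrow> nat \<times> 'v) measure" where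
  "lambda_measure q E v0 \<omega> r = (THE M. markov_law E v0 (lambda_transition q \<omega> r) M)"

end

theory Submission
  imports Defs
begin

text \<open>
  Central measures correspond to normalized nonnegative functions \<open>h\<close> on the dynamic graph with
  \<open>h n v = (\<Sum>w. h (n + 1) w)\<close>, the sum over the neighbours of \<open>v\<close>, and ergodic measures to the
  minimal ones. The function \<open>h (n + 2) v\<close> of \<open>(n, v)\<close> is also harmonic and is bounded by \<open>h\<close>, so for
  minimal \<open>h\<close> it is a multiple of \<open>h\<close>. If the multiple is \<open>0\<close>, then \<open>h\<close> lives on geodesics and \<open>r = 1\<close>.
  Otherwise \<open>h n v = s ^ n * f v\<close> for an eigenfunction \<open>f\<close> of the tree. Splitting \<open>f\<close> along an edge,
  minimality forces the ratio of \<open>f\<close> over each edge to be \<open>F\<close> or \<open>1 / F\<close> for one constant \<open>F < 1\<close>, and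
  exactly one edge at every vertex is increasing; these edges point to an end.

  Conversely, a bounded harmonic function for the chain with \<open>1/2 \<le> r < 1\<close> is constant: the largest
  difference between its values at two vertices with a common \<open>m\<close>-th ancestor is a bounded sequence
  in \<open>m\<close>, dominated by its weighted averages, and vanishes at \<open>0\<close>, hence is \<open>0\<close>. The same argument
  applies to vertices at different heights.

  For the homeomorphism, the return probability after two steps recovers \<open>r\<close>, and the probabilities
  of geodesic segments recover the end.
\<close>

text \<open>The bound 1/2 has one source, seen from two sides. For \<open>r < 1\<close> the
  functions for \<open>r\<close> and \<open>1 - r\<close> share the two-step value
  \<open>s^2 = r (1 - r) / q\<close>, and \<open>F = s / r\<close> is a root of
  \<open>s q x^2 - x + s\<close>, whose two roots have product \<open>1 / q\<close>. A positive
  eigenfunction can lose at most the smaller root as a factor across an edge; this root satisfies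
  \<open>q F^2 \<le> 1\<close>, which is \<open>r \<ge> 1/2\<close>. In the converse, differences of
  a bounded harmonic function satisfy a convexity inequality whose increments cannot shrink when
  \<open>r \<ge> 1 - r\<close>. For \<open>r < 1/2\<close> the chain drifts away from the end
  towards a random one, and nonconstant bounded harmonic functions appear.

  The shift is by two levels because a vertex occurs only at levels of one parity. The splitting
  along an edge is useful because each piece is radial on one side of the edge, which keeps both
  pieces below \<open>f\<close>, so that minimality applies.\<close>

lemma bounded_subconvex_eq_0:
  fixes d :: "nat \<Rightarrow> real"
  assumes r: "1 / 2 \<le> r" "r < 1" and d0: "d 0 = 0" and nonneg: "\<And>m. 0 \<le> d m" and bound: "\<And>m. d m \<le> B"
    and conv: "\<And>m. d (Suc m) \<le> r * d m + (1 - r) * d (Suc (Suc m))"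
  shows "d m = 0"
proof (rule ccontr)
  assume "d m \<noteq> 0"
  define j where "j = (LEAST j. d (Suc j) \<noteq> 0)"
  have "\<exists>j. d (Suc j) \<noteq> 0" using \<open>d m \<noteq> 0\<close> d0 by (metis not0_implies_Suc)
  then have j: "d (Suc j) \<noteq> 0" unfolding j_def by (rule LeastI_ex)
  have dj: "d j = 0"
  proof (cases j)
    case (Suc i) then show ?thesis using not_less_Least[of i "\<lambda>j. d (Suc j) \<noteq> 0"] by (auto simp: j_def)
  qed (simp add: d0)
  define e where "e = d (Suc j)"
  have e: "e > 0" using j nonneg[of "Suc j"] by (simp add: e_def)
  \<comment> \<open>For consecutive increments the hypothesis reads
    \<open>r * ?a \<le> (1 - r) * ?b\<close>. Since \<open>r \<ge> 1 - r\<close>, increments never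
    shrink after the first positive one, so \<open>d\<close> would grow at least linearly.\<close>
  have incr: "d (Suc (j + i)) - d (j + i) \<ge> e" for i
  proof (induction i)
    case 0 then show ?case by (simp add: e_def dj)
  next
    case (Suc i)
    let ?a = "d (Suc (j + i)) - d (j + i)" and ?b = "d (Suc (Suc (j + i))) - d (Suc (j + i))"
    have 1: "r * ?a \<le> (1 - r) * ?b" using conv[of "j + i"] by (simp add: algebra_simps)
    have "(1 - r) * ?a \<le> r * ?a" using r e Suc by (intro mult_right_mono) auto
    then have "(1 - r) * ?a \<le> (1 - r) * ?b" using 1 by linarith
    then show ?case using r Suc by simp
  qed
  have "d (j + i) \<ge> real i * e" for i
  proof (induction i)
    case (Suc i) then show ?case using incr[of i] by (simp add: algebra_simps)
  qed (simp add: dj)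
  moreover obtain i :: nat where "B < real i * e" using e reals_Archimedean3 by blast
  ultimately show False using bound by (meson not_less order_trans)
qed

text \<open>Any bijection may pair the summands, as the bound is assumed for all pairs. This suits
  the children of two vertices, which carry no canonical matching.\<close>

lemma sum_diff_le_equal_card:
  fixes f :: "'a \<Rightarrow> real"
  assumes "finite A" "finite B" "card A = card B" "\<And>a b. a \<in> A \<Longrightarrow> b \<in> B \<Longrightarrow> \<bar>f a - f b\<bar> \<le> d"
  shows "\<bar>sum f A - sum f B\<bar> \<le> real (card A) * d"
proof -
  obtain g where g: "bij_betw g A B" using finite_same_card_bij assms by blast
  have "sum f B = (\<Sum>a\<in>A. f (g a))" using g by (simp add: sum.reindex_bij_betw)
  then have "\<bar>sum f A - sum f B\<bar> = \<bar>\<Sum>a\<in>A. f a - f (g a)\<bar>" by (simp add: sum_subtractf)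
  also have "\<dots> \<le> (\<Sum>a\<in>A. \<bar>f a - f (g a)\<bar>)" by (rule sum_abs)
  also have "\<dots> \<le> (\<Sum>a\<in>A. d)" using g assms(4) by (intro sum_mono) (auto simp: bij_betw_def)
  finally show ?thesis by simp
qed

lemma openin_greater_continuous_map:
  assumes "continuous_map X euclideanreal f"
  shows "openin X {x \<in> topspace X. c < f x}"
  using openin_continuous_map_preimage[OF assms, of "{c<..}"] by simp

lemma openin_less_continuous_map:
  assumes "continuous_map X euclideanreal f"
  shows "openin X {x \<in> topspace X. f x < c}"
  using openin_continuous_map_preimage[OF assms, of "{..<c}"] by simp

section \<open>Adjacency and walks in the homogeneous tree\<close>

locale tree =
  fixes E :: "'v \<Rightarrow> 'v \<Rightarrow> bool" and v0 :: 'v and q :: nat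
  assumes q_ge2: "2 \<le> q" and homogeneous: "homogeneous_tree (q + 1) E"
begin

lemma E_sym: "E u v \<Longrightarrow> E v u"
  using homogeneous by (auto simp: homogeneous_tree_def dest: sympD)

lemma E_irrefl: "\<not> E u u"
  using homogeneous by (auto simp: homogeneous_tree_def dest: irreflpD)

lemma connected: "\<exists>n. (E ^^ n) u v"
  using homogeneous by (auto simp: homogeneous_tree_def intro: rtranclp_imp_relpowp)

lemma acyclic: "3 \<le> length c \<Longrightarrow> distinct c \<Longrightarrow> successively E c \<Longrightarrow> \<not> E (last c) (hd c)"
  using homogeneous by (auto simp: homogeneous_tree_def)

lemma finite_nbrs [simp]: "finite {w. E v w}"
  using homogeneous by (auto simp: homogeneous_tree_def)

lemma card_nbrs: "card {w. E v w} = q + 1"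
  using homogeneous by (auto simp: homogeneous_tree_def)

lemma ex_nbr: "\<exists>w. E v w"
  using card_nbrs[of v] by (metis (no_types, lifting) card.empty empty_Collect_eq add_is_0 one_neq_zero)

lemma relpowp_sym: "(E ^^ n) u v \<Longrightarrow> (E ^^ n) v u"
proof (induction n arbitrary: v)
  case (Suc n)
  then obtain w where "(E ^^ n) u w" "E w v" by auto
  then show ?case using Suc.IH E_sym relpowp_Suc_I2 by metis
qed auto

subsection \<open>Distance\<close>

definition dst :: "'v \<Rightarrow> 'v \<Rightarrow> nat" where
  "dst x y = (LEAST n. (E ^^ n) x y)"

lemma dst_walk: "(E ^^ dst x y) x y"
  unfolding dst_def using connected by (rule LeastI_ex)

lemma dst_le: "(E ^^ n) x y \<Longrightarrow> dst x y \<le> n"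
  unfolding dst_def by (rule Least_le)

lemma dst_refl [simp]: "dst x x = 0"
  using dst_le[of 0 x x] by simp

lemma dst_eq_0 [simp]: "dst x y = 0 \<longleftrightarrow> x = y"
  using dst_walk[of x y] by auto

lemma dst_commute: "dst x y = dst y x"
  by (meson dst_le dst_walk le_antisym relpowp_sym)

lemma dst_edge: "E u v \<Longrightarrow> dst x v \<le> Suc (dst x u)"
  by (meson dst_le dst_walk relpowp_Suc_I)

lemma lower_nbr:
  assumes "x \<noteq> u"
  obtains v where "E u v" "dst x u = Suc (dst x v)"
proof -
  obtain k where k: "dst x u = Suc k" using assms by (metis dst_eq_0 not0_implies_Suc)
  then obtain v where v: "(E ^^ k) x v" "E v u" using dst_walk[of x u] by (metis relpowp_Suc_E)
  then have "dst x v \<le> k" "Suc k \<le> Suc (dst x v)" using dst_le dst_edge k by metis+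
  then show ?thesis using that v k E_sym by fastforce
qed

text \<open>Acyclicity in terms of distance. The two ends have neighbours one step closer to
  \<open>x\<close>, which are new because the path stays at distance at least \<open>k\<close>. If
  they coincide, a cycle closes; otherwise they extend the path and the level drops, until both ends
  would be \<open>x\<close>.\<close>

lemma no_level_path:
  assumes "2 \<le> length c" "distinct c" "successively E c"
    "dst x (hd c) = k" "dst x (last c) = k" "\<forall>y\<in>set c. k \<le> dst x y"
  shows False
  using assms
proof (induction k arbitrary: c)
  case 0
  then have "hd c = last c" using dst_eq_0 by metis
  moreover have "c \<noteq> []" "tl c \<noteq> []" using 0(1) by (cases c; auto)+
  ultimately show False using 0(2) by (cases c) (auto split: if_splits)
next
  case (Suc k)
  have ne: "c \<noteq> []" using Suc.prems(1) by auto
  obtain a where a: "E (hd c) a" "dst x a = k"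
    using lower_nbr[of x "hd c"] Suc.prems(4) by (metis Suc_inject dst_refl nat.distinct(1))
  obtain b where b: "E (last c) b" "dst x b = k"
    using lower_nbr[of x "last c"] Suc.prems(5) by (metis Suc_inject dst_refl nat.distinct(1))
  have notin: "a \<notin> set c" "b \<notin> set c" using a b Suc.prems(6) by force+
  show False
  proof (cases "a = b")
    case True
    have "\<not> E (last (a # c)) (hd (a # c))"
      using Suc.prems notin a ne E_sym by (intro acyclic) (auto simp: successively_Cons)
    then show False using b True ne by auto
  next
    case False
    show False
    proof (rule Suc.IH[of "a # c @ [b]"])
      show "successively E (a # c @ [b])"
        using Suc.prems(3) a b ne E_sym by (auto simp: successively_Cons successively_append_iff)
    qed (use False a b notin Suc.prems in force)+
  qed
qed

lemma edge_dst_cases: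
  assumes "E u v"
  shows "dst x v = Suc (dst x u) \<or> dst x u = Suc (dst x v)"
proof (rule ccontr)
  assume "\<not> ?thesis"
  moreover have "dst x v \<le> Suc (dst x u)" "dst x u \<le> Suc (dst x v)"
    using assms dst_edge E_sym by blast+
  ultimately have "dst x u = dst x v" by linarith
  then show False
    using no_level_path[of "[u, v]" x "dst x u"] assms E_irrefl by auto
qed

lemma lower_nbr_unique:
  assumes "E u a" "E u b" "dst x a < dst x u" "dst x b < dst x u"
  shows "a = b"
proof (rule ccontr)
  assume "a \<noteq> b"
  moreover have "Suc (dst x a) = dst x u" "Suc (dst x b) = dst x u"
    using assms edge_dst_cases[of u a x] edge_dst_cases[of u b x] by auto
  ultimately show False
    using no_level_path[of "[a, u, b]" x "dst x a"] assms E_irrefl E_sym by auto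
qed

text \<open>Each edge changes the distance by exactly one, hence its parity; conversely a geodesic
  is lengthened by going back and forth along an edge. Membership in a level of the dynamic graph
  thus becomes a condition on \<open>dst\<close>.\<close>

lemma walk_iff: "(E ^^ n) x y \<longleftrightarrow> dst x y \<le> n \<and> even (n + dst x y)"
proof
  show "(E ^^ n) x y \<Longrightarrow> dst x y \<le> n \<and> even (n + dst x y)"
  proof (induction n arbitrary: y)
    case (Suc n)
    then obtain z where z: "(E ^^ n) x z" "E z y" by auto
    show ?case using Suc.IH[OF z(1)] edge_dst_cases[OF z(2), of x] by auto
  qed simp
next
  have *: "(E ^^ (dst x y + 2 * k)) x y" for k
  proof (induction k)
    case 0 then show ?case using dst_walk by simp
  next
    case (Suc k)
    obtain z where "E y z" using ex_nbr by blast
    then have "(E ^^ Suc (Suc (dst x y + 2 * k))) x y"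
      using Suc E_sym by (meson relpowp_Suc_I)
    then show ?case by simp
  qed
  assume "dst x y \<le> n \<and> even (n + dst x y)"
  then have "even (n - dst x y)" "n = dst x y + (n - dst x y)" by auto
  then have "\<exists>k. n = dst x y + 2 * k" by (metis evenE)
  then show "(E ^^ n) x y" using * by auto
qed

text \<open>The vertices nearer to \<open>u\<close> than to \<open>v\<close> form one half of the
  tree after deletion of the edge, and only that edge leaves it: an exit elsewhere would give
  \<open>x\<close> two different neighbours closer to \<open>v\<close>.\<close>

lemma half_tree_step:
  assumes "E u v" "dst u x < dst v x" "E x y" "x \<noteq> u \<or> y \<noteq> v"
  shows "dst u y < dst v y"
proof (cases "x = u")
  case True
  then have "y \<noteq> v" using assms(4) by simp
  moreover have "dst v u = 1" "dst u y = 1"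
    using edge_dst_cases[of u y u] edge_dst_cases[OF E_sym[OF assms(1)], of v] assms(3) True by auto
  moreover have "dst v y = Suc (dst v u) \<or> dst v u = Suc (dst v y)"
    using edge_dst_cases assms(3) True by blast
  moreover have "dst v y \<noteq> 0" using \<open>y \<noteq> v\<close> by (metis dst_eq_0)
  ultimately show ?thesis by linarith
next
  case False
  obtain z where z: "E x z" "dst u x = Suc (dst u z)" using lower_nbr[of u x] False by metis
  have ux: "dst v x = Suc (dst u x)"
    using edge_dst_cases[OF assms(1), of x] assms(2) by (auto simp: dst_commute)
  show ?thesis
  proof (rule ccontr)
    assume "\<not> ?thesis"
    then have uy: "dst u y = Suc (dst v y)"
      using edge_dst_cases[OF assms(1), of y] by (auto simp: dst_commute)
    then have y: "dst v y < dst v x"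
      using ux edge_dst_cases[OF assms(3), of u] edge_dst_cases[OF assms(3), of v] by linarith
    have "dst v z < dst v x"
      using edge_dst_cases[OF assms(1), of z] z ux dst_commute[of z] by force
    then have "y = z" using lower_nbr_unique assms(3) z(1) y by blast
    then show False using uy z(2) ux edge_dst_cases[OF assms(3), of v] by simp
  qed
qed

subsection \<open>Rays and ends\<close>

text \<open>The first step that came closer to the start would lead to the unique lower neighbour,
  which is the vertex just left.\<close>

lemma non_backtracking_dst:
  assumes "\<And>i. E (x i) (x (Suc i))" "\<And>i. x (Suc (Suc i)) \<noteq> x i"
  shows "dst (x 0) (x i) = i"
proof -
  have "dst (x 0) (x i) = i \<and> dst (x 0) (x (Suc i)) = Suc i"
  proof (induction i)
    case 0 then show ?case using edge_dst_cases[OF assms(1)[of 0], of "x 0"] by auto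
  next
    case (Suc i)
    have "dst (x 0) (x (Suc (Suc i))) = Suc (Suc i)"
    proof (rule ccontr)
      assume "\<not> ?thesis"
      then have "dst (x 0) (x (Suc (Suc i))) < dst (x 0) (x (Suc i))"
        using edge_dst_cases[OF assms(1)[of "Suc i"], of "x 0"] Suc by auto
      then have "x (Suc (Suc i)) = x i"
        using lower_nbr_unique[of "x (Suc i)" "x (Suc (Suc i))" "x i" "x 0"] Suc assms(1) E_sym by auto
      then show False using assms(2) by auto
    qed
    then show ?case using Suc by auto
  qed
  then show ?thesis ..
qed

lemma raysI:
  assumes "\<And>i. E (x i) (x (Suc i))" "\<And>i. x (Suc (Suc i)) \<noteq> x i"
  shows "x \<in> rays E"
  using non_backtracking_dst[of x, OF assms] assms(1) unfolding rays_def
  by (auto intro!: injI) metis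

lemma raysD:
  assumes "x \<in> rays E"
  shows "E (x i) (x (Suc i))" "x (Suc (Suc i)) \<noteq> x i" "dst (x 0) (x i) = i" "inj x"
proof -
  show *: "E (x i) (x (Suc i))" "x (Suc (Suc i)) \<noteq> x i" "inj x" for i
    using assms unfolding rays_def by (auto dest: injD)
  show "dst (x 0) (x i) = i" using * by (intro non_backtracking_dst) auto
qed

lemma equiv_cofinal: "equiv (rays E) (cofinal_rays E)"
proof (rule equivI)
  show "cofinal_rays E \<subseteq> rays E \<times> rays E" by (auto simp: cofinal_rays_def)
  show "refl_on (rays E) (cofinal_rays E)" by (auto simp: refl_on_def cofinal_rays_def)
  show "sym (cofinal_rays E)" by (auto simp: sym_def cofinal_rays_def) metis
  show "trans (cofinal_rays E)"
  proof (rule transI)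
    fix x y z assume "(x, y) \<in> cofinal_rays E" "(y, z) \<in> cofinal_rays E"
    then obtain m n m' n' where *: "\<forall>k. x (m + k) = y (n + k)" "\<forall>k. y (m' + k) = z (n' + k)"
      and r: "x \<in> rays E" "z \<in> rays E"
      by (auto simp: cofinal_rays_def)
    have "x ((m + m') + k) = z ((n' + n) + k)" for k
      using *(1)[rule_format, of "m' + k"] *(2)[rule_format, of "n + k"]
      by (simp add: ac_simps)
    then show "(x, z) \<in> cofinal_rays E" using r by (auto simp: cofinal_rays_def)
  qed
qed

lemma end_rays: "\<omega> \<in> ends E \<Longrightarrow> x \<in> \<omega> \<Longrightarrow> x \<in> rays E"
  unfolding ends_def using equiv_cofinal by (metis Union_quotient UnionI)

lemma end_cofinal: "\<omega> \<in> ends E \<Longrightarrow> x \<in> \<omega> \<Longrightarrow> y \<in> \<omega> \<Longrightarrow> \<exists>m n. \<forall>k. x (m + k) = y (n + k)"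
  using quotient_eq_iff[OF equiv_cofinal, of \<omega> \<omega> x y] unfolding ends_def
  by (auto simp: cofinal_rays_def)

lemma end_closed:
  assumes "\<omega> \<in> ends E" "x \<in> \<omega>" "y \<in> rays E" "\<And>k. x (m + k) = y (n + k)"
  shows "y \<in> \<omega>"
proof -
  have "(x, y) \<in> cofinal_rays E"
    using assms end_rays by (auto simp: cofinal_rays_def)
  then show ?thesis
    using assms(1,2) in_quotient_imp_closed[OF equiv_cofinal] unfolding ends_def by blast
qed

lemma end_of_ray: "x \<in> rays E \<Longrightarrow> \<exists>\<omega>\<in>ends E. x \<in> \<omega>"
  unfolding ends_def using equiv_cofinal by (metis quotientI equiv_class_self)

lemma end_tail:
  assumes "\<omega> \<in> ends E" "x \<in> \<omega>"
  shows "(\<lambda>i. x (Suc i)) \<in> \<omega>"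
proof -
  have "(\<lambda>i. x (Suc i)) \<in> rays E"
    using raysD[OF end_rays[OF assms]] by (intro raysI) auto
  then show ?thesis by (rule end_closed[OF assms, where m = 1 and n = 0]) auto
qed

lemma end_cons:
  assumes "\<omega> \<in> ends E" "x \<in> \<omega>" "E u (x 0)" "u \<noteq> x 1"
  shows "case_nat u x \<in> \<omega>"
proof -
  have "case_nat u x \<in> rays E"
  proof (rule raysI)
    show "E (case_nat u x i) (case_nat u x (Suc i))" for i
      using raysD(1)[OF end_rays[OF assms(1,2)]] assms(3) by (cases i) auto
    show "case_nat u x (Suc (Suc i)) \<noteq> case_nat u x i" for i
      using raysD(2)[OF end_rays[OF assms(1,2)]] assms(4) by (cases i) auto
  qed
  then show ?thesis by (rule end_closed[OF assms(1,2), where m = 0 and n = 1]) auto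
qed

lemma end_nonempty: "\<omega> \<in> ends E \<Longrightarrow> \<omega> \<noteq> {}"
  unfolding ends_def using in_quotient_imp_non_empty[OF equiv_cofinal] by blast

text \<open>A ray of the end is carried along a walk to \<open>u\<close>. Crossing an edge either
  prepends the new vertex or, if that would backtrack, cuts off the first one; neither changes the
  end.\<close>

lemma ray_from:
  assumes "\<omega> \<in> ends E"
  shows "\<exists>x\<in>\<omega>. x 0 = u"
proof -
  obtain y where y: "y \<in> \<omega>" using end_nonempty assms by blast
  have "(E ^^ n) (y 0) u \<Longrightarrow> \<exists>x\<in>\<omega>. x 0 = u" for n
  proof (induction n arbitrary: u)
    case 0 then show ?case using y by auto
  next
    case (Suc n)
    then obtain w where "(E ^^ n) (y 0) w" "E w u" by auto
    with Suc.IH obtain x where x: "x \<in> \<omega>" "x 0 = w" by blast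
    show ?case
    proof (cases "u = x 1")
      case True
      then show ?thesis using end_tail[OF assms x(1)] by force
    next
      case False
      then have "case_nat u x \<in> \<omega>" using end_cons[OF assms x(1), of u] \<open>E w u\<close> E_sym x(2) by blast
      then show ?thesis by (rule bexI[rotated]) simp
    qed
  qed
  then show ?thesis using connected by blast
qed

text \<open>Both rays are geodesic from the same vertex, so a common vertex has the same index in
  both; from there, uniqueness of lower neighbours forces agreement back to the start.\<close>

lemma ray_unique:
  assumes "\<omega> \<in> ends E" "x \<in> \<omega>" "y \<in> \<omega>" "x 0 = y 0"
  shows "x = y"
proof -
  have r: "x \<in> rays E" "y \<in> rays E" using assms end_rays by auto
  obtain m n where mn: "\<And>k. x (m + k) = y (n + k)" using end_cofinal assms by metis
  have "m = n" using mn[of 0] raysD(3)[OF r(1), of m] raysD(3)[OF r(2), of n] assms(4) by simp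
  have "x (m - j) = y (m - j)" for j
  proof (induction j)
    case 0 then show ?case using mn[of 0] \<open>m = n\<close> by simp
  next
    case (Suc j)
    show ?case
    proof (cases "j < m")
      case True
      then obtain l where l: "m - j = Suc l" by (metis Suc_diff_Suc)
      have "x l = y l"
        using lower_nbr_unique[of "x (Suc l)" "x l" "y l" "x 0"] Suc l raysD[OF r(1)] raysD[OF r(2)]
          E_sym assms(4) by (metis lessI)
      then show ?thesis using l by (metis Suc_diff_Suc True diff_Suc_Suc diff_Suc_1 diff_commute)
    qed (use Suc in simp)
  qed
  then have "x i = y i" if "i \<le> m" for i using that by (metis diff_diff_cancel)
  then show ?thesis
    using mn \<open>m = n\<close> by (metis ext le_Suc_ex nat_le_linear)
qed

section \<open>Parents and heights relative to an end\<close>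

definition ray :: "(nat \<Rightarrow> 'v) set \<Rightarrow> 'v \<Rightarrow> nat \<Rightarrow> 'v" where
  "ray \<omega> u = (THE x. x \<in> \<omega> \<and> x 0 = u)"

definition up :: "(nat \<Rightarrow> 'v) set \<Rightarrow> 'v \<Rightarrow> 'v" where
  "up \<omega> u = ray \<omega> u 1"

context
  fixes \<omega>
  assumes \<omega>: "\<omega> \<in> ends E"
begin

lemma ray_in: "ray \<omega> u \<in> \<omega>" and ray_0 [simp]: "ray \<omega> u 0 = u"
proof -
  have "\<exists>!x. x \<in> \<omega> \<and> x 0 = u" using ray_from[OF \<omega>] ray_unique[OF \<omega>] by blast
  from theI'[OF this] show "ray \<omega> u \<in> \<omega>" "ray \<omega> u 0 = u" by (auto simp: ray_def)
qed

lemma ray_eqI: "x \<in> \<omega> \<Longrightarrow> x 0 = u \<Longrightarrow> ray \<omega> u = x"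
  using ray_unique[OF \<omega>] ray_in by force

lemma end_directed_iff: "end_directed \<omega> u v \<longleftrightarrow> v = up \<omega> u"
  unfolding end_directed_def up_def using ray_in ray_0 ray_eqI by metis

lemma up_edge: "E u (up \<omega> u)"
  using raysD(1)[OF end_rays[OF \<omega> ray_in], of u 0] by (simp add: up_def)

lemma ray_Suc: "ray \<omega> u (Suc i) = ray \<omega> (up \<omega> u) i"
  using ray_eqI[OF end_tail[OF \<omega> ray_in[of u]]] by (metis One_nat_def up_def)

lemma ray_conv_up: "ray \<omega> u i = (up \<omega> ^^ i) u"
proof (induction i arbitrary: u)
  case (Suc i) then show ?case by (simp add: ray_Suc funpow_swap1)
qed simp

lemma up_inj: "(up \<omega> ^^ i) u = (up \<omega> ^^ j) u \<Longrightarrow> i = j"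
  using injD[OF raysD(4)[OF end_rays[OF \<omega> ray_in[of u]]], of i j] by (simp add: ray_conv_up)

lemma up_up_neq: "up \<omega> (up \<omega> u) \<noteq> u"
  using up_inj[of 2 u 0] by (auto simp: numeral_2_eq_2)

text \<open>If \<open>u\<close> is not the parent of \<open>v\<close>, then \<open>u\<close> may be
  prepended to the ray from \<open>v\<close>, and the result is the ray from
  \<open>u\<close>.\<close>

lemma up_cases: "E u v \<Longrightarrow> v = up \<omega> u \<or> u = up \<omega> v"
proof (cases "u = up \<omega> v")
  case False
  assume "E u v"
  then have "case_nat u (ray \<omega> v) \<in> \<omega>"
    using False by (intro end_cons[OF \<omega> ray_in]) (auto simp: up_def)
  from ray_eqI[OF this] show ?thesis by (simp add: up_def)
qed simp

lemma up_confluent: "\<exists>m n. (up \<omega> ^^ m) u = (up \<omega> ^^ n) v"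
  using end_cofinal[OF \<omega> ray_in[of u] ray_in[of v]] by (metis ray_conv_up add_0_right)

end

text \<open>The Busemann function of the end, normalized at \<open>v0\<close> and increasing towards
  the end. The difference does not depend on the chosen meeting point because the iterates of
  \<open>up\<close> at a vertex are all distinct.\<close>

definition hgt :: "(nat \<Rightarrow> 'v) set \<Rightarrow> 'v \<Rightarrow> int" where
  "hgt \<omega> u = (SOME k. \<exists>m n. (up \<omega> ^^ m) u = (up \<omega> ^^ n) v0 \<and> k = int n - int m)"

context
  fixes \<omega>
  assumes \<omega>: "\<omega> \<in> ends E"
begin

lemma hgt_eqI:
  assumes "(up \<omega> ^^ m) u = (up \<omega> ^^ n) v0"
  shows "hgt \<omega> u = int n - int m"
proof -
  have "\<exists>k m n. (up \<omega> ^^ m) u = (up \<omega> ^^ n) v0 \<and> k = int n - int m"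
    using assms by blast
  from someI_ex[OF this] obtain m' n' where *: "(up \<omega> ^^ m') u = (up \<omega> ^^ n') v0"
    "hgt \<omega> u = int n' - int m'" unfolding hgt_def by auto
  have "(up \<omega> ^^ (m' + n)) v0 = (up \<omega> ^^ (m' + m)) u" using assms by (simp add: funpow_add)
  also have "\<dots> = (up \<omega> ^^ (m + n')) v0" using *(1) by (simp add: funpow_add add.commute[of m' m])
  finally have "m' + n = m + n'" by (rule up_inj[OF \<omega>])
  then show ?thesis using *(2) by simp
qed

lemma hgt_obtain:
  obtains m n where "(up \<omega> ^^ m) u = (up \<omega> ^^ n) v0" "hgt \<omega> u = int n - int m"
  using up_confluent[OF \<omega>] hgt_eqI by metis

lemma hgt_v0 [simp]: "hgt \<omega> v0 = 0"
  using hgt_eqI[of 0 v0 0] by simp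

lemma hgt_up [simp]: "hgt \<omega> (up \<omega> u) = hgt \<omega> u + 1"
proof -
  obtain m n where mn: "(up \<omega> ^^ m) (up \<omega> u) = (up \<omega> ^^ n) v0" "hgt \<omega> (up \<omega> u) = int n - int m"
    by (rule hgt_obtain)
  then have "(up \<omega> ^^ Suc m) u = (up \<omega> ^^ n) v0" by (simp add: funpow_swap1)
  from hgt_eqI[OF this] show ?thesis using mn(2) by simp
qed

text \<open>Both vertices are moved up to a common point of the ray from \<open>v0\<close>; equal
  heights make the numbers of iterations equal.\<close>

lemma same_hgt_meet:
  assumes "hgt \<omega> u = hgt \<omega> v"
  shows "\<exists>m. (up \<omega> ^^ m) u = (up \<omega> ^^ m) v"
proof -
  obtain a c where a: "(up \<omega> ^^ a) u = (up \<omega> ^^ c) v0" "hgt \<omega> u = int c - int a" by (rule hgt_obtain)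
  obtain b d where b: "(up \<omega> ^^ b) v = (up \<omega> ^^ d) v0" "hgt \<omega> v = int d - int b" by (rule hgt_obtain)
  have eq: "d + a = c + b" using a b assms by simp
  have "(up \<omega> ^^ (d + a)) u = (up \<omega> ^^ (c + d)) v0"
    using a(1) by (simp add: funpow_add add.commute[of c d])
  also have "\<dots> = (up \<omega> ^^ (c + b)) v" using b(1) by (simp add: funpow_add)
  finally show ?thesis unfolding eq by blast
qed

lemma hgt_walk: "(E ^^ n) v0 v \<Longrightarrow> \<bar>hgt \<omega> v\<bar> \<le> int n \<and> even (int n + hgt \<omega> v)"
proof (induction n arbitrary: v)
  case (Suc n)
  then obtain w where w: "(E ^^ n) v0 w" "E w v" by auto
  then consider "hgt \<omega> v = hgt \<omega> w + 1" | "hgt \<omega> w = hgt \<omega> v + 1"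
    using up_cases[OF \<omega> w(2)] hgt_up by metis
  then show ?case using Suc.IH[OF w(1)] by cases auto
qed simp

lemma sum_nbrs:
  "(\<Sum>w | E v w. f w) = f (up \<omega> v) + (\<Sum>w | E v w \<and> w \<noteq> up \<omega> v. f w :: real)"
proof -
  have "{w. E v w} = insert (up \<omega> v) {w. E v w \<and> w \<noteq> up \<omega> v}" using up_edge[OF \<omega>] by auto
  moreover have "finite {w. E v w \<and> w \<noteq> up \<omega> v}"
    by (rule finite_subset[OF _ finite_nbrs[of v]]) auto
  ultimately show ?thesis by (metis (mono_tags, lifting) mem_Collect_eq sum.insert)
qed

lemma finite_children [simp]: "finite {w. E v w \<and> w \<noteq> up \<omega> v}"
  by (rule finite_subset[OF _ finite_nbrs[of v]]) auto

lemma card_children: "card {w. E v w \<and> w \<noteq> up \<omega> v} = q"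
proof -
  have "{w. E v w \<and> w \<noteq> up \<omega> v} = {w. E v w} - {up \<omega> v}" by auto
  then show ?thesis using card_nbrs up_edge[OF \<omega>, of v] by simp
qed

lemma child_iff: "E v w \<and> w \<noteq> up \<omega> v \<longleftrightarrow> up \<omega> w = v"
  using up_cases[OF \<omega>] up_edge[OF \<omega>] up_up_neq[OF \<omega>] E_sym by metis

end

subsection \<open>Finite paths and cylinders\<close>

abbreviation "FP \<equiv> finite_paths E v0"
abbreviation "PT \<equiv> path_topology E v0"
abbreviation "cyl \<equiv> cylinder E v0"
abbreviation "PS \<equiv> paths E v0"

definition prefix :: "(nat \<Rightarrow> nat \<times> 'v) \<Rightarrow> nat \<Rightarrow> (nat \<times> 'v) list" where
  "prefix w n = map w [0..<Suc n]"

lemma length_prefix [simp]: "length (prefix w n) = Suc n"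
  by (simp add: prefix_def)

lemma nth_prefix [simp]: "i \<le> n \<Longrightarrow> prefix w n ! i = w i"
  by (simp add: prefix_def del: upt_Suc)

lemma prefix_Suc: "prefix w (Suc n) = prefix w n @ [w (Suc n)]"
  by (simp add: prefix_def)

lemma last_prefix [simp]: "last (prefix w n) = w n"
  by (simp add: prefix_def)

lemma FP_init [simp]: "[(0, v0)] \<in> FP"
  by (simp add: finite_paths_def)

lemma FP_nonempty: "p \<in> FP \<Longrightarrow> p \<noteq> []"
  by (simp add: finite_paths_def)

lemma FP_snocD:
  assumes "p @ [x] \<in> FP" "p \<noteq> []"
  shows "p \<in> FP" "dyn_prec E v0 (last p) x"
  using assms by (auto simp: finite_paths_def successively_append_iff)

lemma FP_last: "p \<in> FP \<Longrightarrow> (E ^^ (length p - 1)) v0 (snd (last p)) \<and> fst (last p) = length p - 1"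
proof (induction p rule: rev_induct)
  case (snoc x p)
  show ?case
  proof (cases "p = []")
    case True then show ?thesis using snoc by (auto simp: finite_paths_def)
  next
    case False
    then obtain k where k: "length p = Suc k" by (cases p) auto
    show ?thesis using FP_snocD[OF snoc.prems False] snoc.IH k by (auto simp: dyn_prec_def)
  qed
qed (simp add: finite_paths_def)

lemma FP_walk: "p \<in> FP \<Longrightarrow> (E ^^ (fst (last p))) v0 (snd (last p))"
  using FP_last by metis

lemma FP_snoc:
  assumes "p \<in> FP" "E (snd (last p)) w"
  shows "p @ [(Suc (fst (last p)), w)] \<in> FP"
proof -
  have "dyn_prec E v0 (last p) (Suc (fst (last p)), w)"
    using FP_walk[OF assms(1)] assms(2) by (auto simp: dyn_prec_def dyn_verts_def intro: prod.expand)
  then show ?thesis using assms(1) by (auto simp: finite_paths_def successively_append_iff)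
qed

lemma FP_induct [consumes 1, case_names init snoc]:
  assumes "p \<in> FP" "P [(0, v0)]"
    "\<And>p w. p \<in> FP \<Longrightarrow> P p \<Longrightarrow> E (snd (last p)) w \<Longrightarrow> P (p @ [(Suc (fst (last p)), w)])"
  shows "P p"
  using assms(1)
proof (induction p rule: rev_induct)
  case (snoc x p)
  show ?case
  proof (cases "p = []")
    case True then show ?thesis using snoc assms(2) by (auto simp: finite_paths_def)
  next
    case False
    note * = FP_snocD[OF snoc.prems False]
    then have "x = (Suc (fst (last p)), snd x)" "E (snd (last p)) (snd x)"
      by (auto simp: dyn_prec_def intro: prod.expand)
    then show ?thesis using assms(3)[of p "snd x"] * snoc.IH by metis
  qed
qed (simp add: finite_paths_def)

lemma ex_FP: "(E ^^ n) v0 v \<Longrightarrow> \<exists>p\<in>FP. last p = (n, v)"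
proof (induction n arbitrary: v)
  case 0 then show ?case using FP_init by (metis last_ConsL relpowp_0_E)
next
  case (Suc n)
  then obtain w where "(E ^^ n) v0 w" "E w v" by auto
  with Suc.IH obtain p where "p \<in> FP" "last p = (n, w)" by blast
  then show ?case using FP_snoc[of p v] \<open>E w v\<close> by (intro bexI[of _ "p @ [(Suc n, v)]"]) auto
qed

lemma FP_length: "p \<in> FP \<Longrightarrow> length p = Suc (fst (last p))"
  using FP_last[of p] FP_nonempty[of p] by (cases p) auto

lemma FP_nth: "p \<in> FP \<Longrightarrow> i < length p \<Longrightarrow> fst (p ! i) = i"
  by (induction p arbitrary: i rule: FP_induct) (auto simp: nth_append FP_length less_Suc_eq)

lemma hd_prefix [simp]: "hd (prefix w n) = w 0"
  by (induction n) (auto simp: prefix_def hd_append)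

lemma prefix_nonempty [simp]: "prefix w n \<noteq> []"
  by (simp add: prefix_def)

lemma prefix_FP: "w \<in> PS \<Longrightarrow> prefix w n \<in> FP"
proof (induction n)
  case 0 then show ?case by (simp add: prefix_def paths_def)
next
  case (Suc n)
  have "w 0 = (0, v0)" "dyn_prec E v0 (w n) (w (Suc n))" using Suc.prems by (auto simp: paths_def)
  then show ?case
    using Suc by (simp add: prefix_Suc finite_paths_def successively_append_iff)
qed

lemma paths_walk: "w \<in> PS \<Longrightarrow> fst (w n) = n \<and> (E ^^ n) v0 (snd (w n))"
  using FP_last[OF prefix_FP, of w n] by simp

lemma cyl_subset: "cyl p \<subseteq> PS"
  by (auto simp: cylinder_def)

lemma cyl_init [simp]: "cyl [(0, v0)] = PS"
  by (auto simp: cylinder_def paths_def)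

lemma in_cyl_prefix: "w \<in> PS \<Longrightarrow> w \<in> cyl (prefix w n)"
  by (auto simp: cylinder_def)

lemma in_cyl_iff:
  assumes "p \<in> FP"
  shows "w \<in> cyl p \<longleftrightarrow> w \<in> PS \<and> prefix w (fst (last p)) = p"
  by (auto simp: cylinder_def list_eq_iff_nth_eq FP_length[OF assms] less_Suc_eq_le)

lemma prefix_mono: "n \<le> m \<Longrightarrow> cyl (prefix w m) \<subseteq> cyl (prefix w n)"
  by (auto simp: cylinder_def)

text \<open>Prefixes of a common path are comparable, so cylinders are nested or disjoint. Together
  with the empty set they become an intersection-stable generator.\<close>

lemma cyl_Int:
  assumes "p \<in> FP" "p' \<in> FP"
  shows "cyl p \<inter> cyl p' \<in> {cyl p, cyl p', {}}"
proof (cases "cyl p \<inter> cyl p' = {}")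
  case False
  then obtain w where w: "prefix w (fst (last p)) = p" "prefix w (fst (last p')) = p'"
    using assms by (auto simp: in_cyl_iff)
  have "cyl p \<subseteq> cyl p' \<or> cyl p' \<subseteq> cyl p"
    using prefix_mono w nat_le_linear[of "fst (last p)" "fst (last p')"] by metis
  then show ?thesis by blast
qed simp

lemma cyl_split:
  assumes "p \<in> FP"
  shows "cyl p = (\<Union>w\<in>{w. E (snd (last p)) w}. cyl (p @ [(Suc (fst (last p)), w)]))" (is "_ = ?R")
proof
  show "?R \<subseteq> cyl p" by (auto simp: cylinder_def nth_append)
  show "cyl p \<subseteq> ?R"
  proof
    fix x assume x: "x \<in> cyl p"
    define n where "n = fst (last p)"
    have "prefix x n = p" "x \<in> PS" using x assms by (auto simp: in_cyl_iff n_def)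
    then have p: "prefix x (Suc n) = p @ [x (Suc n)]" "last p = x n"
      by (auto simp: prefix_Suc)
    have d: "dyn_prec E v0 (x n) (x (Suc n))" using \<open>x \<in> PS\<close> by (auto simp: paths_def)
    then have "x (Suc n) = (Suc (fst (last p)), snd (x (Suc n)))" "E (snd (last p)) (snd (x (Suc n)))"
      using p by (auto simp: dyn_prec_def intro: prod.expand)
    then show "x \<in> ?R"
      using in_cyl_prefix[OF \<open>x \<in> PS\<close>, of "Suc n"] p by (metis (no_types, lifting) UN_I mem_Collect_eq)
  qed
qed

lemma cyl_split_disjoint:
  assumes "p \<in> FP"
  shows "disjoint_family_on (\<lambda>w. cyl (p @ [(Suc (fst (last p)), w)])) A"
  by (auto simp: disjoint_family_on_def cylinder_def)

lemma countable_vertices: "countable (UNIV :: 'v set)"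
proof -
  have fin: "finite {v. (E ^^ n) v0 v}" for n
  proof (induction n)
    case (Suc n)
    have "{v. (E ^^ Suc n) v0 v} = (\<Union>u\<in>{v. (E ^^ n) v0 v}. {w. E u w})" by auto
    then show ?case using Suc by simp
  qed simp
  have "UNIV = (\<Union>n. {v. (E ^^ n) v0 v})" using connected by auto
  then show ?thesis using countable_UN[of UNIV "\<lambda>n. {v. (E ^^ n) v0 v}"] countable_finite[OF fin] by simp
qed

lemma countable_FP: "countable FP"
proof -
  have "countable (UNIV \<times> UNIV :: (nat \<times> 'v) set)" using countable_vertices by (intro countable_SIGMA) auto
  then have "countable (lists (UNIV :: (nat \<times> 'v) set))" by (intro countable_lists) simp
  then show ?thesis by (rule countable_subset[rotated]) auto
qed

lemma finite_FP_level: "finite {p \<in> FP. length p = Suc n}"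
proof (induction n)
  case 0
  have "{p \<in> FP. length p = Suc 0} \<subseteq> {[(0, v0)]}"
    by (auto simp: finite_paths_def length_Suc_conv)
  then show ?case by (rule finite_subset) simp
next
  case (Suc n)
  have "{p \<in> FP. length p = Suc (Suc n)} \<subseteq>
    (\<Union>p\<in>{p \<in> FP. length p = Suc n}. (\<lambda>w. p @ [(Suc (fst (last p)), w)]) ` {w. E (snd (last p)) w})"
  proof
    fix p assume "p \<in> {p \<in> FP. length p = Suc (Suc n)}"
    then have "p \<in> FP" "length p = Suc (Suc n)" by auto
    then show "p \<in> (\<Union>p\<in>{p \<in> FP. length p = Suc n}. (\<lambda>w. p @ [(Suc (fst (last p)), w)]) ` {w. E (snd (last p)) w})"
      by (induction rule: FP_induct) auto
  qed
  then show ?case by (rule finite_subset) (use Suc in auto)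
qed

subsection \<open>Measures on the path space\<close>

text \<open>The cylinders around a path shrink with the level, so a finite intersection of
  generators contains a longer one: cylinders are a base, not only a subbase.\<close>

lemma openin_PT_iff: "openin PT U \<longleftrightarrow> U \<subseteq> PS \<and> (\<forall>w\<in>U. \<exists>n. cyl (prefix w n) \<subseteq> U)"
proof
  assume "openin PT U"
  then have "generate_topology_on (cyl ` FP) U"
    by (simp add: path_topology_def openin_topology_generated_by)
  then show "U \<subseteq> PS \<and> (\<forall>w\<in>U. \<exists>n. cyl (prefix w n) \<subseteq> U)"
  proof induction
    case (Int a b)
    have "\<exists>n. cyl (prefix w n) \<subseteq> a \<inter> b" if w: "w \<in> a \<inter> b" for w
    proof -
      obtain n m where "cyl (prefix w n) \<subseteq> a" "cyl (prefix w m) \<subseteq> b" using Int w by blast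
      then have "cyl (prefix w (max n m)) \<subseteq> a \<inter> b"
        using prefix_mono[of n "max n m" w] prefix_mono[of m "max n m" w] by auto
      then show ?thesis by blast
    qed
    then show ?case using Int by blast
  next
    case (UN K) then show ?case by (meson Sup_le_iff UnionE Union_upper subset_trans)
  next
    case (Basis s)
    then obtain p where p: "p \<in> FP" "s = cyl p" by auto
    then show ?case using cyl_subset in_cyl_iff by (metis subset_refl)
  qed auto
next
  assume *: "U \<subseteq> PS \<and> (\<forall>w\<in>U. \<exists>n. cyl (prefix w n) \<subseteq> U)"
  have "U = \<Union>{cyl p |p. p \<in> FP \<and> cyl p \<subseteq> U}"
    using * prefix_FP in_cyl_prefix by fastforce
  moreover have "openin PT (\<Union>{cyl p |p. p \<in> FP \<and> cyl p \<subseteq> U})"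
    by (intro openin_Union) (auto simp: path_topology_def intro!: topology_generated_by_Basis)
  ultimately show "openin PT U" by simp
qed

lemma openin_cyl: "p \<in> FP \<Longrightarrow> openin PT (cyl p)"
  by (auto simp: path_topology_def intro!: topology_generated_by_Basis)

lemma topspace_PT [simp]: "topspace PT = PS"
proof -
  have "(\<Union>p\<in>FP. cyl p) = PS" using cyl_subset cyl_init FP_init by blast
  then show ?thesis by (simp add: path_topology_def)
qed

text \<open>There are countably many finite paths, so every open set is a countable union of
  cylinders.\<close>

lemma sigma_sets_open: "sigma_sets PS {U. openin PT U} = sigma_sets PS (cyl ` FP)"
proof (rule sigma_sets_eqI)
  fix U assume "U \<in> {U. openin PT U}"
  then have "U = (\<Union>p\<in>{p \<in> FP. cyl p \<subseteq> U}. cyl p)"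
    using prefix_FP in_cyl_prefix by (fastforce simp: openin_PT_iff)
  moreover have "(\<Union>p\<in>{p \<in> FP. cyl p \<subseteq> U}. cyl p) \<in> sigma_sets PS (cyl ` FP)"
    using countable_FP by (intro sigma_sets_UNION countable_image) (auto intro: countable_subset)
  ultimately show "U \<in> sigma_sets PS (cyl ` FP)" by simp
qed (auto intro: openin_cyl)

lemma borel_iff:
  "M \<in> borel_prob_measures PT \<longleftrightarrow> prob_space M \<and> sets M = sigma_sets PS (cyl ` FP)"
proof -
  have "sets (sigma PS {U. openin PT U}) = sigma_sets PS (cyl ` FP)"
    by (subst sets_measure_of) (auto simp: sigma_sets_open openin_PT_iff)
  then show ?thesis by (simp add: borel_prob_measures_def)
qed

lemma borelD:
  assumes "M \<in> borel_prob_measures PT"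
  shows "prob_space M" "sets M = sigma_sets PS (cyl ` FP)" "space M = PS" "p \<in> FP \<Longrightarrow> cyl p \<in> sets M"
proof -
  show 1: "prob_space M" "sets M = sigma_sets PS (cyl ` FP)" using assms by (auto simp: borel_iff)
  show "p \<in> FP \<Longrightarrow> cyl p \<in> sets M" using 1 by auto
  have "space M \<in> sigma_sets PS (cyl ` FP)" using 1 by (metis sets.top)
  then have "space M \<subseteq> PS" using sigma_sets_into_sp[of "cyl ` FP" PS] cyl_subset by blast
  moreover have "PS \<in> sets M" using 1 sigma_sets_top by metis
  ultimately show "space M = PS" using sets.sets_into_space by blast
qed

lemma Int_stable_cyl: "Int_stable (insert {} (cyl ` FP))"
  using cyl_Int by (intro Int_stableI) fastforce

lemma sigma_sets_insert_empty: "sigma_sets PS (insert {} (cyl ` FP)) = sigma_sets PS (cyl ` FP)"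
  by (rule sigma_sets_eqI) (auto intro: sigma_sets.Empty)

lemma borel_eqI:
  assumes M: "M \<in> borel_prob_measures PT" and N: "N \<in> borel_prob_measures PT"
    and eq: "\<And>p. p \<in> FP \<Longrightarrow> measure M (cyl p) = measure N (cyl p)"
  shows "M = N"
proof (rule measure_eqI_generator_eq[OF Int_stable_cyl, where \<Omega> = PS and A = "\<lambda>_. PS"])
  interpret M: prob_space M using borelD(1)[OF M] .
  interpret N: prob_space N using borelD(1)[OF N] .
  show "insert {} (cyl ` FP) \<subseteq> Pow PS" using cyl_subset by auto
  show "\<And>X. X \<in> insert {} (cyl ` FP) \<Longrightarrow> emeasure M X = emeasure N X"
    using eq by (auto simp: M.emeasure_eq_measure N.emeasure_eq_measure)
  show "sets M = sigma_sets PS (insert {} (cyl ` FP))" "sets N = sigma_sets PS (insert {} (cyl ` FP))"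
    using borelD(2) M N by (auto simp: sigma_sets_insert_empty)
  show "range (\<lambda>_::nat. PS) \<subseteq> insert {} (cyl ` FP)" using cyl_init FP_init by blast
qed (auto simp: finite_measure.emeasure_eq_measure[OF prob_space.finite_measure[OF borelD(1)[OF M]]])

text \<open>The identity is linear in the measures and survives complements and disjoint countable
  unions, so Dynkin's argument extends it from cylinders to all measurable sets.\<close>

lemma borel_mixture:
  assumes M: "M \<in> borel_prob_measures PT" and N: "N \<in> borel_prob_measures PT"
    and L: "L \<in> borel_prob_measures PT"
    and eq: "\<And>p. p \<in> FP \<Longrightarrow> measure L (cyl p) = t * measure M (cyl p) + (1 - t) * measure N (cyl p)"
    and A: "A \<in> sets L"
  shows "measure L A = t * measure M A + (1 - t) * measure N A"
proof -
  interpret M: prob_space M using borelD(1)[OF M] .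
  interpret N: prob_space N using borelD(1)[OF N] .
  interpret L: prob_space L using borelD(1)[OF L] .
  note sp = borelD(3)[OF M] borelD(3)[OF N] borelD(3)[OF L]
  have ss: "sets M = sigma_sets PS (insert {} (cyl ` FP))" "sets N = sigma_sets PS (insert {} (cyl ` FP))"
    "sets L = sigma_sets PS (insert {} (cyl ` FP))"
    using borelD(2) M N L by (auto simp: sigma_sets_insert_empty)
  have A': "A \<in> sigma_sets PS (insert {} (cyl ` FP))" using A ss by simp
  have "insert {} (cyl ` FP) \<subseteq> Pow PS" using cyl_subset by auto
  from Int_stable_cyl this A' show ?thesis
  proof (induction rule: sigma_sets_induct_disjoint)
    case (basic A) then show ?case using eq by auto
  next
    case (compl A)
    have "A \<in> sets M" "A \<in> sets N" "A \<in> sets L" using ss compl by auto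
    then have d: "measure M (PS - A) = 1 - measure M A" "measure N (PS - A) = 1 - measure N A"
      "measure L (PS - A) = 1 - measure L A"
      using M.prob_compl[of A] N.prob_compl[of A] L.prob_compl[of A] sp by auto
    show ?case unfolding d compl.IH by (simp add: algebra_simps)
  next
    case (union A)
    have r: "range A \<subseteq> sets M" "range A \<subseteq> sets N" "range A \<subseteq> sets L" using ss union by auto
    have "(\<lambda>i. measure L (A i)) sums measure L (\<Union>i. A i)"
      using L.finite_measure_UNION[OF r(3)] union by auto
    moreover have "(\<lambda>i. t * measure M (A i) + (1 - t) * measure N (A i)) sums
        (t * measure M (\<Union>i. A i) + (1 - t) * measure N (\<Union>i. A i))"
      using M.finite_measure_UNION[OF r(1)] N.finite_measure_UNION[OF r(2)] union
      by (intro sums_add sums_mult) auto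
    ultimately show ?case using union by (auto dest: sums_unique2)
  qed simp
qed

subsection \<open>Central measures and harmonic functions\<close>

text \<open>Only vertices of the dynamic graph are constrained; at pairs without a walk of length
  \<open>n\<close> the values are arbitrary, so functions are compared only on the pairs with a
  walk.\<close>

definition harmonic :: "(nat \<Rightarrow> 'v \<Rightarrow> real) \<Rightarrow> bool" where
  "harmonic h \<longleftrightarrow> (\<forall>n v. (E ^^ n) v0 v \<longrightarrow> 0 \<le> h n v \<and> h n v = (\<Sum>w | E v w. h (Suc n) w))"

definition represents :: "(nat \<Rightarrow> nat \<times> 'v) measure \<Rightarrow> (nat \<Rightarrow> 'v \<Rightarrow> real) \<Rightarrow> bool" where
  "represents M h \<longleftrightarrow> M \<in> borel_prob_measures PT \<and>
     (\<forall>p\<in>FP. measure M (cyl p) = h (fst (last p)) (snd (last p)))"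

lemma harmonic_nonneg: "harmonic h \<Longrightarrow> (E ^^ n) v0 v \<Longrightarrow> 0 \<le> h n v"
  and harmonic_sum: "harmonic h \<Longrightarrow> (E ^^ n) v0 v \<Longrightarrow> h n v = (\<Sum>w | E v w. h (Suc n) w)"
  unfolding harmonic_def by blast+

lemma harmonic_edge_le:
  assumes "harmonic h" "(E ^^ n) v0 v" "E v w"
  shows "h (Suc n) w \<le> h n v"
proof -
  have "0 \<le> h (Suc n) u" if "E v u" for u
    using that assms(1,2) harmonic_nonneg relpowp_Suc_I by metis
  then have "h (Suc n) w \<le> (\<Sum>w | E v w. h (Suc n) w)"
    using assms by (intro member_le_sum) auto
  then show ?thesis using harmonic_sum assms by metis
qed

text \<open>Centrality makes the mass of a cylinder a function of its endpoint alone, and additivity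
  over the one-step extensions is the harmonic equation.\<close>

lemma central_represents:
  assumes "M \<in> central_measures E v0"
  shows "\<exists>h. harmonic h \<and> h 0 v0 = 1 \<and> represents M h"
proof -
  have M: "M \<in> borel_prob_measures PT" using assms by (simp add: central_measures_def)
  interpret prob_space M using borelD(1)[OF M] .
  define pth where "pth n v = (SOME p. p \<in> FP \<and> last p = (n, v))" for n v
  have pth: "pth n v \<in> FP" "last (pth n v) = (n, v)" if "(E ^^ n) v0 v" for n v
    using someI_ex[of "\<lambda>p. p \<in> FP \<and> last p = (n, v)"] ex_FP[OF that] unfolding pth_def by blast+
  define h where "h n v = measure M (cyl (pth n v))" for n v
  have h: "measure M (cyl p) = h n v" if "p \<in> FP" "last p = (n, v)" for p n v
  proof -
    have "(E ^^ n) v0 v" using FP_walk[OF that(1)] that(2) by simp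
    note nv = pth[OF this]
    have "\<forall>p\<in>FP. \<forall>p'\<in>FP. last p = last p' \<longrightarrow> measure M (cyl p) = measure M (cyl p')"
      using assms unfolding central_measures_def by blast
    from this[rule_format, OF that(1) nv(1)] show ?thesis using nv(2) that(2) by (simp add: h_def)
  qed
  have "h n v = (\<Sum>w | E v w. h (Suc n) w)" if nv: "(E ^^ n) v0 v" for n v
  proof -
    note p = pth[OF nv]
    have "h n v = measure M (\<Union>w\<in>{w. E v w}. cyl (pth n v @ [(Suc n, w)]))"
      using cyl_split[OF p(1)] p by (simp add: h_def)
    also have "\<dots> = (\<Sum>w | E v w. measure M (cyl (pth n v @ [(Suc n, w)])))"
      using cyl_split_disjoint[OF p(1)] p FP_snoc[OF p(1)] borelD(4)[OF M]
      by (intro finite_measure_finite_Union) auto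
    also have "\<dots> = (\<Sum>w | E v w. h (Suc n) w)"
      using FP_snoc[OF p(1)] p by (intro sum.cong refl h) auto
    finally show ?thesis .
  qed
  moreover have nonneg: "0 \<le> h n v" for n v by (simp add: h_def)
  moreover have "h 0 v0 = 1" using h[of "[(0, v0)]" 0 v0] prob_space borelD(3)[OF M] by simp
  ultimately have "harmonic h \<and> h 0 v0 = 1 \<and> represents M h"
    using h M nonneg by (simp add: harmonic_def represents_def sum_nonneg)
  then show ?thesis by blast
qed

lemma represents_central: "represents M h \<Longrightarrow> M \<in> central_measures E v0"
  by (auto simp: represents_def central_measures_def)

lemma represents_unique: "represents M h \<Longrightarrow> represents N h \<Longrightarrow> M = N"
  by (intro borel_eqI) (auto simp: represents_def)

lemma represents_cong:
  assumes "\<And>n v. (E ^^ n) v0 v \<Longrightarrow> h n v = g n v"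
  shows "represents M h \<longleftrightarrow> represents M g"
  using assms FP_walk by (simp add: represents_def)

lemma represents_D: "represents M h \<Longrightarrow> p \<in> FP \<Longrightarrow> last p = (n, v) \<Longrightarrow> measure M (cyl p) = h n v"
  by (auto simp: represents_def)

text \<open>
  A path is read off from independent choices of a successor at every vertex of the dynamic graph,
  so that the law of the path is a push-forward of a product measure.
\<close>

lemma represents_exists:
  assumes h: "harmonic h" and h0: "h 0 v0 = 1"
  shows "\<exists>M. represents M h"
proof -
  \<comment> \<open>The uniform default at zeros of \<open>h\<close> and at pairs outside the
    dynamic graph makes every \<open>R a\<close> a probability measure, as the product over all
    pairs requires.\<close>
  define T where "T a w = (if (E ^^ fst a) v0 (snd a) \<and> h (fst a) (snd a) \<noteq> 0
    then h (Suc (fst a)) w / h (fst a) (snd a) else 1 / real (q + 1))" for a :: "nat \<times> 'v" and w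
  define R where "R a = point_measure {w. E (snd a) w} (\<lambda>w. ennreal (T a w))" for a :: "nat \<times> 'v"
  have T_nonneg: "0 \<le> T a w" if "E (snd a) w" for a w
    using that harmonic_nonneg[OF h, of "fst a" "snd a"] harmonic_nonneg[OF h, of "Suc (fst a)" w]
    by (auto simp: T_def intro!: divide_nonneg_nonneg)
  have T_sum: "(\<Sum>w | E (snd a) w. T a w) = 1" for a
  proof (cases "(E ^^ fst a) v0 (snd a) \<and> h (fst a) (snd a) \<noteq> 0")
    case True
    then show ?thesis
      using harmonic_sum[OF h, of "fst a" "snd a"] by (simp add: T_def sum_divide_distrib[symmetric])
  next
    case False
    then show ?thesis using card_nbrs by (auto simp: T_def simp del: of_nat_add of_nat_Suc)
  qed
  have R_prob: "prob_space (R a)" for a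
  proof
    have "emeasure (R a) {w. E (snd a) w} = (\<Sum>w | E (snd a) w. ennreal (T a w))"
      unfolding R_def by (subst emeasure_point_measure_finite) auto
    also have "\<dots> = 1" using T_nonneg by (subst sum_ennreal) (auto simp: T_sum)
    finally show "emeasure (R a) (space (R a)) = 1" by (simp add: R_def space_point_measure)
  qed
  have R_sets: "sets (R a) = Pow {w. E (snd a) w}" and R_space: "space (R a) = {w. E (snd a) w}" for a
    by (simp_all add: R_def sets_point_measure space_point_measure)
  interpret product_prob_space R UNIV
    using R_prob by (intro product_prob_spaceI) auto
  let ?P = "PiM UNIV R"
  define G where "G \<omega> = rec_nat (0, v0) (\<lambda>n a. (Suc n, \<omega> a))" for \<omega> :: "nat \<times> 'v \<Rightarrow> 'v"
  have G0: "G \<omega> 0 = (0, v0)" and GS: "G \<omega> (Suc n) = (Suc n, \<omega> (G \<omega> n))" for \<omega> n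
    by (simp_all add: G_def)
  have Gfst: "fst (G \<omega> n) = n" for \<omega> n by (cases n) (simp_all add: G0 GS)
  have Gpath: "G \<omega> \<in> PS" if "\<omega> \<in> space ?P" for \<omega>
  proof -
    have e: "E (snd a) (\<omega> a)" for a using that by (cases a) (auto simp: space_PiM R_space PiE_iff)
    have "(E ^^ n) v0 (snd (G \<omega> n))" for n
    proof (induction n)
      case (Suc n) then show ?case using e[of "G \<omega> n"] by (auto simp: GS)
    qed (simp add: G0)
    then show ?thesis
      using e unfolding paths_def dyn_prec_def dyn_verts_def
      by (auto simp: G0 GS Gfst case_prod_unfold simp del: relpowp.simps) (metis GS relpowp_Suc_I snd_conv)
  qed
  \<comment> \<open>The last vertex is dropped because its successor is not prescribed. The level of
    a vertex is its position in the path, so the vertices are distinct and each one constrains its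
    own coordinate.\<close>
  define emb where "emb p = prod_emb UNIV R (set (butlast p))
    (PiE (set (butlast p)) (\<lambda>a. {snd (p ! Suc (fst a))}))" for p
  have pre: "G -` cyl p \<inter> space ?P = emb p" if p: "p \<in> FP" for p
  proof -
    have b: "set (butlast p) = (!) p ` {..<length p - 1}"
      by (simp add: butlast_conv_take nth_image[symmetric] lessThan_atLeast0)
    have pfst: "fst (p ! i) = i" if "i < length p" for i using FP_nth[OF p that] .
    have p0: "p ! 0 = (0, v0)" using p by (auto simp: finite_paths_def hd_conv_nth)
    have iff: "(\<forall>i<length p. G \<omega> i = p ! i) \<longleftrightarrow> (\<forall>i<length p - 1. \<omega> (p ! i) = snd (p ! Suc i))" (is "?L = ?R") for \<omega>
    proof
      assume ?L
      then show ?R by (auto simp: less_diff_conv) (metis GS Suc_lessD snd_conv)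
    next
      assume R: ?R
      have "i < length p \<Longrightarrow> G \<omega> i = p ! i" for i
      proof (induction i)
        case (Suc i)
        then have "\<omega> (p ! i) = snd (p ! Suc i)" using R by auto
        then show ?case using Suc pfst[of "Suc i"] by (auto simp: GS intro: prod.expand)
      qed (simp add: G0 p0)
      then show ?L by blast
    qed
    have "\<omega> \<in> G -` cyl p \<inter> space ?P \<longleftrightarrow> \<omega> \<in> emb p" for \<omega>
    proof -
      have "\<omega> \<in> G -` cyl p \<inter> space ?P \<longleftrightarrow> \<omega> \<in> space ?P \<and> (\<forall>i<length p - 1. \<omega> (p ! i) = snd (p ! Suc i))"
        using Gpath iff by (auto simp: cylinder_def)
      also have "\<dots> \<longleftrightarrow> \<omega> \<in> emb p"
        using pfst by (auto simp: emb_def prod_emb_def space_PiM b PiE_iff)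
      finally show ?thesis .
    qed
    then show ?thesis by blast
  qed
  have edge: "E (snd a) (snd (p ! Suc (fst a)))" if p: "p \<in> FP" "a \<in> set (butlast p)" for p a
    using that
  proof (induction p rule: FP_induct)
    case (snoc p w)
    have l: "fst (last p) = length p - 1" "p \<noteq> []" using FP_last[of p] FP_nonempty snoc by auto
    have set: "set p = insert (last p) (set (butlast p))"
      using l(2) by (metis append_butlast_last_id rotate1.simps(2) set_rotate1 list.simps(15))
    have *: "fst a < length p - 1" if "a \<in> set (butlast p)" for a
      using that FP_nth[OF snoc(1)] by (auto simp: set_conv_nth nth_butlast)
    show ?case
    proof (cases "a \<in> set (butlast p)")
      case True
      then have "Suc (fst a) < length p" using *[of a] by linarith
      then show ?thesis using snoc.IH True by (simp add: nth_append)
    next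
      case False
      then have "a = last p" using snoc.prems set by auto
      then show ?thesis using l snoc by (auto simp: nth_append)
    qed
  qed simp
  have emb_meas: "emb p \<in> sets ?P" if "p \<in> FP" for p
    unfolding emb_def using edge[OF that] by (intro measurable_prod_emb sets_PiM_I_finite) (auto simp: R_sets)
  have prod_h: "(\<Prod>a\<in>set (butlast p). T a (snd (p ! Suc (fst a)))) = h (fst (last p)) (snd (last p))"
    if "p \<in> FP" for p
    using that
  proof (induction p rule: FP_induct)
    case init then show ?case using h0 by simp
  next
    case (snoc p w)
    have l: "fst (last p) = length p - 1" "p \<noteq> []" using FP_last[of p] FP_nonempty snoc by auto
    have set: "set p = insert (last p) (set (butlast p))"
      using l(2) by (metis append_butlast_last_id rotate1.simps(2) set_rotate1 list.simps(15))
    have *: "Suc (fst a) < length p" if "a \<in> set (butlast p)" for a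
      using that FP_nth[OF snoc(1)] by (auto simp: set_conv_nth nth_butlast)
    let ?p = "p @ [(Suc (fst (last p)), w)]"
    have "(\<Prod>a\<in>set (butlast ?p). T a (snd (?p ! Suc (fst a)))) =
      T (last p) w * (\<Prod>a\<in>set (butlast p). T a (snd (?p ! Suc (fst a))))"
      using l *[of "last p"] by (subst butlast_snoc, subst set, subst prod.insert) (auto simp: nth_append)
    also have "(\<Prod>a\<in>set (butlast p). T a (snd (?p ! Suc (fst a)))) =
      (\<Prod>a\<in>set (butlast p). T a (snd (p ! Suc (fst a))))"
      using * by (intro prod.cong) (auto simp: nth_append)
    also have "\<dots> = h (fst (last p)) (snd (last p))" by (rule snoc.IH)
    also have "T (last p) w * \<dots> = h (Suc (fst (last p))) w"
    proof (cases "h (fst (last p)) (snd (last p)) = 0")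
      \<comment> \<open>Here \<open>T\<close> has its arbitrary default value, which does no harm: a
        harmonic function cannot increase along an edge, so it vanishes at the successor
        too.\<close>
      case True
      then show ?thesis
        using harmonic_edge_le[OF h FP_walk[OF snoc(1)] snoc.hyps(2)]
          harmonic_nonneg[OF h relpowp_Suc_I[OF FP_walk[OF snoc(1)] snoc.hyps(2)]] by simp
    qed (use FP_walk[OF snoc(1)] in \<open>simp add: T_def\<close>)
    finally show ?case by simp
  qed
  let ?M = "distr ?P (sigma PS (cyl ` FP)) G"
  have G_meas: "G \<in> measurable ?P (sigma PS (cyl ` FP))"
    using Gpath pre emb_meas cyl_subset[THEN subsetD] by (intro measurable_measure_of) auto
  have sets_M: "sets ?M = sigma_sets PS (cyl ` FP)"
    using cyl_subset[THEN subsetD] by (subst sets_distr, subst sets_measure_of) auto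
  have "measure ?M (cyl p) = h (fst (last p)) (snd (last p))" if p: "p \<in> FP" for p
  proof -
    have "emeasure ?M (cyl p) = emeasure ?P (emb p)"
      using p sets_M by (subst emeasure_distr[OF G_meas]) (auto simp: pre)
    also have "\<dots> = (\<Prod>a\<in>set (butlast p). emeasure (R a) {snd (p ! Suc (fst a))})"
      unfolding emb_def using edge[OF p] by (intro emeasure_PiM_emb) (auto simp: R_sets)
    also have "\<dots> = (\<Prod>a\<in>set (butlast p). ennreal (T a (snd (p ! Suc (fst a)))))"
      using edge[OF p] by (intro prod.cong refl) (auto simp: R_def emeasure_point_measure_finite)
    also have "\<dots> = ennreal (h (fst (last p)) (snd (last p)))"
      using edge[OF p] T_nonneg prod_h[OF p] by (subst prod_ennreal) auto
    finally show ?thesis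
      using harmonic_nonneg[OF h FP_walk[OF p]] by (simp add: measure_def)
  qed
  moreover have "prob_space ?M" using G_meas by (rule prob_space_distr)
  ultimately have "represents ?M h"
    using sets_M by (auto simp: represents_def borel_iff)
  then show ?thesis by blast
qed

text \<open>Minimality as in Martin boundary theory: \<open>h\<close> spans an extreme ray of the
  cone of nonnegative harmonic functions. The factor is the value at the root, where
  \<open>h\<close> is 1.\<close>

definition minimal :: "(nat \<Rightarrow> 'v \<Rightarrow> real) \<Rightarrow> bool" where
  "minimal h \<longleftrightarrow> harmonic h \<and> h 0 v0 = 1 \<and>
     (\<forall>g C. harmonic g \<longrightarrow> (\<forall>n v. (E ^^ n) v0 v \<longrightarrow> g n v \<le> C * h n v) \<longrightarrow>
       (\<forall>n v. (E ^^ n) v0 v \<longrightarrow> g n v = g 0 v0 * h n v))"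

section \<open>Functions generated by the transition probabilities of an end\<close>

definition step :: "(nat \<Rightarrow> 'v) set \<Rightarrow> real \<Rightarrow> 'v \<Rightarrow> 'v \<Rightarrow> real" where
  "step \<omega> r v w = (if w = up \<omega> v then r else (1 - r) / real q)"

text \<open>All edges into a vertex are covered, so the condition includes that the product of
  transition probabilities does not depend on the path.\<close>

definition follows :: "(nat \<Rightarrow> 'v) set \<Rightarrow> real \<Rightarrow> (nat \<Rightarrow> 'v \<Rightarrow> real) \<Rightarrow> bool" where
  "follows \<omega> r h \<longleftrightarrow> h 0 v0 = 1 \<and>
     (\<forall>n v w. (E ^^ n) v0 v \<longrightarrow> E v w \<longrightarrow> h (Suc n) w = step \<omega> r v w * h n v)"

lemma minimalD:
  assumes "minimal h" "harmonic g" "\<And>n v. (E ^^ n) v0 v \<Longrightarrow> g n v \<le> C * h n v" "(E ^^ n) v0 v"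
  shows "g n v = g 0 v0 * h n v"
  using assms unfolding minimal_def by blast

lemma followsD: "follows \<omega> r h \<Longrightarrow> (E ^^ n) v0 v \<Longrightarrow> E v w \<Longrightarrow> h (Suc n) w = step \<omega> r v w * h n v"
  by (simp add: follows_def)

lemma follows_0: "follows \<omega> r h \<Longrightarrow> h 0 v0 = 1"
  by (simp add: follows_def)

lemma follows_unique:
  assumes "follows \<omega> r h" "follows \<omega> r g" "(E ^^ n) v0 v"
  shows "h n v = g n v"
  using assms(3)
proof (induction n arbitrary: v)
  case 0 then show ?case using follows_0[OF assms(1)] follows_0[OF assms(2)] by auto
next
  case (Suc n)
  then obtain w where "(E ^^ n) v0 w" "E w v" by auto
  then show ?case using Suc.IH followsD[OF assms(1)] followsD[OF assms(2)] by metis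
qed

lemma sum_step:
  assumes "\<omega> \<in> ends E"
  shows "(\<Sum>w | E v w. step \<omega> r v w * f w) =
    r * f (up \<omega> v) + (1 - r) / real q * (\<Sum>w | E v w \<and> w \<noteq> up \<omega> v. f w)"
  by (subst sum_nbrs[OF assms]) (auto simp: step_def sum_distrib_left intro!: sum.cong)

lemma sum_step_1:
  assumes "\<omega> \<in> ends E"
  shows "(\<Sum>w | E v w. step \<omega> r v w) = 1"
  using sum_step[OF assms, where v = v and r = r and f = "\<lambda>_. 1"] q_ge2 card_children[OF assms, of v] by simp

lemma follows_harmonic:
  assumes "\<omega> \<in> ends E" "0 \<le> r" "r \<le> 1" "follows \<omega> r h"
  shows "harmonic h"
proof -
  have pos: "(E ^^ n) v0 v \<Longrightarrow> 0 \<le> h n v" for n v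
  proof (induction n arbitrary: v)
    case 0 then show ?case using follows_0[OF assms(4)] by auto
  next
    case (Suc n)
    then obtain w where w: "(E ^^ n) v0 w" "E w v" by auto
    then show ?case using Suc.IH[OF w(1)] followsD[OF assms(4) w] assms(2,3) by (simp add: step_def)
  qed
  have "h n v = (\<Sum>w | E v w. h (Suc n) w)" if "(E ^^ n) v0 v" for n v
  proof -
    have "(\<Sum>w | E v w. h (Suc n) w) = (\<Sum>w | E v w. step \<omega> r v w * h n v)"
      using followsD[OF assms(4) that] by (intro sum.cong) auto
    also have "\<dots> = h n v" using sum_step_1[OF assms(1)] by (simp add: sum_distrib_right[symmetric])
    finally show ?thesis by simp
  qed
  then show ?thesis using pos unfolding harmonic_def by blast
qed

text \<open>Every path of length \<open>n\<close> from \<open>v0\<close> to a vertex of height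
  \<open>k\<close> has exactly \<open>(n + k) / 2\<close> upward and \<open>(n - k) / 2\<close>
  downward steps. This is why the Markov measure is central.\<close>

definition lam :: "(nat \<Rightarrow> 'v) set \<Rightarrow> real \<Rightarrow> nat \<Rightarrow> 'v \<Rightarrow> real" where
  "lam \<omega> r n v = r ^ nat ((int n + hgt \<omega> v) div 2) * ((1 - r) / real q) ^ nat ((int n - hgt \<omega> v) div 2)"

lemma lam_eqI:
  assumes "hgt \<omega> v = k" "int n + k = 2 * int a" "int n - k = 2 * int b"
  shows "lam \<omega> r n v = r ^ a * ((1 - r) / real q) ^ b"
  using assms by (simp add: lam_def)

lemma lam_follows:
  assumes \<omega>: "\<omega> \<in> ends E"
  shows "follows \<omega> r (lam \<omega> r)"
  unfolding follows_def
proof (intro conjI allI impI)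
  show "lam \<omega> r 0 v0 = 1" by (simp add: lam_def hgt_v0[OF \<omega>])
next
  fix n v w assume n: "(E ^^ n) v0 v" and e: "E v w"
  define k where "k = hgt \<omega> v"
  have k: "\<bar>k\<bar> \<le> int n" "even (int n + k)" using hgt_walk[OF \<omega> n] by (auto simp: k_def)
  define a where "a = nat ((int n + k) div 2)"
  define b where "b = nat ((int n - k) div 2)"
  have ab: "int n + k = 2 * int a" "int n - k = 2 * int b" using k by (auto simp: a_def b_def)
  have v: "lam \<omega> r n v = r ^ a * ((1 - r) / real q) ^ b"
    using lam_eqI ab k_def by metis
  show "lam \<omega> r (Suc n) w = step \<omega> r v w * lam \<omega> r n v"
  proof (cases "w = up \<omega> v")
    case True
    then have w: "hgt \<omega> w = k + 1" using hgt_up[OF \<omega>] by (simp add: k_def)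
    have "int (Suc n) + (k + 1) = 2 * int (Suc a)" "int (Suc n) - (k + 1) = 2 * int b" using ab by auto
    from lam_eqI[OF w this] have "lam \<omega> r (Suc n) w = r ^ Suc a * ((1 - r) / real q) ^ b" .
    then show ?thesis using True v by (simp add: step_def)
  next
    case False
    then have "up \<omega> w = v" using child_iff[OF \<omega>] e by blast
    then have w: "hgt \<omega> w = k - 1" using hgt_up[OF \<omega>, of w] by (simp add: k_def)
    have "int (Suc n) + (k - 1) = 2 * int a" "int (Suc n) - (k - 1) = 2 * int (Suc b)" using ab by auto
    from lam_eqI[OF w this] have "lam \<omega> r (Suc n) w = r ^ a * ((1 - r) / real q) ^ Suc b" .
    then show ?thesis using False v by (simp add: step_def)
  qed
qed

subsection \<open>The functions \<open>lam \<omega> r\<close> are minimal\<close>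

text \<open>Downward steps have probability 0, so domination by \<open>h\<close> makes
  \<open>g\<close> vanish after them, and the harmonic equation then determines \<open>g\<close>
  along upward steps. Since \<open>h\<close> has zeros, this case cannot be treated by dividing by
  \<open>h\<close>.\<close>

lemma follows_1_minimal:
  assumes \<omega>: "\<omega> \<in> ends E" and h: "follows \<omega> 1 h"
  shows "minimal h"
proof -
  have "g n v = g 0 v0 * h n v"
    if g: "harmonic g" and le: "\<forall>n v. (E ^^ n) v0 v \<longrightarrow> g n v \<le> C * h n v" and nv: "(E ^^ n) v0 v" for g C n v
    using nv
  proof (induction n arbitrary: v)
    case 0 then show ?case using follows_0[OF h] by auto
  next
    case (Suc n)
    then obtain u where u: "(E ^^ n) v0 u" "E u v" by auto
    have 0: "h (Suc n) w = 0 \<and> g (Suc n) w = 0" if w: "E u w" "w \<noteq> up \<omega> u" for w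
    proof -
      have Dw: "(E ^^ Suc n) v0 w" using u(1) w(1) by (rule relpowp_Suc_I)
      have "h (Suc n) w = 0" using followsD[OF h u(1) w(1)] w(2) by (simp add: step_def)
      then show ?thesis using le[rule_format, OF Dw] harmonic_nonneg[OF g Dw] by simp
    qed
    show ?case
    proof (cases "v = up \<omega> u")
      case True
      have "g n u = g (Suc n) (up \<omega> u)"
        using harmonic_sum[OF g u(1)] sum_nbrs[OF \<omega>, of "g (Suc n)" u] 0 by simp
      moreover have "h (Suc n) v = h n u" using followsD[OF h u] True by (simp add: step_def)
      ultimately show ?thesis using Suc.IH[OF u(1)] True by simp
    next
      case False
      then show ?thesis using 0 u(2) by simp
    qed
  qed
  then show ?thesis
    using follows_harmonic[OF \<omega> _ _ h] h unfolding minimal_def follows_def by simp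
qed

text \<open>The chain is run from two vertices of one level at once. Matching their upward and
  downward steps shows that \<open>u\<close> depends only on level and height; letting them step
  independently removes the height; the harmonic equation then removes the level.\<close>

lemma bounded_harmonic_const:
  assumes \<omega>: "\<omega> \<in> ends E" and r: "1 / 2 \<le> r" "r < 1"
    and bnd: "\<And>n v. (E ^^ n) v0 v \<Longrightarrow> 0 \<le> u n v \<and> u n v \<le> B"
    and har: "\<And>n v. (E ^^ n) v0 v \<Longrightarrow> u n v = (\<Sum>w | E v w. step \<omega> r v w * u (Suc n) w)"
    and nv: "(E ^^ n) v0 v"
  shows "u n v = u 0 v0"
proof -
  note upE = up_edge[OF \<omega>]
  have D0: "(E ^^ 0) v0 v0" by simp
  have har': "u n v = r * u (Suc n) (up \<omega> v) + (1 - r) / real q * (\<Sum>w | E v w \<and> w \<noteq> up \<omega> v. u (Suc n) w)"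
    if "(E ^^ n) v0 v" for n v
    using har[OF that] sum_step[OF \<omega>] by simp
  define S where "S m = {(n, v, w). (E ^^ n) v0 v \<and> (E ^^ n) v0 w \<and> (up \<omega> ^^ m) v = (up \<omega> ^^ m) w}" for m
  define d where "d m = (SUP (n, v, w)\<in>S m. \<bar>u n v - u n w\<bar>)" for m
  have bdd: "bdd_above ((\<lambda>(n, v, w). \<bar>u n v - u n w\<bar>) ` A)"
    if "\<And>n v w. (n, v, w) \<in> A \<Longrightarrow> (E ^^ n) v0 v \<and> (E ^^ n) v0 w" for A
  proof (rule bdd_aboveI2[where M = B], clarify)
    fix n v w assume "(n, v, w) \<in> A"
    then show "\<bar>u n v - u n w\<bar> \<le> B" using that[of n v w] bnd[of n v] bnd[of n w] by auto
  qed
  have d_upper: "\<bar>u n v - u n w\<bar> \<le> d m"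
    if "(E ^^ n) v0 v" "(E ^^ n) v0 w" "(up \<omega> ^^ m) v = (up \<omega> ^^ m) w" for n v w m
    unfolding d_def by (rule cSUP_upper2[OF bdd, where x = "(n, v, w)"]) (use that in \<open>auto simp: S_def\<close>)
  have d_least: "d m \<le> c"
    if "\<And>n v w. (E ^^ n) v0 v \<Longrightarrow> (E ^^ n) v0 w \<Longrightarrow> (up \<omega> ^^ m) v = (up \<omega> ^^ m) w \<Longrightarrow> \<bar>u n v - u n w\<bar> \<le> c"
    for m c
    unfolding d_def
  proof (rule cSUP_least)
    show "S m \<noteq> {}" using D0 unfolding S_def by blast
  qed (use that in \<open>auto simp: S_def\<close>)
  have d_nonneg: "0 \<le> d m" for m using d_upper[OF D0 D0, of m] by simp
  have d_B: "d m \<le> B" for m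
  proof (rule d_least)
    fix n v w assume "(E ^^ n) v0 v" "(E ^^ n) v0 w"
    then show "\<bar>u n v - u n w\<bar> \<le> B" using bnd[of n v] bnd[of n w] by auto
  qed
  \<comment> \<open>Passing to both parents brings the common ancestor one generation nearer,
    passing to children one generation further away, and there any child of \<open>v\<close> may be
    paired with any child of \<open>w\<close>.\<close>
  have d_conv: "d (Suc m) \<le> r * d m + (1 - r) * d (Suc (Suc m))" for m
  proof (rule d_least)
    fix n v w assume v: "(E ^^ n) v0 v" and w: "(E ^^ n) v0 w" and eq: "(up \<omega> ^^ Suc m) v = (up \<omega> ^^ Suc m) w"
    let ?cv = "\<Sum>x | E v x \<and> x \<noteq> up \<omega> v. u (Suc n) x" and ?cw = "\<Sum>x | E w x \<and> x \<noteq> up \<omega> w. u (Suc n) x"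
    have 1: "\<bar>u (Suc n) (up \<omega> v) - u (Suc n) (up \<omega> w)\<bar> \<le> d m"
      using relpowp_Suc_I[OF v upE] relpowp_Suc_I[OF w upE] eq
      by (intro d_upper) (auto simp: funpow_swap1)
    have 2: "\<bar>?cv - ?cw\<bar> \<le> real (card {x. E v x \<and> x \<noteq> up \<omega> v}) * d (Suc (Suc m))"
    proof (rule sum_diff_le_equal_card)
      fix a b assume "a \<in> {x. E v x \<and> x \<noteq> up \<omega> v}" "b \<in> {x. E w x \<and> x \<noteq> up \<omega> w}"
      then have ab: "E v a" "E w b" "up \<omega> a = v" "up \<omega> b = w" using child_iff[OF \<omega>] by auto
      then have "(up \<omega> ^^ Suc (Suc m)) a = (up \<omega> ^^ Suc (Suc m)) b"
        using eq by (metis comp_apply funpow_Suc_right)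
      then show "\<bar>u (Suc n) a - u (Suc n) b\<bar> \<le> d (Suc (Suc m))"
        using relpowp_Suc_I[OF v ab(1)] relpowp_Suc_I[OF w ab(2)] by (intro d_upper)
    qed (use finite_children[OF \<omega>] card_children[OF \<omega>] in auto)
    have "u n v - u n w = r * (u (Suc n) (up \<omega> v) - u (Suc n) (up \<omega> w)) + (1 - r) / real q * (?cv - ?cw)"
      using har'[OF v] har'[OF w] by (simp add: algebra_simps)
    then have "\<bar>u n v - u n w\<bar> \<le> \<bar>r * (u (Suc n) (up \<omega> v) - u (Suc n) (up \<omega> w))\<bar> + \<bar>(1 - r) / real q * (?cv - ?cw)\<bar>"
      by (simp only: abs_triangle_ineq)
    also have "\<dots> = r * \<bar>u (Suc n) (up \<omega> v) - u (Suc n) (up \<omega> w)\<bar> + (1 - r) / real q * \<bar>?cv - ?cw\<bar>"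
      using r by (simp add: abs_mult)
    also have "\<dots> \<le> r * d m + (1 - r) / real q * (real q * d (Suc (Suc m)))"
      using 1 2 r card_children[OF \<omega>] by (intro add_mono mult_left_mono) auto
    also have "\<dots> = r * d m + (1 - r) * d (Suc (Suc m))" using q_ge2 by simp
    finally show "\<bar>u n v - u n w\<bar> \<le> r * d m + (1 - r) * d (Suc (Suc m))" .
  qed
  have "d 0 \<le> 0" by (rule d_least) auto
  then have d0: "d m = 0" for m
    using bounded_subconvex_eq_0[OF r, of d B m] d_nonneg d_B d_conv by (meson order_antisym)
  have same: "u n v = u n w" if "(E ^^ n) v0 v" "(E ^^ n) v0 w" "hgt \<omega> v = hgt \<omega> w" for n v w
    using same_hgt_meet[OF \<omega> that(3)] d_upper[OF that(1,2)] d0 by fastforce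
  \<comment> \<open>All children of \<open>v\<close> have the same level and height, hence the same
    value, so a single child stands for all \<open>q\<close> of them.\<close>
  have har2: "u n v = r * u (Suc n) (up \<omega> v) + (1 - r) * u (Suc n) c"
    if v: "(E ^^ n) v0 v" and c: "up \<omega> c = v" for n v c
  proof -
    have "(\<Sum>w | E v w \<and> w \<noteq> up \<omega> v. u (Suc n) w) = (\<Sum>w | E v w \<and> w \<noteq> up \<omega> v. u (Suc n) c)"
    proof (rule sum.cong)
      fix w assume w: "w \<in> {w. E v w \<and> w \<noteq> up \<omega> v}"
      then have "up \<omega> w = v" using child_iff[OF \<omega>] by auto
      then have "hgt \<omega> w = hgt \<omega> c" using hgt_up[OF \<omega>, of w] hgt_up[OF \<omega>, of c] c by simp
      moreover have "E v c" using child_iff[OF \<omega>] c by blast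
      ultimately show "u (Suc n) w = u (Suc n) c"
        using same relpowp_Suc_I[OF v] w by blast
    qed simp
    also have "\<dots> = real q * u (Suc n) c" using card_children[OF \<omega>] by simp
    finally show ?thesis using har'[OF v] q_ge2 by simp
  qed
  have child: "\<exists>c. up \<omega> c = v \<and> E v c \<and> hgt \<omega> c = hgt \<omega> v - 1" for v
  proof -
    have "{w. E v w \<and> w \<noteq> up \<omega> v} \<noteq> {}" using card_children[OF \<omega>, of v] q_ge2 by (metis card.empty not_numeral_le_zero)
    then obtain c where "up \<omega> c = v" "E v c" using child_iff[OF \<omega>] by blast
    then show ?thesis using hgt_up[OF \<omega>, of c] by auto
  qed
  define T where "T j = {(n, v, w). (E ^^ n) v0 v \<and> (E ^^ n) v0 w \<and> hgt \<omega> w = hgt \<omega> v + 2 * int j}" for j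
  define e where "e j = (SUP (n, v, w)\<in>T j. \<bar>u n v - u n w\<bar>)" for j
  \<comment> \<open>The supremum needs a nonempty set. The witness at level \<open>j\<close>
    consists of vertices reached from \<open>v0\<close> by \<open>j\<close> downward and by
    \<open>j\<close> upward steps.\<close>
  have T_ne: "T j \<noteq> {}" for j
  proof -
    have a: "(E ^^ j) v0 ((up \<omega> ^^ j) v0) \<and> hgt \<omega> ((up \<omega> ^^ j) v0) = int j" for j
    proof (induction j)
      case (Suc j) then show ?case using upE hgt_up[OF \<omega>] by auto
    qed (simp add: hgt_v0[OF \<omega>])
    have "\<exists>v. (E ^^ j) v0 v \<and> hgt \<omega> v = - int j" for j
    proof (induction j)
      case (Suc j)
      then obtain v where "(E ^^ j) v0 v" "hgt \<omega> v = - int j" by blast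
      then show ?case using child[of v] relpowp_Suc_I by fastforce
    qed (simp add: hgt_v0[OF \<omega>])
    then obtain v where "(E ^^ j) v0 v" "hgt \<omega> v = - int j" by blast
    with a[of j] have "(j, v, (up \<omega> ^^ j) v0) \<in> T j" by (auto simp: T_def)
    then show ?thesis by blast
  qed
  have e_upper: "\<bar>u n v - u n w\<bar> \<le> e j"
    if "(E ^^ n) v0 v" "(E ^^ n) v0 w" "hgt \<omega> w = hgt \<omega> v + 2 * int j" for n v w j
    unfolding e_def by (rule cSUP_upper2[OF bdd, where x = "(n, v, w)"]) (use that in \<open>auto simp: T_def\<close>)
  have e_least: "e j \<le> c"
    if "\<And>n v w. (E ^^ n) v0 v \<Longrightarrow> (E ^^ n) v0 w \<Longrightarrow> hgt \<omega> w = hgt \<omega> v + 2 * int j \<Longrightarrow> \<bar>u n v - u n w\<bar> \<le> c"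
    for j c
    unfolding e_def by (rule cSUP_least[OF T_ne]) (use that in \<open>auto simp: T_def\<close>)
  have e_nonneg: "0 \<le> e j" for j
  proof -
    obtain n v w where "(n, v, w) \<in> T j" using T_ne by fast
    then show ?thesis using e_upper[of n v w j] by (auto simp: T_def)
  qed
  have e_B: "e j \<le> B" for j
  proof (rule e_least)
    fix n v w assume "(E ^^ n) v0 v" "(E ^^ n) v0 w"
    then show "\<bar>u n v - u n w\<bar> \<le> B" using bnd[of n v] bnd[of n w] by auto
  qed
  have e_conv: "e (Suc j) \<le> 1/2 * e j + (1 - 1/2) * e (Suc (Suc j))" for j
  proof -
    let ?A = "r * r + (1 - r) * (1 - r)" and ?B = "r * (1 - r)"
    have "e (Suc j) \<le> ?A * e (Suc j) + ?B * e j + ?B * e (Suc (Suc j))"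
    proof (rule e_least)
      fix n v w assume v: "(E ^^ n) v0 v" and w: "(E ^^ n) v0 w" and h: "hgt \<omega> w = hgt \<omega> v + 2 * int (Suc j)"
      obtain c where c: "up \<omega> c = v" "E v c" "hgt \<omega> c = hgt \<omega> v - 1" using child by blast
      obtain c' where c': "up \<omega> c' = w" "E w c'" "hgt \<omega> c' = hgt \<omega> w - 1" using child by blast
      note V = relpowp_Suc_I[OF v upE] relpowp_Suc_I[OF v c(2)]
      note W = relpowp_Suc_I[OF w upE] relpowp_Suc_I[OF w c'(2)]
      let ?a = "u (Suc n) (up \<omega> v)" and ?b = "u (Suc n) c" and ?a' = "u (Suc n) (up \<omega> w)" and ?b' = "u (Suc n) c'"
      have 1: "\<bar>?a - ?a'\<bar> \<le> e (Suc j)" by (rule e_upper[OF V(1) W(1)]) (use h hgt_up[OF \<omega>] in auto)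
      have 2: "\<bar>?b - ?b'\<bar> \<le> e (Suc j)" by (rule e_upper[OF V(2) W(2)]) (use h c c' in auto)
      have 3: "\<bar>?a - ?b'\<bar> \<le> e j" by (rule e_upper[OF V(1) W(2)]) (use h hgt_up[OF \<omega>] c c' in auto)
      have 4: "\<bar>?b - ?a'\<bar> \<le> e (Suc (Suc j))" by (rule e_upper[OF V(2) W(1)]) (use h hgt_up[OF \<omega>] c c' in auto)
      \<comment> \<open>Product coupling: the two vertices step independently. Equal directions keep
        the height difference; opposite ones change it by two, with the same weight
        \<open>?B\<close> in both senses.\<close>
      have "u n v - u n w = r * r * (?a - ?a') + (1 - r) * (1 - r) * (?b - ?b') + ?B * (?a - ?b') + ?B * (?b - ?a')"
        unfolding har2[OF v c(1)] har2[OF w c'(1)] by (simp add: algebra_simps)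
      then have "\<bar>u n v - u n w\<bar> \<le> \<bar>r * r * (?a - ?a')\<bar> + \<bar>(1 - r) * (1 - r) * (?b - ?b')\<bar> + \<bar>?B * (?a - ?b')\<bar> + \<bar>?B * (?b - ?a')\<bar>"
        by linarith
      also have "\<dots> = r * r * \<bar>?a - ?a'\<bar> + (1 - r) * (1 - r) * \<bar>?b - ?b'\<bar> + ?B * \<bar>?a - ?b'\<bar> + ?B * \<bar>?b - ?a'\<bar>"
        using r by (simp add: abs_mult)
      also have "\<dots> \<le> r * r * e (Suc j) + (1 - r) * (1 - r) * e (Suc j) + ?B * e j + ?B * e (Suc (Suc j))"
        using 1 2 3 4 r by (intro add_mono mult_left_mono) auto
      finally show "\<bar>u n v - u n w\<bar> \<le> ?A * e (Suc j) + ?B * e j + ?B * e (Suc (Suc j))" by (simp add: algebra_simps)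
    qed
    \<comment> \<open>Since \<open>1 - ?A = 2 * ?B\<close>, the stationary part cancels and a
      symmetric convexity inequality remains, whence the weight 1/2 whatever \<open>r\<close>
      is.\<close>
    then have "?B * (2 * e (Suc j)) \<le> ?B * (e j + e (Suc (Suc j)))" by (simp add: algebra_simps)
    moreover have "?B > 0" using r by simp
    ultimately have "2 * e (Suc j) \<le> e j + e (Suc (Suc j))" by (metis mult_le_cancel_left_pos)
    then show ?thesis by simp
  qed
  have "e 0 \<le> 0"
  proof (rule e_least)
    fix n v w assume "(E ^^ n) v0 v" "(E ^^ n) v0 w" "hgt \<omega> w = hgt \<omega> v + 2 * int 0"
    then have "u n v = u n w" by (intro same) auto
    then show "\<bar>u n v - u n w\<bar> \<le> 0" by simp
  qed
  then have "e 0 = 0" using e_nonneg[of 0] by simp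
  then have e0: "e j = 0" for j
    by (intro bounded_subconvex_eq_0[of "1/2" e B j] e_nonneg e_B e_conv) auto
  have level: "u n v = u n w" if v: "(E ^^ n) v0 v" and w: "(E ^^ n) v0 w" for n v w
  proof -
    have *: "u n v = u n w" if v: "(E ^^ n) v0 v" and w: "(E ^^ n) v0 w" and le: "hgt \<omega> v \<le> hgt \<omega> w" for v w
    proof -
      have "even (hgt \<omega> w - hgt \<omega> v)" using hgt_walk[OF \<omega> v] hgt_walk[OF \<omega> w] by presburger
      then obtain j where j: "hgt \<omega> w - hgt \<omega> v = 2 * j" by (rule evenE)
      then have "hgt \<omega> w = hgt \<omega> v + 2 * int (nat j)" using le by simp
      then show ?thesis using e_upper[OF v w] e0 by fastforce
    qed
    show ?thesis using *[OF v w] *[OF w v] by linarith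
  qed
  show ?thesis
    using nv
  proof (induction n arbitrary: v)
    case (Suc n)
    then obtain w where w: "(E ^^ n) v0 w" "E w v" by auto
    obtain c where c: "up \<omega> c = w" "E w c" using child by blast
    have "u (Suc n) (up \<omega> w) = u (Suc n) v" "u (Suc n) c = u (Suc n) v"
      using level Suc.prems relpowp_Suc_I[OF w(1)] upE c(2) by blast+
    then have "u n w = u (Suc n) v" using har2[OF w(1) c(1)] by (simp add: algebra_simps)
    then show ?case using Suc.IH[OF w(1)] by simp
  qed simp
qed

text \<open>A Doob transform: for \<open>r < 1\<close> the function \<open>h\<close> is positive,
  and the quotient \<open>g / h\<close> is bounded and harmonic for the chain with transition
  probabilities \<open>step\<close>, hence constant.\<close>

lemma follows_minimal:
  assumes \<omega>: "\<omega> \<in> ends E" and r: "1 / 2 \<le> r" "r \<le> 1" and h: "follows \<omega> r h"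
  shows "minimal h"
proof (cases "r = 1")
  case True then show ?thesis using follows_1_minimal[OF \<omega>] h by simp
next
  case False
  then have r1: "r < 1" using r by simp
  have har: "harmonic h" using follows_harmonic[OF \<omega> _ _ h] r by simp
  have h0: "h 0 v0 = 1" using h by (simp add: follows_def)
  have step_pos: "0 < step \<omega> r v w" for v w using r r1 q_ge2 by (simp add: step_def)
  have pos: "(E ^^ n) v0 v \<Longrightarrow> 0 < h n v" for n v
  proof (induction n arbitrary: v)
    case 0 then show ?case using h0 by simp
  next
    case (Suc n)
    then obtain w where w: "(E ^^ n) v0 w" "E w v" by auto
    then show ?case using Suc.IH[OF w(1)] followsD[OF h w] step_pos by simp
  qed
  have "g n v = g 0 v0 * h n v"
    if g: "harmonic g" and le: "\<forall>n v. (E ^^ n) v0 v \<longrightarrow> g n v \<le> C * h n v" and nv: "(E ^^ n) v0 v" for g C n v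
  proof -
    have "g n v / h n v = g 0 v0 / h 0 v0"
    proof (rule bounded_harmonic_const[OF \<omega> r(1) r1 _ _ nv, where B = C])
      fix n v assume nv: "(E ^^ n) v0 v"
      show "0 \<le> g n v / h n v \<and> g n v / h n v \<le> C"
        using harmonic_nonneg[OF g nv] le[rule_format, OF nv] pos[OF nv] by (simp add: divide_le_eq)
      have "g n v / h n v = (\<Sum>w | E v w. g (Suc n) w / h n v)"
        using harmonic_sum[OF g nv] by (simp add: sum_divide_distrib)
      also have "\<dots> = (\<Sum>w | E v w. step \<omega> r v w * (g (Suc n) w / h (Suc n) w))"
      proof (rule sum.cong)
        fix w assume "w \<in> {w. E v w}"
        then have w: "E v w" by simp
        show "g (Suc n) w / h n v = step \<omega> r v w * (g (Suc n) w / h (Suc n) w)"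
          using followsD[OF h nv w] step_pos[of v w] pos[OF nv] by (simp add: field_simps)
      qed simp
      finally show "g n v / h n v = (\<Sum>w | E v w. step \<omega> r v w * (g (Suc n) w / h (Suc n) w))" .
    qed
    then show ?thesis using pos[OF nv] h0 by (simp add: field_simps)
  qed
  then show ?thesis using har h0 unfolding minimal_def by blast
qed

subsection \<open>Minimal harmonic functions\<close>

text \<open>Going to a neighbour and back returns to \<open>v\<close> two levels later, and
  \<open>h\<close> never increases along edges. So the shifted function is dominated by
  \<open>h\<close> with constant 1.\<close>

lemma minimal_shift:
  assumes "minimal h" "(E ^^ n) v0 v"
  shows "h (Suc (Suc n)) v = h 2 v0 * h n v"
proof -
  have h: "harmonic h" using assms by (simp add: minimal_def)
  have D2: "(E ^^ Suc (Suc n)) v0 v" if "(E ^^ n) v0 v" for n v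
    using that ex_nbr E_sym by (meson relpowp_Suc_I)
  have "h (Suc (Suc n)) v = h (Suc (Suc 0)) v0 * h n v"
  proof (rule minimalD[OF assms(1) _ _ assms(2), where C = 1 and g = "\<lambda>n. h (Suc (Suc n))"])
    show "harmonic (\<lambda>n. h (Suc (Suc n)))" using h D2 unfolding harmonic_def by blast
    fix n v assume n: "(E ^^ n) v0 v"
    obtain w where "E v w" using ex_nbr by blast
    then show "h (Suc (Suc n)) v \<le> 1 * h n v"
      using harmonic_edge_le[OF h n] harmonic_edge_le[OF h relpowp_Suc_I[OF n] E_sym]
      by (metis mult_1 order_trans)
  qed
  then show ?thesis by (simp add: numeral_2_eq_2)
qed

text \<open>Unique predecessors make the support of \<open>h\<close> a tree, so the part of
  \<open>h\<close> carried by the descendants of one vertex is again harmonic. Minimality forbids a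
  proper part, so the support cannot branch.\<close>

lemma minimal_concentrated:
  assumes h: "minimal h"
    and pred_unique: "\<And>n y1 y2 w. (E ^^ n) v0 y1 \<Longrightarrow> (E ^^ n) v0 y2 \<Longrightarrow> E y1 w \<Longrightarrow> E y2 w \<Longrightarrow>
      0 < h (Suc n) w \<Longrightarrow> y1 = y2"
  shows "\<exists>x. (E ^^ n) v0 x \<and> h n x = 1 \<and> (\<forall>w. (E ^^ n) v0 w \<longrightarrow> w \<noteq> x \<longrightarrow> h n w = 0)"
proof (induction n)
  case 0 then show ?case using h by (auto simp: minimal_def)
next
  case (Suc n)
  have har: "harmonic h" using h by (simp add: minimal_def)
  obtain x where x: "(E ^^ n) v0 x" "h n x = 1" and x0: "\<And>w. (E ^^ n) v0 w \<Longrightarrow> w \<noteq> x \<Longrightarrow> h n w = 0"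
    using Suc.IH by blast
  note nonneg = harmonic_nonneg[OF har]
  have "\<exists>v. E x v \<and> 0 < h (Suc n) v"
  proof (rule ccontr)
    assume "\<not> ?thesis"
    then have "(\<Sum>w | E x w. h (Suc n) w) = 0"
      using nonneg[OF relpowp_Suc_I[OF x(1)]] by (intro sum.neutral) force
    then show False using harmonic_sum[OF har x(1)] x(2) by simp
  qed
  then obtain v where v: "E x v" "0 < h (Suc n) v" by blast
  let ?c = "h (Suc n) v"
  have Dv: "(E ^^ Suc n) v0 v" using x(1) v(1) by (rule relpowp_Suc_I)
  have c1: "?c \<le> 1" using harmonic_edge_le[OF har x(1) v(1)] x(2) by simp
  \<comment> \<open>The part of \<open>h\<close> carried by paths through \<open>v\<close> at level
    \<open>n + 1\<close>. All mass at level \<open>n\<close> sits at \<open>x\<close>, so up to that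
    level this part is the fraction \<open>?c\<close> of \<open>h\<close>.\<close>
  define g where "g m w = (if m \<le> n then ?c * h m w else if (E ^^ (m - Suc n)) v w then h m w else 0)" for m w
  have g_le: "g m w \<le> 1 * h m w" if D: "(E ^^ m) v0 w" for m w
    using nonneg[OF D] c1 v(2) by (simp add: g_def mult_left_le_one_le)
  have "harmonic g"
    unfolding harmonic_def
  proof (intro allI impI conjI)
    fix m w assume D: "(E ^^ m) v0 w"
    show "0 \<le> g m w" using nonneg[OF D] v(2) by (simp add: g_def)
    consider "m < n" | "m = n" "w \<noteq> x" | "m = n" "w = x" | "m > n" "(E ^^ (m - Suc n)) v w"
      | "m > n" "\<not> (E ^^ (m - Suc n)) v w" by linarith
    then show "g m w = (\<Sum>w' | E w w'. g (Suc m) w')"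
    proof cases
      case 1
      then show ?thesis using harmonic_sum[OF har D] by (simp add: g_def sum_distrib_left)
    next
      case 2
      have "g (Suc m) w' = 0" if "E w w'" for w'
        using harmonic_edge_le[OF har D that] nonneg[OF relpowp_Suc_I[OF D that]] x0[of w] D 2
        by (simp add: g_def)
      then show ?thesis using 2 x0[of w] D by (simp add: g_def)
    next
      case 3
      have "(\<Sum>w' | E w w'. g (Suc m) w') = (\<Sum>w' | E w w'. if w' = v then ?c else 0)"
        using 3 by (intro sum.cong) (auto simp: g_def)
      then show ?thesis using 3 v(1) x(2) by (simp add: g_def)
    next
      case 4
      have "(E ^^ (Suc m - Suc n)) v w'" if "E w w'" for w'
        using relpowp_Suc_I[OF 4(2) that] 4(1) by (simp add: Suc_diff_Suc)
      then show ?thesis using 4 harmonic_sum[OF har D] by (simp add: g_def)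
    next
      case 5
      \<comment> \<open>A common successor of \<open>w\<close> and of a descendant \<open>y\<close>
        of \<open>v\<close> would have two predecessors, so \<open>h\<close> vanishes there and no
        mass of \<open>g\<close> enters from outside.\<close>
      have "g (Suc m) w' = 0" if w': "E w w'" for w'
      proof (cases "(E ^^ (m - n)) v w'")
        case True
        moreover have "m - n = Suc (m - Suc n)" using 5 by simp
        ultimately obtain y where y: "(E ^^ (m - Suc n)) v y" "E y w'" by auto
        have "(E ^^ (Suc n + (m - Suc n))) v0 y" using Dv y(1) by (rule relpowp_trans)
        then have Dy: "(E ^^ m) v0 y" using 5 by simp
        have "y \<noteq> w" using y 5 by auto
        then have "\<not> 0 < h (Suc m) w'" using pred_unique[OF D Dy w' y(2)] by blast
        then show ?thesis using nonneg[OF relpowp_Suc_I[OF D w']] 5 by (simp add: g_def)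
      qed (use 5 in \<open>simp add: g_def\<close>)
      then show ?thesis using 5 by (simp add: g_def)
    qed
  qed
  then have gm: "g m w = g 0 v0 * h m w" if "(E ^^ m) v0 w" for m w
    using minimalD[OF h _ _ that, of g 1] g_le by blast
  have g0: "g 0 v0 = ?c" using h by (simp add: g_def minimal_def)
  \<comment> \<open>At \<open>v\<close> itself \<open>g\<close> agrees with \<open>h\<close>, while
    minimality makes it \<open>?c\<close> times \<open>h\<close>.\<close>
  have "?c = ?c * ?c" using gm[OF Dv] unfolding g0 by (simp add: g_def)
  then have "?c = 1" using v(2) by simp
  moreover have "h (Suc n) w = 0" if "(E ^^ Suc n) v0 w" "w \<noteq> v" for w
    using gm[OF that(1)] that(2) v(2) unfolding g0 by (simp add: g_def)
  ultimately show ?case using Dv by blast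
qed

text \<open>By \<open>minimal_shift\<close>, \<open>h\<close> vanishes at every level beyond the
  distance from \<open>v0\<close>. Predecessors of a point of the support are therefore lower
  neighbours, which are unique, and the support is a single ray from \<open>v0\<close>.\<close>

lemma minimal_geodesic:
  assumes h: "minimal h" and h2: "h 2 v0 = 0"
  shows "\<exists>\<omega>\<in>ends E. follows \<omega> 1 h"
proof -
  have har: "harmonic h" using h by (simp add: minimal_def)
  have pos_dst: "dst v0 w = n" if D: "(E ^^ n) v0 w" and pos: "0 < h n w" for n w
  proof (rule ccontr)
    assume "dst v0 w \<noteq> n"
    then have "dst v0 w < n" "even (n + dst v0 w)" using D by (auto simp: walk_iff)
    then have "even (n - dst v0 w)" "0 < n - dst v0 w" by auto
    then obtain k where k: "n - dst v0 w = 2 * Suc k" by (metis evenE gr0_conv_Suc nat_0_less_mult_iff)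
    then have n: "n = Suc (Suc (dst v0 w + 2 * k))" by simp
    have "(E ^^ (dst v0 w + 2 * k)) v0 w" by (simp add: walk_iff)
    from minimal_shift[OF h this] show False using h2 pos n by simp
  qed
  have pred: "y1 = y2" if "(E ^^ n) v0 y1" "(E ^^ n) v0 y2" "E y1 w" "E y2 w" "0 < h (Suc n) w" for n y1 y2 w
    using lower_nbr_unique[of w y1 y2 v0] pos_dst[OF relpowp_Suc_I[OF that(1,3)] that(5)] that E_sym
    by (simp add: walk_iff)
  have "\<forall>n. \<exists>x. (E ^^ n) v0 x \<and> h n x = 1 \<and> (\<forall>w. (E ^^ n) v0 w \<longrightarrow> w \<noteq> x \<longrightarrow> h n w = 0)"
    by (intro allI minimal_concentrated[OF h]) (rule pred)
  then obtain x where x: "\<And>n. (E ^^ n) v0 (x n)" "\<And>n. h n (x n) = 1"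
    and x0: "\<And>n w. (E ^^ n) v0 w \<Longrightarrow> w \<noteq> x n \<Longrightarrow> h n w = 0" by metis
  have dx: "dst v0 (x n) = n" for n using pos_dst[OF x(1)] x(2) by simp
  have Ex: "E (x n) (x (Suc n))" for n
  proof (rule ccontr)
    assume "\<not> ?thesis"
    then have "h (Suc n) w = 0" if "E (x n) w" for w
      using x0[OF relpowp_Suc_I[OF x(1) that]] that by blast
    then show False using harmonic_sum[OF har x(1), of n] x(2) by simp
  qed
  have "x \<in> rays E" using Ex dx by (auto simp: rays_def intro!: injI) (metis dx)
  then obtain \<omega> where \<omega>: "\<omega> \<in> ends E" "x \<in> \<omega>" using end_of_ray by blast
  have "x 0 = v0" using dx[of 0] by simp
  then have "x n = (up \<omega> ^^ n) v0" for n using ray_eqI[OF \<omega>(1,2)] ray_conv_up[OF \<omega>(1)] by metis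
  then have up: "up \<omega> (x n) = x (Suc n)" for n by simp
  have "h (Suc n) w = step \<omega> 1 v w * h n v" if D: "(E ^^ n) v0 v" and e: "E v w" for n v w
  proof (cases "v = x n")
    case True
    then show ?thesis using up x(2) x0[OF relpowp_Suc_I[OF D e]] by (simp add: step_def)
  next
    case False
    then show ?thesis
      using x0[OF D] harmonic_edge_le[OF har D e] harmonic_nonneg[OF har relpowp_Suc_I[OF D e]] by simp
  qed
  then have "follows \<omega> 1 h" using h by (simp add: follows_def minimal_def)
  then show ?thesis using \<omega> by blast
qed

section \<open>Nonnegative eigenfunctions of the adjacency operator, with eigenvalue
  \<open>1 / s\<close>\<close>

definition eigen :: "real \<Rightarrow> ('v \<Rightarrow> real) \<Rightarrow> bool" where
  "eigen s f \<longleftrightarrow> (\<forall>v. 0 \<le> f v \<and> f v = s * (\<Sum>w | E v w. f w))"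

lemma eigenD:
  assumes "eigen s f"
  shows "0 \<le> f v" "f v = s * (\<Sum>w | E v w. f w)"
  using assms unfolding eigen_def by blast+

lemma eigen_harmonic:
  assumes "eigen s f" "0 < s"
  shows "harmonic (\<lambda>n v. s ^ n * f v)"
  unfolding harmonic_def
proof (intro allI impI conjI)
  fix n v
  have f: "0 \<le> f v" "f v = s * (\<Sum>w | E v w. f w)" using eigenD[OF assms(1)] by blast+
  show "0 \<le> s ^ n * f v" using f(1) assms(2) by simp
  show "s ^ n * f v = (\<Sum>w | E v w. s ^ Suc n * f w)"
    by (subst f(2)) (simp add: sum_distrib_left[symmetric])
qed

lemma eigen_pos:
  assumes f: "eigen s f" "0 < s" "f v0 = 1"
  shows "0 < f v"
proof (rule ccontr)
  assume "\<not> 0 < f v"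
  then have v: "f v = 0" using eigenD(1)[OF f(1), of v] by simp
  have "(E ^^ n) v u \<Longrightarrow> f u = 0" for n u
  proof (induction n arbitrary: u)
    case (Suc n)
    then obtain w where w: "(E ^^ n) v w" "E w u" by auto
    have "(\<Sum>u | E w u. f u) = 0" using Suc.IH[OF w(1)] f(2) eigenD(2)[OF f(1), of w] by simp
    then show ?case using eigenD(1)[OF f(1)] w(2) by (subst (asm) sum_nonneg_eq_0_iff) auto
  qed (use v in auto)
  then show False using connected f(3) by (metis zero_neq_one)
qed

lemma sum_nbrs_split:
  assumes "E v u"
  shows "(\<Sum>w | E v w. f w) = f u + (\<Sum>w | E v w \<and> w \<noteq> u. f w :: real)"
    "card {w. E v w \<and> w \<noteq> u} = q" "finite {w. E v w \<and> w \<noteq> u}"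
proof -
  have *: "{w. E v w} = insert u {w. E v w \<and> w \<noteq> u}" using assms by auto
  show fin: "finite {w. E v w \<and> w \<noteq> u}" by (rule finite_subset[OF _ finite_nbrs[of v]]) auto
  show "(\<Sum>w | E v w. f w) = f u + (\<Sum>w | E v w \<and> w \<noteq> u. f w)"
    unfolding * using fin by (subst sum.insert) auto
  have "{w. E v w \<and> w \<noteq> u} = {w. E v w} - {u}" by auto
  then show "card {w. E v w \<and> w \<noteq> u} = q" using card_nbrs assms by simp
qed

text \<open>
  With \<open>\<rho>\<close> the infimum of \<open>f v / f u\<close> over all edges, the eigenvalue equation at \<open>v\<close> gives
  \<open>s q \<rho>\<^sup>2 - \<rho> + s \<le> 0\<close>; so this quadratic has real roots, and \<open>\<rho>\<close> is at least the smaller root \<open>F\<close>.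
\<close>

lemma eigen_root:
  fixes s :: real
  assumes f: "eigen s f" "0 < s" "f v0 = 1"
  obtains F where "0 < F" "s * (1 + real q * F\<^sup>2) = F" "real q * F\<^sup>2 \<le> 1" "\<And>u v. E u v \<Longrightarrow> F * f u \<le> f v"
proof -
  note pos = eigen_pos[OF f]
  note eq = eigenD(2)[OF f(1)]
  define R where "R = {f v / f u | u v. E u v}"
  \<comment> \<open>In the equation at \<open>v\<close> all neighbours but \<open>u\<close> are
    dropped; the bound makes the infimum over all edges meaningful.\<close>
  have lower: "s \<le> f v / f u" if "E u v" for u v
  proof -
    have "f v = s * f u + s * (\<Sum>w | E v w \<and> w \<noteq> u. f w)"
      using eq[of v] sum_nbrs_split(1)[OF E_sym[OF that], of f] by (simp add: algebra_simps)
    moreover have "0 \<le> (\<Sum>w | E v w \<and> w \<noteq> u. f w)" using pos by (intro sum_nonneg) (simp add: less_imp_le)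
    ultimately have "s * f u \<le> f v" using f(2) by simp
    then show ?thesis using pos[of u] by (simp add: le_divide_eq)
  qed
  define \<rho> where "\<rho> = Inf R"
  have ne: "R \<noteq> {}" using ex_nbr by (auto simp: R_def)
  have bdd: "bdd_below R" using lower by (auto simp: R_def intro!: bdd_belowI[of _ s])
  have rs: "s \<le> \<rho>" unfolding \<rho>_def using ne lower by (intro cInf_greatest) (auto simp: R_def)
  have r_le: "\<rho> * f u \<le> f v" if "E u v" for u v
  proof -
    have "\<rho> \<le> f v / f u" unfolding \<rho>_def using that by (intro cInf_lower bdd) (auto simp: R_def)
    then show ?thesis using pos[of u] by (simp add: le_divide_eq)
  qed
  \<comment> \<open>In the equation at \<open>v\<close> the neighbour \<open>u\<close> is kept, and
    the other \<open>q\<close> are bounded below by \<open>\<rho> * f v\<close>.\<close>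
  have key: "s * f u \<le> f v * (1 - s * q * \<rho>)" if "E u v" for u v
  proof -
    have "real q * (\<rho> * f v) \<le> (\<Sum>w | E v w \<and> w \<noteq> u. f w)"
      using r_le sum_nbrs_split(2)[OF E_sym[OF that]]
      by (metis (mono_tags, lifting) mem_Collect_eq sum_bounded_below)
    then have "s * (f u + real q * (\<rho> * f v)) \<le> s * (\<Sum>w | E v w. f w)"
      using sum_nbrs_split(1)[OF E_sym[OF that], of f] f(2) by simp
    then show ?thesis using eq[of v] by (simp add: algebra_simps)
  qed
  obtain a b where ab: "E a b" using ex_nbr by blast
  have d: "0 < 1 - s * q * \<rho>"
  proof -
    have "0 < f b * (1 - s * q * \<rho>)" using key[OF ab] mult_pos_pos[OF f(2) pos[of a]] by linarith
    then show ?thesis using pos[of b] by (simp add: zero_less_mult_iff)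
  qed
  \<comment> \<open>\<open>key\<close> bounds every edge ratio, hence also their infimum; this turns
    it into an inequality in \<open>\<rho>\<close> alone.\<close>
  have "s / (1 - s * q * \<rho>) \<le> \<rho>"
    unfolding \<rho>_def
  proof (rule cInf_greatest[OF ne])
    fix x assume "x \<in> R"
    then obtain u v where uv: "E u v" "x = f v / f u" by (auto simp: R_def)
    then have "f v = x * f u" using pos[of u] by simp
    then have "s * f u \<le> (x * (1 - s * q * \<rho>)) * f u" using key[OF uv(1)] by (simp only: ac_simps)
    then have "s \<le> x * (1 - s * q * \<rho>)" using pos[of u] by simp
    then show "s / (1 - s * q * Inf R) \<le> x" using d by (simp add: \<rho>_def[symmetric] divide_le_eq)
  qed
  then have quad: "s \<le> \<rho> * (1 - s * q * \<rho>)" using d by (simp add: divide_le_eq)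
  let ?D = "1 - 4 * s\<^sup>2 * q"
  have "(2 * s * q * \<rho> - 1)\<^sup>2 = 1 - 4 * s * q * (\<rho> * (1 - s * q * \<rho>))"
    by (simp add: power2_eq_square algebra_simps)
  also have "\<dots> \<le> ?D"
  proof -
    have "4 * s * q * s \<le> 4 * s * q * (\<rho> * (1 - s * q * \<rho>))" using quad f(2) by (intro mult_left_mono) auto
    then show ?thesis by (simp add: power2_eq_square algebra_simps)
  qed
  finally have disc: "(2 * s * q * \<rho> - 1)\<^sup>2 \<le> ?D" .
  then have D0: "0 \<le> ?D" by (meson order_trans zero_le_power2)
  have sq0: "0 < s * q" using f(2) q_ge2 by simp
  \<comment> \<open>The smaller root satisfies \<open>2 * s * q * F \<le> 1\<close>, which yields
    \<open>q F^2 \<le> 1\<close> and later \<open>r \<ge> 1/2\<close>. The larger root would lead to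
    \<open>r \<le> 1/2\<close>.\<close>
  define F where "F = (1 - sqrt ?D) / (2 * s * q)"
  have F2: "2 * (s * q) * F = 1 - sqrt ?D" using sq0 by (simp add: F_def)
  have "\<bar>2 * s * q * \<rho> - 1\<bar> \<le> sqrt ?D" using disc real_le_rsqrt[of "\<bar>2 * s * q * \<rho> - 1\<bar>"] by simp
  then have "2 * (s * q) * F \<le> 2 * (s * q) * \<rho>" using F2 by (simp add: mult.assoc)
  then have F_rho: "F \<le> \<rho>" using sq0 mult_le_cancel_left_pos[of "2 * (s * q)" F \<rho>] by simp
  have "(1 - 2 * (s * q) * F)\<^sup>2 = ?D" using F2 D0 by simp
  then have "4 * (s * q) * (s + s * real q * F\<^sup>2 - F) = 0" by (simp add: power2_eq_square algebra_simps)
  then have Feq: "s + s * real q * F\<^sup>2 = F" using f(2) q_ge2 by simp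
  show ?thesis
  proof (rule that[of F])
    show F0: "0 < F"
    proof -
      have "0 \<le> s * real q * F\<^sup>2" using sq0 by simp
      then show ?thesis using Feq f(2) by linarith
    qed
    show "s * (1 + real q * F\<^sup>2) = F" using Feq by (simp add: algebra_simps)
    have "2 * (s * q) * F * F \<le> 1 * F" using F2 D0 F0 by (intro mult_right_mono) auto
    then have "2 * (s * real q * F\<^sup>2) \<le> F" by (simp add: power2_eq_square algebra_simps)
    then have "s * (real q * F\<^sup>2) \<le> s * 1" using Feq by (simp add: mult.assoc)
    then show "real q * F\<^sup>2 \<le> 1" using f(2) by (metis mult_le_cancel_left_pos)
    show "F * f u \<le> f v" if "E u v" for u v
      by (rule order_trans[OF mult_right_mono[OF F_rho less_imp_le[OF pos]] r_le[OF that]])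
  qed
qed

text \<open>The powers \<open>F ^ dst u x\<close> are a radial solution of the eigenvalue equation
  off \<open>u\<close>: one neighbour lies nearer and contributes the factor \<open>1 / F\<close>,
  the other \<open>q\<close> contribute \<open>F\<close>, and the quadratic equation for
  \<open>F\<close> balances them.\<close>

lemma sum_pow_dst:
  fixes s F :: real
  assumes F: "0 < F" "s * (1 + real q * F\<^sup>2) = F"
  shows "x \<noteq> u \<Longrightarrow> s * (\<Sum>w | E x w. F ^ dst u w) = F ^ dst u x"
    and "s * (1 / F + real q * F) = 1"
proof -
  show c: "s * (1 / F + real q * F) = 1" using F by (simp add: field_simps power2_eq_square)
  assume "x \<noteq> u"
  then obtain y where y: "E x y" "dst u x = Suc (dst u y)" by (metis lower_nbr)
  have "dst u w = Suc (dst u x)" if "E x w" "w \<noteq> y" for w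
    using edge_dst_cases[OF that(1), of u] lower_nbr_unique[OF that(1) y(1), of u] that(2) y(2) by auto
  then have "(\<Sum>w | E x w \<and> w \<noteq> y. F ^ dst u w) = (\<Sum>w | E x w \<and> w \<noteq> y. F * F ^ dst u x)"
    by (intro sum.cong) auto
  then have "(\<Sum>w | E x w. F ^ dst u w) = F ^ dst u y + q * (F * F ^ dst u x)"
    using sum_nbrs_split[OF y(1)] by simp
  also have "F ^ dst u y = F ^ dst u x / F" using y(2) F(1) by simp
  also have "F ^ dst u x / F + q * (F * F ^ dst u x) = (1 / F + real q * F) * F ^ dst u x"
    by (simp add: algebra_simps)
  finally have "s * (\<Sum>w | E x w. F ^ dst u w) = (s * (1 / F + real q * F)) * F ^ dst u x"
    by (simp add: mult.assoc)
  then show "s * (\<Sum>w | E x w. F ^ dst u w) = F ^ dst u x" using c by simp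
qed

text \<open>
  Removing the edge between \<open>u\<close> and \<open>v\<close> splits \<open>f\<close> into two nonnegative eigenfunctions, one for each
  half of the tree; \<open>g\<close> below is the part that decays away from the half of \<open>v\<close>. The constants
  \<open>\<alpha>\<close> and \<open>\<beta>\<close> are forced by the equations at \<open>u\<close> and \<open>v\<close>.
\<close>

lemma eigen_edge_ratio:
  assumes f: "eigen s f" "0 < s" "f v0 = 1"
    and min: "\<And>g. eigen s g \<Longrightarrow> (\<And>x. g x \<le> f x) \<Longrightarrow> (\<And>x. g x = g v0 * f x)"
    and F: "0 < F" "s * (1 + real q * F\<^sup>2) = F" "real q * F\<^sup>2 \<le> 1" "\<And>u v. E u v \<Longrightarrow> F * f u \<le> f v"
    and uv: "E u v"
  shows "f v = F * f u \<or> f u = F * f v"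
proof -
  note c = sum_pow_dst(2)[OF F(1,2)]
  have eq: "s * (\<Sum>w | E x w. f w) = f x" for x by (rule eigenD(2)[OF f(1), symmetric])
  \<comment> \<open>Iterating the edge bound keeps both radial pieces below \<open>f\<close>; this
    is what gives \<open>0 \<le> g\<close> and \<open>g \<le> f\<close>.\<close>
  have path: "F ^ dst y x * f y \<le> f x" for x y
  proof -
    have "(E ^^ n) y x \<Longrightarrow> F ^ n * f y \<le> f x" for n
    proof (induction n arbitrary: x)
      case (Suc n)
      then obtain w where w: "(E ^^ n) y w" "E w x" by auto
      have "F * (F ^ n * f y) \<le> F * f w" using Suc.IH[OF w(1)] F(1) by simp
      also have "\<dots> \<le> f x" using F(4)[OF w(2)] .
      finally show ?case by (simp add: mult.assoc)
    qed simp
    then show ?thesis using dst_walk by blast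
  qed
  have F2: "F\<^sup>2 < 1"
  proof -
    have "2 * F\<^sup>2 \<le> real q * F\<^sup>2" using q_ge2 by (intro mult_right_mono) auto
    then show ?thesis using F(3) by linarith
  qed
  define \<alpha> where "\<alpha> = F * (f v - F * f u) / (1 - F\<^sup>2)"
  define \<beta> where "\<beta> = F * (f u - F * f v) / (1 - F\<^sup>2)"
  have \<alpha>0: "0 \<le> \<alpha>" using F(1) F(4)[OF uv] F2 by (simp add: \<alpha>_def)
  have \<beta>0: "0 \<le> \<beta>" using F(1) F(4)[OF E_sym[OF uv]] F2 by (simp add: \<beta>_def)
  \<comment> \<open>These identities let each piece continue across the edge with the radial ratio:
    \<open>g\<close> is \<open>\<alpha>\<close> at \<open>u\<close> and \<open>\<alpha> / F\<close>
    at \<open>v\<close>, while \<open>f - g\<close> is \<open>\<beta>\<close> at \<open>v\<close>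
    and \<open>\<beta> / F\<close> at \<open>u\<close>.\<close>
  have \<alpha>F: "f v - \<beta> = \<alpha> / F" using F(1) F2 by (simp add: \<alpha>_def \<beta>_def field_simps power2_eq_square)
  have \<beta>F: "f u - \<alpha> = \<beta> / F" using F(1) F2 by (simp add: \<alpha>_def \<beta>_def field_simps power2_eq_square)
  have \<beta>_le: "\<beta> \<le> f v" "\<alpha> \<le> f u" using \<alpha>F \<beta>F \<alpha>0 \<beta>0 F(1) by (metis diff_ge_0_iff_ge divide_nonneg_pos)+
  define g where "g x = (if dst u x < dst v x then \<alpha> * F ^ dst u x else f x - \<beta> * F ^ dst v x)" for x
  have side: "\<not> dst u x < dst v x \<longleftrightarrow> dst v x < dst u x" for x
    using edge_dst_cases[OF uv, of x] by (auto simp: dst_commute)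
  have step_u: "dst u y < dst v y" if "dst u x < dst v x" "E x y" "x \<noteq> u \<or> y \<noteq> v" for x y
    using half_tree_step[OF uv that] .
  have step_v: "\<not> dst u y < dst v y" if "\<not> dst u x < dst v x" "E x y" "x \<noteq> v \<or> y \<noteq> u" for x y
    using half_tree_step[OF E_sym[OF uv]] that side by metis
  have duv: "dst u v = 1" "dst v u = 1"
    using edge_dst_cases[OF uv, of u] edge_dst_cases[OF E_sym[OF uv], of v] by auto
  have "eigen s g"
    unfolding eigen_def
  proof (intro allI conjI)
    fix x
    have "\<beta> * F ^ dst v x \<le> F ^ dst v x * f v" using \<beta>_le F(1) by simp
    also have "\<dots> \<le> f x" by (rule path)
    finally show "0 \<le> g x" using \<alpha>0 F(1) by (simp add: g_def)
    consider "dst u x < dst v x" "x \<noteq> u" | "x = u" | "\<not> dst u x < dst v x" "x \<noteq> v" | "x = v"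
      by blast
    then show "g x = s * (\<Sum>w | E x w. g w)"
    proof cases
      case 1
      then have "(\<Sum>w | E x w. g w) = (\<Sum>w | E x w. \<alpha> * F ^ dst u w)"
        using step_u by (intro sum.cong) (auto simp: g_def)
      then have "s * (\<Sum>w | E x w. g w) = \<alpha> * (s * (\<Sum>w | E x w. F ^ dst u w))"
        by (simp add: sum_distrib_left[symmetric] mult.left_commute)
      then show ?thesis using 1 sum_pow_dst(1)[OF F(1,2)] by (simp add: g_def)
    next
      case 2
      have "g w = \<alpha> * F" if "E u w" "w \<noteq> v" for w
        using step_u[of u w] that duv edge_dst_cases[OF that(1), of u] by (simp add: g_def)
      then have "(\<Sum>w | E u w \<and> w \<noteq> v. g w) = q * (\<alpha> * F)"
        using sum_nbrs_split(2)[OF uv] by simp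
      then have "(\<Sum>w | E u w. g w) = \<alpha> / F + q * (\<alpha> * F)"
        using sum_nbrs_split(1)[OF uv, of g] \<alpha>F duv by (simp add: g_def)
      also have "\<dots> = \<alpha> * (1 / F + real q * F)" by (simp add: algebra_simps)
      finally have "s * (\<Sum>w | E u w. g w) = \<alpha> * (s * (1 / F + real q * F))" by (simp only: mult.left_commute)
      then show ?thesis using 2 c duv by (simp add: g_def)
    next
      case 3
      then have "(\<Sum>w | E x w. g w) = (\<Sum>w | E x w. f w - \<beta> * F ^ dst v w)"
        using step_v by (intro sum.cong) (auto simp: g_def)
      then have "(\<Sum>w | E x w. g w) = (\<Sum>w | E x w. f w) - \<beta> * (\<Sum>w | E x w. F ^ dst v w)"
        by (simp add: sum_subtractf sum_distrib_left)
      then have "s * (\<Sum>w | E x w. g w) = s * (\<Sum>w | E x w. f w) - \<beta> * (s * (\<Sum>w | E x w. F ^ dst v w))"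
        by (simp only: right_diff_distrib mult.left_commute)
      then show ?thesis using 3 sum_pow_dst(1)[OF F(1,2)] eq by (simp add: g_def)
    next
      case 4
      note vu = E_sym[OF uv]
      have "g w = f w - \<beta> * F" if "E v w" "w \<noteq> u" for w
        using step_v[of v w] that duv edge_dst_cases[OF that(1), of v] by (simp add: g_def)
      then have "(\<Sum>w | E v w \<and> w \<noteq> u. g w) = (\<Sum>w | E v w \<and> w \<noteq> u. f w) - q * (\<beta> * F)"
        using sum_nbrs_split(2)[OF vu] by (simp add: sum_subtractf)
      then have "(\<Sum>w | E v w. g w) = (\<Sum>w | E v w. f w) - f u + \<alpha> - q * (\<beta> * F)"
        using sum_nbrs_split(1)[OF vu, of g] sum_nbrs_split(1)[OF vu, of f] duv by (simp add: g_def)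
      also have "\<dots> = (\<Sum>w | E v w. f w) - \<beta> * (1 / F + real q * F)" using \<beta>F by (simp add: algebra_simps)
      finally have "s * (\<Sum>w | E v w. g w) = s * (\<Sum>w | E v w. f w) - \<beta> * (s * (1 / F + real q * F))"
        by (simp only: right_diff_distrib mult.left_commute)
      then show ?thesis using 4 c eq duv by (simp add: g_def)
    qed
  qed
  moreover have "g x \<le> f x" for x
  proof (cases "dst u x < dst v x")
    case True
    have "\<alpha> * F ^ dst u x \<le> F ^ dst u x * f u" using \<beta>_le F(1) by simp
    also have "\<dots> \<le> f x" by (rule path)
    finally show ?thesis using True by (simp add: g_def)
  qed (use \<beta>0 F(1) in \<open>simp add: g_def\<close>)
  ultimately have gc: "g x = g v0 * f x" for x by (rule min)
  \<comment> \<open>If \<open>g\<close> is a nonzero multiple of \<open>f\<close>, then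
    \<open>f\<close> inherits the ratio \<open>1 / F\<close> of \<open>g\<close> across the edge. If
    it is zero, \<open>\<alpha> = 0\<close>, which by its definition is the other
    alternative.\<close>
  have gu: "\<alpha> = g v0 * f u" and gv: "\<alpha> / F = g v0 * f v"
    using gc[of u] gc[of v] duv \<alpha>F by (simp_all add: g_def)
  show ?thesis
  proof (cases "g v0 = 0")
    case True
    then have "\<alpha> = 0" using gu by simp
    then show ?thesis using F(1) F2 by (simp add: \<alpha>_def)
  next
    case False
    have "g v0 * f u = g v0 * (F * f v)" using gu gv F(1) by (simp add: field_simps)
    then show ?thesis using False by simp
  qed
qed

lemma minimal_eigen:
  assumes f: "eigen s f" "0 < s" "f v0 = 1"
    and min: "\<And>g. eigen s g \<Longrightarrow> (\<And>x. g x \<le> f x) \<Longrightarrow> (\<And>x. g x = g v0 * f x)"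
  shows "\<exists>\<omega>\<in>ends E. \<exists>r\<in>{1/2..1}. \<forall>v w. E v w \<longrightarrow> s * f w = step \<omega> r v w * f v"
proof -
  obtain F where F: "0 < F" "s * (1 + real q * F\<^sup>2) = F" "real q * F\<^sup>2 \<le> 1" "\<And>u v. E u v \<Longrightarrow> F * f u \<le> f v"
    using eigen_root[OF f] by blast
  note pos = eigen_pos[OF f]
  have ratio: "f v = F * f u \<or> f u = F * f v" if "E u v" for u v
    by (rule eigen_edge_ratio[OF f min F that])
  note c = sum_pow_dst(2)[OF F(1,2)]
  have F1: "F < 1"
  proof (rule ccontr)
    assume "\<not> F < 1"
    then have "1 \<le> F\<^sup>2" by simp
    then have "2 * 1 \<le> real q * F\<^sup>2" using q_ge2 by (intro mult_mono) auto
    then show False using F(3) by simp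
  qed
  have ex1: "\<exists>!w. E v w \<and> f v = F * f w" for v
  proof -
    define A where "A = {w. E v w \<and> f v = F * f w}"
    define B where "B = {w. E v w \<and> f v \<noteq> F * f w}"
    have fin: "finite A" "finite B" by (rule finite_subset[OF _ finite_nbrs[of v]]; auto simp: A_def B_def)+
    have AB: "{w. E v w} = A \<union> B" "A \<inter> B = {}" by (auto simp: A_def B_def)
    have card: "real (card A) + real (card B) = q + 1"
      using card_nbrs[of v] AB fin card_Un_disjoint[of A B] by simp
    have "(\<Sum>w | E v w. f w) = (\<Sum>w\<in>A. f w) + (\<Sum>w\<in>B. f w)"
      unfolding AB(1) using fin AB(2) by (rule sum.union_disjoint)
    also have "(\<Sum>w\<in>A. f w) = (\<Sum>w\<in>A. f v / F)" using F(1) by (intro sum.cong) (auto simp: A_def)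
    also have "(\<Sum>w\<in>B. f w) = (\<Sum>w\<in>B. F * f v)" using ratio by (intro sum.cong) (auto simp: B_def)
    finally have "s * (\<Sum>w | E v w. f w) = s * (card A / F + card B * F) * f v"
      by (simp add: algebra_simps)
    then have "s * (card A / F + card B * F) * f v = s * (1 / F + real q * F) * f v"
      using eigenD(2)[OF f(1), of v] c by simp
    then have "card A / F + card B * F = 1 / F + real q * F" using pos[of v] f(2) by simp
    moreover have cB: "real (card B) = real q + 1 - real (card A)" using card by simp
    \<comment> \<open>The equation at \<open>v\<close> is compared with the balance for one
      neighbour of factor \<open>1 / F\<close> and \<open>q\<close> of factor \<open>F\<close>;
      since there are \<open>q + 1\<close> neighbours in all, only this product remains.\<close>
    ultimately have "(real (card A) - 1) * (1 / F - F) = 0" unfolding cB by (simp add: algebra_simps)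
    moreover have "1 / F - F \<noteq> 0"
    proof -
      have "F * F < 1" using F(1) F1 by (metis mult_strict_mono' less_eq_real_def mult_1)
      then show ?thesis using F(1) by (simp add: field_simps)
    qed
    ultimately have "card A = 1" by simp
    then obtain x where x: "A = {x}" by (rule card_1_singletonE)
    have iff: "E v w \<and> f v = F * f w \<longleftrightarrow> w = x" for w
      using x unfolding A_def set_eq_iff mem_Collect_eq singleton_iff by blast
    then show ?thesis by (simp only: iff) blast
  qed
  define U where "U v = (THE w. E v w \<and> f v = F * f w)" for v
  have U: "E v (U v)" "f v = F * f (U v)" for v using theI'[OF ex1[of v]] by (auto simp: U_def)
  have U_eq: "w = U v" if "E v w" "f v = F * f w" for v w using ex1[of v] U[of v] that by blast
  have f_incr: "f v < f (U v)" for v using U(2)[of v] pos[of "U v"] F1 by simp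
  have rayU: "(\<lambda>i. (U ^^ i) v) \<in> rays E" for v
  proof (rule raysI)
    show "E ((U ^^ i) v) ((U ^^ Suc i) v)" for i using U(1) by simp
    show "(U ^^ Suc (Suc i)) v \<noteq> (U ^^ i) v" for i
      using f_incr[of "(U ^^ i) v"] f_incr[of "U ((U ^^ i) v)"] by auto
  qed
  obtain \<omega> where \<omega>: "\<omega> \<in> ends E" "(\<lambda>i. (U ^^ i) v0) \<in> \<omega>" using end_of_ray[OF rayU] by blast
  \<comment> \<open>Across an edge one vertex is the \<open>U\<close>-successor of the other, so the
    two orbits share a tail and define the same end.\<close>
  have "(E ^^ n) v0 v \<Longrightarrow> (\<lambda>i. (U ^^ i) v) \<in> \<omega>" for n v
  proof (induction n arbitrary: v)
    case (Suc n)
    then obtain w where w: "(E ^^ n) v0 w" "E w v" by auto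
    note IH = Suc.IH[OF w(1)]
    show ?case
    proof (cases "f w = F * f v")
      case True
      then have "v = U w" using U_eq w(2) by blast
      then show ?thesis by (intro end_closed[OF \<omega>(1) IH rayU, where m = 1 and n = 0]) (auto simp: funpow_swap1)
    next
      case False
      then have "w = U v" using U_eq[OF E_sym[OF w(2)]] ratio[OF w(2)] by blast
      then show ?thesis by (intro end_closed[OF \<omega>(1) IH rayU, where m = 0 and n = 1]) (auto simp: funpow_swap1)
    qed
  qed (use \<omega>(2) in auto)
  then have "(\<lambda>i. (U ^^ i) v) \<in> \<omega>" for v using connected by blast
  then have "ray \<omega> v = (\<lambda>i. (U ^^ i) v)" for v by (intro ray_eqI[OF \<omega>(1)]) auto
  then have up: "up \<omega> v = U v" for v by (simp add: up_def)
  \<comment> \<open>Multiplied by \<open>s / f v\<close>, the values at the neighbours of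
    \<open>v\<close> become probabilities: \<open>s / F\<close> for the increasing edge and
    \<open>s * F\<close> for the others. The equation for \<open>F\<close> makes \<open>r\<close>
    equal to \<open>1 / (1 + q F^2)\<close>.\<close>
  define r where "r = s / F"
  have r: "(1 - r) / q = s * F" using c q_ge2 by (simp add: r_def field_simps)
  have "r * (1 + real q * F\<^sup>2) = 1" using F(1,2) by (simp add: r_def)
  moreover have "r * (1 + real q * F\<^sup>2) \<le> r * 2" using F(1,3) f(2) by (intro mult_left_mono) (auto simp: r_def)
  ultimately have r_ge: "1 / 2 \<le> r" by simp
  have "0 \<le> (1 - r) / q" unfolding r using f(2) F(1) by simp
  then have r_le: "r \<le> 1" using q_ge2 by (simp add: zero_le_divide_iff)
  have "s * f w = step \<omega> r v w * f v" if e: "E v w" for v w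
  proof (cases "w = U v")
    case True
    then show ?thesis using U(2)[of v] F(1) by (simp add: step_def up r_def)
  next
    case False
    then have "f w = F * f v" using ratio[OF e] U_eq[OF e] by blast
    then show ?thesis using False r by (simp add: step_def up)
  qed
  then show ?thesis using \<omega>(1) r_ge r_le by (intro bexI[of _ \<omega>] bexI[of _ r]) auto
qed

lemma minimal_follows:
  assumes h: "minimal h"
  shows "\<exists>\<omega>\<in>ends E. \<exists>r\<in>{1/2..1}. follows \<omega> r h"
proof (cases "h 2 v0 = 0")
  case True
  then show ?thesis using minimal_geodesic[OF h] by (metis atLeastAtMost_iff half_bounded_equal order_refl divide_le_eq_1_pos one_le_numeral zero_less_numeral)
next
  case False
  have har: "harmonic h" and h0: "h 0 v0 = 1" using h by (auto simp: minimal_def)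
  have "0 \<le> h 2 v0" by (rule harmonic_nonneg[OF har]) (simp add: walk_iff)
  then have c: "0 < h 2 v0" using False by simp
  \<comment> \<open>Two levels at a fixed vertex cost the factor \<open>h 2 v0\<close>, so its root
    is the factor per level.\<close>
  define s where "s = sqrt (h 2 v0)"
  have s: "0 < s" "s\<^sup>2 = h 2 v0" using c by (auto simp: s_def)
  \<comment> \<open>The distance is the first level at which \<open>v\<close> occurs, and later ones
    follow in steps of two. The scaling glues the two parity classes into one function on the
    tree.\<close>
  define f where "f v = h (dst v0 v) v / s ^ dst v0 v" for v
  have hf: "h n v = s ^ n * f v" if D: "(E ^^ n) v0 v" for n v
  proof -
    have "h (dst v0 v + 2 * k) v = s ^ (dst v0 v + 2 * k) * f v" for k
    proof (induction k)
      case 0 then show ?case using s(1) by (simp add: f_def)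
    next
      case (Suc k)
      have "(E ^^ (dst v0 v + 2 * k)) v0 v" by (simp add: walk_iff)
      from minimal_shift[OF h this] show ?case using Suc s(2) by (simp add: power2_eq_square mult.assoc)
    qed
    moreover have "even (n - dst v0 v)" "n = dst v0 v + (n - dst v0 v)" using D by (auto simp: walk_iff)
    ultimately show ?thesis by (metis evenE)
  qed
  have f: "eigen s f"
    unfolding eigen_def
  proof (intro allI conjI)
    fix v
    have D: "(E ^^ dst v0 v) v0 v" by (rule dst_walk)
    show "0 \<le> f v" using harmonic_nonneg[OF har D] s(1) by (simp add: f_def)
    have "s ^ dst v0 v * f v = (\<Sum>w | E v w. h (Suc (dst v0 v)) w)" using hf[OF D] harmonic_sum[OF har D] by simp
    also have "\<dots> = (\<Sum>w | E v w. s ^ Suc (dst v0 v) * f w)"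
      using hf relpowp_Suc_I[OF D] by (intro sum.cong) auto
    also have "\<dots> = s ^ dst v0 v * (s * (\<Sum>w | E v w. f w))" by (simp add: sum_distrib_left mult.assoc mult.left_commute)
    finally show "f v = s * (\<Sum>w | E v w. f w)" using s(1) by simp
  qed
  have f0: "f v0 = 1" by (simp add: f_def h0)
  \<comment> \<open>An eigenfunction below \<open>f\<close> with the same \<open>s\<close> yields a
    harmonic function below \<open>h\<close>, so \<open>f\<close> inherits minimality among
    eigenfunctions.\<close>
  have "g x = g v0 * f x" if g: "eigen s g" and le: "\<And>x. g x \<le> f x" for g x
  proof -
    have D: "(E ^^ dst v0 x) v0 x" by (rule dst_walk)
    have "s ^ dst v0 x * g x = (s ^ 0 * g v0) * h (dst v0 x) x"
    proof (rule minimalD[OF h eigen_harmonic[OF g s(1)] _ D, where C = 1])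
      fix n v assume "(E ^^ n) v0 v"
      then show "s ^ n * g v \<le> 1 * h n v" using hf le s(1) by simp
    qed
    then show ?thesis using hf[OF D] s(1) by simp
  qed
  from minimal_eigen[OF f s(1) f0 this]
  obtain \<omega> r where \<omega>: "\<omega> \<in> ends E" "r \<in> {1/2..1}" and st: "\<And>v w. E v w \<Longrightarrow> s * f w = step \<omega> r v w * f v"
    by blast
  have "follows \<omega> r h"
    unfolding follows_def
  proof (intro conjI allI impI)
    fix n v w assume D: "(E ^^ n) v0 v" and e: "E v w"
    show "h (Suc n) w = step \<omega> r v w * h n v"
      using hf[OF D] hf[OF relpowp_Suc_I[OF D e]] st[OF e] by (simp add: mult.left_commute mult.assoc)
  qed (rule h0)
  then show ?thesis using \<omega> by blast
qed

subsection \<open>Ergodic measures\<close>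

text \<open>A harmonic function dominated by a multiple of \<open>h\<close> is, once normalized, a
  convex component of \<open>h\<close>; conversely a component of weight \<open>t\<close> is
  dominated by \<open>h / t\<close>. \<open>represents_exists\<close> and
  \<open>borel_mixture\<close> carry the first decomposition over to measures.\<close>

lemma ergodic_iff_minimal:
  assumes M: "represents M h"
    and h: "harmonic h" "h 0 v0 = 1"
  shows "M \<in> ergodic_central_measures E v0 \<longleftrightarrow> minimal h"
proof
  assume erg: "M \<in> ergodic_central_measures E v0"
  note bM = M[unfolded represents_def, THEN conjunct1]
  have "g n v = g 0 v0 * h n v"
    if g: "harmonic g" and le: "\<forall>n v. (E ^^ n) v0 v \<longrightarrow> g n v \<le> C * h n v" and nv: "(E ^^ n) v0 v" for g C n v
  proof -
    have D0: "(E ^^ 0) v0 v0" by simp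
    have g0: "0 \<le> g 0 v0" by (rule harmonic_nonneg[OF g D0])
    show ?thesis
    proof (cases "g 0 v0 = 0")
      case True
      have "(E ^^ n) v0 v \<Longrightarrow> g n v \<le> 0" for n v
      proof (induction n arbitrary: v)
        case 0 then show ?case using True by auto
      next
        case (Suc n)
        then obtain w where w: "(E ^^ n) v0 w" "E w v" by auto
        then show ?case using harmonic_edge_le[OF g w] Suc.IH[OF w(1)] by simp
      qed
      then show ?thesis using harmonic_nonneg[OF g nv] nv True by force
    next
      case False
      \<comment> \<open>The extra summand keeps \<open>K\<close> above \<open>g 0 v0\<close>, so
        that \<open>t < 1\<close> and \<open>h2\<close> can be normalized even if \<open>C\<close>
        equals \<open>g 0 v0\<close>.\<close>
      define K where "K = C + g 0 v0"
      define t where "t = g 0 v0 / K"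
      have C: "g 0 v0 \<le> C" using le[rule_format, OF D0] h(2) by simp
      have g0': "0 < g 0 v0" using False g0 by simp
      have K: "g 0 v0 < K" using C g0' by (simp add: K_def)
      have t: "t \<in> {0<..<1}" using g0' K by (simp add: t_def)
      define h1 where "h1 n v = g n v / g 0 v0" for n v
      define h2 where "h2 n v = (K * h n v - g n v) / (K - g 0 v0)" for n v
      have har1: "harmonic h1"
        unfolding harmonic_def h1_def
      proof (intro allI impI conjI)
        fix n v assume D: "(E ^^ n) v0 v"
        show "0 \<le> g n v / g 0 v0" using harmonic_nonneg[OF g D] g0' by simp
        show "g n v / g 0 v0 = (\<Sum>w | E v w. g (Suc n) w / g 0 v0)"
          using harmonic_sum[OF g D] by (simp only: sum_divide_distrib)
      qed
      have har2: "harmonic h2"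
        unfolding harmonic_def
      proof (intro allI impI conjI)
        fix n v assume D: "(E ^^ n) v0 v"
        have "g n v \<le> C * h n v" using le D by blast
        also have "\<dots> \<le> K * h n v"
          using harmonic_nonneg[OF h(1) D] g0 by (intro mult_right_mono) (auto simp: K_def)
        finally show "0 \<le> h2 n v" using K by (simp add: h2_def)
        show "h2 n v = (\<Sum>w | E v w. h2 (Suc n) w)"
          unfolding h2_def sum_divide_distrib[symmetric] sum_subtractf sum_distrib_left[symmetric]
          using harmonic_sum[OF h(1) D] harmonic_sum[OF g D] by simp
      qed
      obtain M1 where M1: "represents M1 h1" using represents_exists[OF har1] g0' by (auto simp: h1_def)
      obtain M2 where M2: "represents M2 h2" using represents_exists[OF har2] K h(2) by (auto simp: h2_def)
      have mix: "h n v = t * h1 n v + (1 - t) * h2 n v" for n v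
      proof -
        have "K \<noteq> 0" "g 0 v0 \<noteq> 0" "K - g 0 v0 \<noteq> 0" using K g0' by auto
        moreover from this have "1 - t = (K - g 0 v0) / K" by (simp add: t_def field_simps)
        ultimately show ?thesis unfolding h1_def h2_def by (simp add: t_def field_simps)
      qed
      have "\<forall>A\<in>sets M. measure M A = t * measure M1 A + (1 - t) * measure M2 A"
      proof (rule ballI, rule borel_mixture)
        fix p assume "p \<in> FP"
        then show "measure M (cyl p) = t * measure M1 (cyl p) + (1 - t) * measure M2 (cyl p)"
          using M M1 M2 mix[of "fst (last p)" "snd (last p)"] by (simp add: represents_def)
      qed (use M M1 M2 in \<open>simp_all add: represents_def\<close>)
      then have "M1 = M"
        using erg t represents_central[OF M1] represents_central[OF M2]
        unfolding ergodic_central_measures_def extreme_measures_def by blast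
      then have "h1 n v = h n v"
        using ex_FP[OF nv] represents_D[OF M] represents_D[OF M1] by metis
      then show ?thesis using g0' by (simp add: h1_def field_simps)
    qed
  qed
  then show "minimal h" using h unfolding minimal_def by blast
next
  assume min: "minimal h"
  have *: "M1 = M"
    if M1: "M1 \<in> central_measures E v0" and M2: "M2 \<in> central_measures E v0" and t: "0 < t" "t < 1"
      and mix: "\<forall>A\<in>sets M. measure M A = t * measure M1 A + (1 - t) * measure M2 A" for M1 M2 t
  proof -
    obtain h1 where h1: "harmonic h1" "h1 0 v0 = 1" "represents M1 h1" using central_represents[OF M1] by blast
    obtain h2 where h2: "harmonic h2" "h2 0 v0 = 1" "represents M2 h2" using central_represents[OF M2] by blast
    have le: "h1 n v \<le> (1 / t) * h n v" if D: "(E ^^ n) v0 v" for n v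
    proof -
      obtain p where p: "p \<in> FP" "last p = (n, v)" using ex_FP[OF D] by blast
      have "cyl p \<in> sets M" using borelD(4) M p(1) by (auto simp: represents_def)
      then have "h n v = t * h1 n v + (1 - t) * h2 n v"
        using mix represents_D[OF M p] represents_D[OF h1(3) p] represents_D[OF h2(3) p] by simp
      then have "t * h1 n v \<le> h n v" using harmonic_nonneg[OF h2(1) D] t by simp
      then show ?thesis using t by (simp add: field_simps)
    qed
    have "h1 n v = h n v" if "(E ^^ n) v0 v" for n v
      using minimalD[OF min h1(1) le that] h1(2) by simp
    then have "represents M1 h" using h1(3) represents_cong by metis
    then show ?thesis using M represents_unique by blast
  qed
  show "M \<in> ergodic_central_measures E v0"
    unfolding ergodic_central_measures_def extreme_measures_def
  proof (intro CollectI conjI ballI impI)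
    show "M \<in> central_measures E v0" using represents_central[OF M] .
    fix M1 M2 t
    assume a: "M1 \<in> central_measures E v0" "M2 \<in> central_measures E v0" "t \<in> {0<..<1::real}"
      "\<forall>A\<in>sets M. measure M A = t * measure M1 A + (1 - t) * measure M2 A"
    show "M1 = M" using *[OF a(1,2) _ _ a(4)] a(3) by simp
    show "M2 = M" using *[OF a(2,1), of "1 - t"] a(3,4) by simp
  qed
qed

text \<open>Products of transition probabilities satisfy the recursion of \<open>lam\<close>, so the
  Markov law and representation by \<open>lam\<close> are the same condition. It has exactly one
  solution, which resolves the definite description.\<close>

lemma lambda_represents:
  assumes \<omega>: "\<omega> \<in> ends E" and r: "0 \<le> r" "r \<le> 1"
  shows "represents (lambda_measure q E v0 \<omega> r) (lam \<omega> r)"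
proof -
  let ?P = "lambda_transition q \<omega> r"
  have P: "?P a b = step \<omega> r (snd a) (snd b)" for a b
    using end_directed_iff[OF \<omega>] by (simp add: lambda_transition_def step_def)
  have prod: "(\<Prod>i<length p - 1. ?P (p ! i) (p ! Suc i)) = lam \<omega> r (fst (last p)) (snd (last p))"
    if "p \<in> FP" for p
    using that
  proof (induction p rule: FP_induct)
    case init then show ?case using follows_0[OF lam_follows[OF \<omega>]] by simp
  next
    case (snoc p w)
    obtain k where k: "length p = Suc k" using FP_length[OF snoc.hyps(1)] by blast
    have l: "last p = p ! k" using k by (metis diff_Suc_1 last_conv_nth length_0_conv nat.distinct(1))
    let ?p = "p @ [(Suc (fst (last p)), w)]"
    have "(\<Prod>i<length ?p - 1. ?P (?p ! i) (?p ! Suc i)) =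
        (\<Prod>i<k. ?P (?p ! i) (?p ! Suc i)) * ?P (last p) (Suc (fst (last p)), w)"
      using k l by (simp add: nth_append)
    also have "(\<Prod>i<k. ?P (?p ! i) (?p ! Suc i)) = (\<Prod>i<k. ?P (p ! i) (p ! Suc i))"
      using k by (intro prod.cong) (auto simp: nth_append)
    also have "\<dots> = lam \<omega> r (fst (last p)) (snd (last p))" using snoc.IH k by simp
    finally show ?case
      using followsD[OF lam_follows[OF \<omega>] FP_walk[OF snoc.hyps(1)] snoc.hyps(2), of r] P by simp
  qed
  have iff: "markov_law E v0 ?P M \<longleftrightarrow> represents M (lam \<omega> r)" for M
    using prod by (auto simp: markov_law_def represents_def)
  have "harmonic (lam \<omega> r)" "lam \<omega> r 0 v0 = 1"
    using follows_harmonic[OF \<omega> r lam_follows[OF \<omega>]] follows_0[OF lam_follows[OF \<omega>]] by auto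
  then have "\<exists>!M. markov_law E v0 ?P M" using represents_exists represents_unique by (metis iff)
  from theI'[OF this] show ?thesis by (simp add: lambda_measure_def iff)
qed

lemma ergodic_eq:
  "ergodic_central_measures E v0 = {lambda_measure q E v0 \<omega> r | \<omega> r. \<omega> \<in> ends E \<and> r \<in> {1/2..1}}"
proof (intro equalityI subsetI)
  fix M assume M: "M \<in> ergodic_central_measures E v0"
  then have "M \<in> central_measures E v0" by (simp add: ergodic_central_measures_def extreme_measures_def)
  then obtain h where h: "harmonic h" "h 0 v0 = 1" "represents M h" using central_represents by blast
  then have "minimal h" using ergodic_iff_minimal M by blast
  then obtain \<omega> r where \<omega>: "\<omega> \<in> ends E" "r \<in> {1/2..1}" "follows \<omega> r h" using minimal_follows by blast
  have "represents M (lam \<omega> r)"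
    using h(3) represents_cong[OF follows_unique[OF \<omega>(3) lam_follows[OF \<omega>(1)]]] by simp
  then have "M = lambda_measure q E v0 \<omega> r"
    using lambda_represents[OF \<omega>(1)] \<omega>(2) by (intro represents_unique) auto
  then show "M \<in> {lambda_measure q E v0 \<omega> r | \<omega> r. \<omega> \<in> ends E \<and> r \<in> {1/2..1}}" using \<omega> by blast
next
  fix M assume "M \<in> {lambda_measure q E v0 \<omega> r | \<omega> r. \<omega> \<in> ends E \<and> r \<in> {1/2..1}}"
  then obtain \<omega> r where M: "M = lambda_measure q E v0 \<omega> r" and \<omega>: "\<omega> \<in> ends E" and r: "1/2 \<le> r" "r \<le> 1" by auto
  have rep: "represents M (lam \<omega> r)" unfolding M using r by (intro lambda_represents[OF \<omega>]) auto
  have "minimal (lam \<omega> r)" using follows_minimal[OF \<omega> r lam_follows[OF \<omega>]] .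
  then show "M \<in> ergodic_central_measures E v0"
    using ergodic_iff_minimal[OF rep] by (simp add: minimal_def)
qed

subsection \<open>Continuous functions on the path space\<close>

lemma closed_cyl: "p \<in> FP \<Longrightarrow> openin PT (PS - cyl p)"
  unfolding openin_PT_iff
proof (intro conjI ballI)
  fix w assume p: "p \<in> FP" and w: "w \<in> PS - cyl p"
  have "cyl (prefix w (fst (last p))) \<subseteq> PS - cyl p"
  proof
    fix x assume x: "x \<in> cyl (prefix w (fst (last p)))"
    then have "x \<in> PS" "prefix x (fst (last p)) = prefix w (fst (last p))"
      using in_cyl_iff[OF prefix_FP[of w "fst (last p)"], of x] w paths_walk[of w] by auto
    then show "x \<in> PS - cyl p" using w p by (auto simp: in_cyl_iff)
  qed
  then show "\<exists>n. cyl (prefix w n) \<subseteq> PS - cyl p" by blast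
qed auto

lemma continuous_indicator_cyl:
  assumes "p \<in> FP"
  shows "continuous_map PT euclideanreal (indicator (cyl p))"
  unfolding continuous_map_def
proof (intro conjI allI impI)
  fix U :: "real set"
  let ?V = "{x \<in> topspace PT. indicator (cyl p) x \<in> U}"
  have "?V = (if 1 \<in> U then cyl p else {}) \<union> (if 0 \<in> U then PS - cyl p else {})"
    using cyl_subset[of p] by (auto simp: indicator_def)
  moreover have "openin PT (if 1 \<in> U then cyl p else {})" "openin PT (if 0 \<in> U then PS - cyl p else {})"
    using openin_cyl[OF assms] closed_cyl[OF assms] by auto
  ultimately show "openin PT ?V" by (simp only: openin_Un)
qed auto

text \<open>Compactness of the path space as Koenig's lemma: if no level works on a cylinder, none
  works on one of its finitely many extensions, and the resulting infinite path contradicts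
  continuity there.\<close>

lemma uniform_on_cylinders:
  assumes f: "continuous_map PT euclideanreal f" and e: "0 < e"
  shows "\<exists>n. \<forall>w\<in>PS. \<forall>w'\<in>PS. prefix w n = prefix w' n \<longrightarrow> \<bar>f w - f w'\<bar> < e"
proof (rule ccontr)
  assume contr: "\<not> ?thesis"
  define bad where "bad p \<longleftrightarrow> p \<in> FP \<and>
    (\<forall>n. \<exists>w\<in>cyl p. \<exists>w'\<in>cyl p. prefix w n = prefix w' n \<and> \<not> \<bar>f w - f w'\<bar> < e)" for p
  have bad0: "bad [(0, v0)]" using contr by (auto simp: bad_def)
  have bad_step: "\<exists>w. E (snd (last p)) w \<and> bad (p @ [(Suc (fst (last p)), w)])" if p: "bad p" for p
  proof (rule ccontr)
    assume none: "\<not> ?thesis"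
    have pF: "p \<in> FP" using p by (simp add: bad_def)
    let ?ext = "\<lambda>w. p @ [(Suc (fst (last p)), w)]"
    have "\<exists>n. \<forall>x\<in>cyl (?ext w). \<forall>x'\<in>cyl (?ext w). prefix x n = prefix x' n \<longrightarrow> \<bar>f x - f x'\<bar> < e"
      if "E (snd (last p)) w" for w
      using none FP_snoc[OF pF that] that unfolding bad_def by blast
    then obtain N where N: "\<And>w x x'. E (snd (last p)) w \<Longrightarrow> x \<in> cyl (?ext w) \<Longrightarrow> x' \<in> cyl (?ext w) \<Longrightarrow>
      prefix x (N w) = prefix x' (N w) \<Longrightarrow> \<bar>f x - f x'\<bar> < e" by metis
    \<comment> \<open>Besides the levels \<open>N w\<close>, the next level is included, so that
      paths agreeing up to \<open>m\<close> lie in the same extension.\<close>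
    define m where "m = Max (insert (Suc (fst (last p))) (N ` {w. E (snd (last p)) w}))"
    have m: "Suc (fst (last p)) \<le> m" "\<And>w. E (snd (last p)) w \<Longrightarrow> N w \<le> m"
      unfolding m_def by (rule Max_ge; auto)+
    obtain x x' where x: "x \<in> cyl p" "x' \<in> cyl p" "prefix x m = prefix x' m" "\<not> \<bar>f x - f x'\<bar> < e"
      using p unfolding bad_def by blast
    have eq: "x i = x' i" if "i \<le> m" for i using x(3) that nth_prefix by metis
    have pre: "prefix x k = prefix x' k" if "k \<le> m" for k
      using eq that by (auto simp: prefix_def)
    obtain w where w: "E (snd (last p)) w" "x \<in> cyl (?ext w)" using x(1) cyl_split[OF pF] by blast
    have "x' \<in> cyl (?ext w)"
      using w(2) x(2) pre[OF m(1)] in_cyl_iff[OF FP_snoc[OF pF w(1)]] in_cyl_iff[OF pF] by auto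
    then show False using N[OF w(1,2)] pre[OF m(2)[OF w(1)]] x(4) by blast
  qed
  have "\<exists>P. \<forall>n. (bad (P n) \<and> length (P n) = Suc n) \<and>
      (\<exists>w. E (snd (last (P n))) w \<and> P (Suc n) = P n @ [(Suc (fst (last (P n))), w)])"
  proof (rule dependent_nat_choice)
    show "\<exists>p. bad p \<and> length p = Suc 0" using bad0 by (intro exI[of _ "[(0, v0)]"]) simp
    fix p n assume "bad p \<and> length p = Suc n"
    then show "\<exists>y. (bad y \<and> length y = Suc (Suc n)) \<and> (\<exists>w. E (snd (last p)) w \<and> y = p @ [(Suc (fst (last p)), w)])"
      using bad_step[of p] by auto
  qed
  then obtain P where P: "\<And>n. bad (P n)" "\<And>n. length (P n) = Suc n"
    and Pn: "\<And>n. \<exists>w. P (Suc n) = P n @ [(Suc (fst (last (P n))), w)]" by blast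
  have PF: "P n \<in> FP" for n using P(1) by (simp add: bad_def)
  define W where "W n = last (P n)" for n
  have PS: "P (Suc n) = P n @ [W (Suc n)]" for n using Pn[of n] by (auto simp: W_def)
  have pre: "prefix W n = P n" for n
  proof (induction n)
    case 0
    obtain a where "P 0 = [a]" using P(2)[of 0] by (auto simp: length_Suc_conv)
    then show ?case by (simp add: prefix_def W_def)
  qed (simp add: prefix_Suc PS)
  have W: "W \<in> PS"
    unfolding paths_def
  proof (intro CollectI conjI allI)
    have "W 0 = hd (P 0)" using pre[of 0] hd_prefix by metis
    then show "W 0 = (0, v0)" using PF[of 0] by (simp add: finite_paths_def)
    show "dyn_prec E v0 (W i) (W (Suc i))" for i
      using FP_snocD(2)[OF PF[of "Suc i", unfolded PS] FP_nonempty[OF PF]] by (simp add: W_def)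
  qed
  \<comment> \<open>With radius \<open>e / 2\<close>, two values of \<open>f\<close> on a small
    cylinder around \<open>W\<close> differ by less than \<open>e\<close>.\<close>
  have "openin PT {x \<in> topspace PT. f x \<in> ball (f W) (e / 2)}"
    using openin_continuous_map_preimage[OF f, of "ball (f W) (e / 2)"] by simp
  moreover have "W \<in> {x \<in> topspace PT. f x \<in> ball (f W) (e / 2)}" using W e by simp
  ultimately obtain n where n: "cyl (prefix W n) \<subseteq> {x \<in> topspace PT. f x \<in> ball (f W) (e / 2)}"
    unfolding openin_PT_iff by blast
  obtain x x' where "x \<in> cyl (P n)" "x' \<in> cyl (P n)" "\<not> \<bar>f x - f x'\<bar> < e"
    using P(1)[of n] unfolding bad_def by blast
  moreover from this have "dist (f W) (f x) < e / 2" "dist (f W) (f x') < e / 2"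
    using n by (auto simp: pre)
  ultimately show False unfolding dist_real_def by linarith
qed

text \<open>\<open>f\<close> is compared with the step function taking one sample value on each
  cylinder of level \<open>n\<close>. The integral is thus controlled by finitely many cylinder
  masses.\<close>

lemma integral_cylinder_approx:
  assumes M: "M \<in> borel_prob_measures PT"
    and f: "continuous_map PT euclideanreal f" "bounded (f ` PS)"
    and n: "\<And>w w'. w \<in> PS \<Longrightarrow> w' \<in> PS \<Longrightarrow> prefix w n = prefix w' n \<Longrightarrow> \<bar>f w - f w'\<bar> < e"
  shows "\<bar>integral\<^sup>L M f - (\<Sum>p | p \<in> FP \<and> length p = Suc n. f (SOME w. w \<in> cyl p) * measure M (cyl p))\<bar> \<le> e"
proof -
  interpret prob_space M using borelD(1)[OF M] .
  note sp = borelD(3)[OF M] and cs = borelD(4)[OF M]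
  let ?A = "{p \<in> FP. length p = Suc n}"
  define r where "r p = (SOME w. w \<in> cyl p)" for p
  have "f \<in> borel_measurable M"
  proof (rule borel_measurableI)
    fix S :: "real set" assume "open S"
    then have "openin PT {x \<in> topspace PT. f x \<in> S}"
      using openin_continuous_map_preimage[OF f(1), of S] by simp
    then have "{x \<in> PS. f x \<in> S} \<in> sets M"
      using borelD(2)[OF M] sigma_sets_open by (auto intro: sigma_sets.Basic)
    moreover have "f -` S \<inter> space M = {x \<in> PS. f x \<in> S}" by (auto simp: sp)
    ultimately show "f -` S \<inter> space M \<in> sets M" by simp
  qed
  moreover obtain B where "\<And>w. w \<in> PS \<Longrightarrow> norm (f w) \<le> B" using f(2) by (auto simp: bounded_iff)
  ultimately have int_f: "integrable M f" by (intro integrable_const_bound[of _ B]) (auto simp: sp)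
  define g where "g w = (\<Sum>p\<in>?A. f (r p) * indicator (cyl p) w)" for w :: "nat \<Rightarrow> nat \<times> 'v"
  have int_ind: "integrable M (indicator (cyl p) :: _ \<Rightarrow> real)" if "p \<in> FP" for p
    using cs[OF that] by (simp add: emeasure_eq_measure)
  have int_g: "integrable M g"
    unfolding g_def using int_ind by (intro Bochner_Integration.integrable_sum integrable_mult_right) auto
  have "integral\<^sup>L M g = (\<Sum>p\<in>?A. f (r p) * measure M (cyl p))"
    unfolding g_def using int_ind cyl_subset
    by (subst Bochner_Integration.integral_sum)
       (auto intro!: sum.cong Bochner_Integration.integrable_mult_right simp: sp Int_absorb2)
  moreover have "\<bar>integral\<^sup>L M f - integral\<^sup>L M g\<bar> \<le> e"
  proof -
    have fg: "\<bar>f w - g w\<bar> \<le> e" if w: "w \<in> PS" for w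
    proof -
      let ?p = "prefix w n"
      have p: "?p \<in> ?A" using prefix_FP[OF w] by simp
      have "g w = (\<Sum>p\<in>?A. if p = ?p then f (r p) else 0)"
        unfolding g_def
      proof (rule sum.cong)
        fix p assume "p \<in> ?A"
        then have "fst (last p) = n" "p \<in> FP" using FP_length by fastforce+
        then have "w \<in> cyl p \<longleftrightarrow> p = ?p" using w in_cyl_iff by auto
        then show "f (r p) * indicator (cyl p) w = (if p = ?p then f (r p) else 0)" by (auto simp: indicator_def)
      qed simp
      also have "\<dots> = f (r ?p)" using p finite_FP_level by (subst sum.delta) auto
      finally have g: "g w = f (r ?p)" .
      have "r ?p \<in> cyl ?p" unfolding r_def by (rule someI[of "\<lambda>x. x \<in> cyl ?p", OF in_cyl_prefix[OF w]])
      then have "r ?p \<in> PS" "prefix (r ?p) n = ?p"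
        using in_cyl_iff[OF prefix_FP[OF w], of "r ?p" n] paths_walk[OF w] by auto
      then show ?thesis using n[OF w, of "r ?p"] g by simp
    qed
    have "\<bar>integral\<^sup>L M f - integral\<^sup>L M g\<bar> = \<bar>\<integral>w. f w - g w \<partial>M\<bar>" using int_f int_g by simp
    also have "\<dots> \<le> (\<integral>w. \<bar>f w - g w\<bar> \<partial>M)" by (rule integral_abs_bound)
    also have "\<dots> \<le> (\<integral>w. e \<partial>M)" using int_f int_g fg by (intro integral_mono) (auto simp: sp)
    also have "\<dots> = e" by (simp add: prob_space)
    finally show ?thesis .
  qed
  ultimately show ?thesis by (simp add: r_def)
qed

lemma topspace_weak [simp]: "topspace (weak_topology PT) = borel_prob_measures PT"
proof -
  let ?S = "{{M \<in> borel_prob_measures PT. integral\<^sup>L M f \<in> U} | (f :: _ \<Rightarrow> real) U.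
    continuous_map PT euclideanreal f \<and> bounded (f ` topspace PT) \<and> open U}"
  have "borel_prob_measures PT = {M \<in> borel_prob_measures PT. integral\<^sup>L M (\<lambda>_. 0::real) \<in> UNIV}" by simp
  moreover have "bounded ((\<lambda>_. 0::real) ` topspace PT)" by (intro boundedI[of _ 0]) auto
  ultimately have "borel_prob_measures PT \<in> ?S"
    by (intro CollectI exI[of _ "\<lambda>_. 0"] exI[of _ UNIV]) simp
  moreover have "X \<subseteq> borel_prob_measures PT" if "X \<in> ?S" for X using that by blast
  ultimately have "\<Union>?S = borel_prob_measures PT" by (intro equalityI Union_least Union_upper)
  then show ?thesis unfolding weak_topology_def topology_generated_by_topspace .
qed

lemma continuous_measure_cyl:
  assumes p: "p \<in> FP"
  shows "continuous_map (weak_topology PT) euclideanreal (\<lambda>M. measure M (cyl p))"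
  unfolding continuous_map_def
proof (intro conjI allI impI)
  fix U :: "real set" assume "openin euclideanreal U"
  then have U: "open U" by simp
  have "bounded (indicator (cyl p) ` topspace PT :: real set)"
    by (intro boundedI[of _ 1]) (auto simp: indicator_def)
  then have "openin (weak_topology PT) {M \<in> borel_prob_measures PT. integral\<^sup>L M (indicator (cyl p)) \<in> U}"
    unfolding weak_topology_def using continuous_indicator_cyl[OF p] U
    by (intro topology_generated_by_Basis) blast
  moreover have "integral\<^sup>L M (indicator (cyl p)) = measure M (cyl p)" if "M \<in> borel_prob_measures PT" for M
    using borelD(3)[OF that] cyl_subset[of p] by (simp add: Int_absorb2)
  ultimately show "openin (weak_topology PT) {M \<in> topspace (weak_topology PT). measure M (cyl p) \<in> U}"
    by (auto cong: conj_cong elim!: back_subst[of "openin (weak_topology PT)"])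
qed auto

subsection \<open>The parametrization is a homeomorphism\<close>

abbreviation "param_measure \<equiv> \<lambda>(\<omega>, r). lambda_measure q E v0 \<omega> r"
abbreviation "param_space \<equiv> prod_topology (ends_topology E) (top_of_set {1/2..1::real})"
abbreviation "ergodic_space \<equiv> subtopology (weak_topology PT) (ergodic_central_measures E v0)"

section \<open>The topology of the ends and continuity of the parametrization\<close>

lemma topspace_ends [simp]: "topspace (ends_topology E) = ends E"
proof -
  have "\<omega> \<in> {\<omega> \<in> ends E. end_directed \<omega> v0 (up \<omega> v0)}" "E v0 (up \<omega> v0)" if "\<omega> \<in> ends E" for \<omega>
    using that end_directed_iff up_edge by auto
  then show ?thesis unfolding ends_topology_def topology_generated_by_topspace by blast
qed

lemma openin_directed: "E u v \<Longrightarrow> openin (ends_topology E) {\<omega> \<in> ends E. end_directed \<omega> u v}"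
  unfolding ends_topology_def by (intro topology_generated_by_Basis) blast

text \<open>Deleting an edge splits the ends into two complementary generating sets; the generators
  are therefore clopen.\<close>

lemma directed_flip: "\<omega> \<in> ends E \<Longrightarrow> E u v \<Longrightarrow> end_directed \<omega> u v \<longleftrightarrow> \<not> end_directed \<omega> v u"
  by (metis end_directed_iff up_cases up_up_neq)

lemma continuous_directed:
  assumes "E u v"
  shows "continuous_map (ends_topology E) euclideanreal (\<lambda>\<omega>. if end_directed \<omega> u v then 1 else 0)"
  unfolding continuous_map_def
proof (intro conjI allI impI)
  fix U :: "real set"
  let ?V = "{\<omega> \<in> topspace (ends_topology E). (if end_directed \<omega> u v then 1 else 0) \<in> U}"
  have "?V = (if 1 \<in> U then {\<omega> \<in> ends E. end_directed \<omega> u v} else {}) \<union>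
      (if 0 \<in> U then {\<omega> \<in> ends E. end_directed \<omega> v u} else {})"
    using directed_flip[OF _ assms] by auto
  then show "openin (ends_topology E) ?V"
    using openin_directed[OF assms] openin_directed[OF E_sym[OF assms]] by auto
qed auto

lemma continuous_snd_real: "continuous_map param_space euclideanreal snd"
  by (rule continuous_map_into_fulltopology[OF continuous_map_snd])

text \<open>Along a fixed walk to \<open>v\<close>, each factor depends on the end only through the
  clopen condition that the end lies beyond the edge, and on \<open>r\<close> linearly.\<close>

lemma continuous_lam:
  "(E ^^ n) v0 v \<Longrightarrow> continuous_map param_space euclideanreal (\<lambda>y. lam (fst y) (snd y) n v)"
proof (induction n arbitrary: v)
  case 0
  then have v: "v = v0" by auto
  show ?case unfolding v
    by (rule continuous_map_eq[where f = "\<lambda>_. 1"]) (use follows_0[OF lam_follows] in auto)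
next
  case (Suc n)
  then obtain w where w: "(E ^^ n) v0 w" "E w v" by auto
  let ?i = "\<lambda>\<omega>. if end_directed \<omega> w v then 1 else 0 :: real"
  have "continuous_map param_space euclideanreal (?i \<circ> fst)"
    by (rule continuous_map_compose[OF continuous_map_fst continuous_directed[OF w(2)]])
  then have i: "continuous_map param_space euclideanreal (\<lambda>y. ?i (fst y))" by (simp add: comp_def)
  have "continuous_map param_space euclideanreal
     (\<lambda>y. (?i (fst y) * snd y + (1 - ?i (fst y)) * ((1 - snd y) * (1 / real q))) * lam (fst y) (snd y) n w)"
    by (intro continuous_map_real_mult continuous_map_add continuous_map_diff i continuous_snd_real
        Suc.IH[OF w(1)]) auto
  then show ?case
  proof (rule continuous_map_eq)
    fix y assume "y \<in> topspace param_space"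
    then have \<omega>: "fst y \<in> ends E" by auto
    show "(?i (fst y) * snd y + (1 - ?i (fst y)) * ((1 - snd y) * (1 / real q))) * lam (fst y) (snd y) n w
        = lam (fst y) (snd y) (Suc n) v"
      using followsD[OF lam_follows[OF \<omega>] w, of "snd y"] end_directed_iff[OF \<omega>, of w v]
      by (simp add: step_def)
  qed
qed

lemma param_measure_represents:
  assumes "y \<in> topspace param_space"
  shows "represents (param_measure y) (lam (fst y) (snd y))" "param_measure y \<in> borel_prob_measures PT"
    "p \<in> FP \<Longrightarrow> measure (param_measure y) (cyl p) = lam (fst y) (snd y) (fst (last p)) (snd (last p))"
proof -
  show 1: "represents (param_measure y) (lam (fst y) (snd y))"
    using lambda_represents[of "fst y" "snd y"] assms by (auto simp: case_prod_unfold)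
  then show "param_measure y \<in> borel_prob_measures PT" 
    "p \<in> FP \<Longrightarrow> measure (param_measure y) (cyl p) = lam (fst y) (snd y) (fst (last p)) (snd (last p))"
    by (auto simp: represents_def)
qed

text \<open>A third of \<open>e\<close> goes to the cylinder approximation at each of the two
  parameters, and a third to the variation of the finite sum \<open>\<phi>\<close>, which is
  continuous.\<close>

lemma continuous_integral_param:
  assumes f: "continuous_map PT euclideanreal f" "bounded (f ` PS)" and U: "open U"
  shows "openin param_space {y \<in> topspace param_space. integral\<^sup>L (param_measure y) f \<in> U}"
proof (subst openin_subopen, intro ballI)
  fix y0 assume "y0 \<in> {y \<in> topspace param_space. integral\<^sup>L (param_measure y) f \<in> U}"
  then have y0: "y0 \<in> topspace param_space" "integral\<^sup>L (param_measure y0) f \<in> U" by auto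
  obtain e where e: "0 < e" "ball (integral\<^sup>L (param_measure y0) f) e \<subseteq> U" using U y0(2) openE by blast
  obtain n where n: "\<And>w w'. w \<in> PS \<Longrightarrow> w' \<in> PS \<Longrightarrow> prefix w n = prefix w' n \<Longrightarrow> \<bar>f w - f w'\<bar> < e / 3"
    using uniform_on_cylinders[OF f(1), of "e / 3"] e(1) by auto
  let ?A = "{p. p \<in> FP \<and> length p = Suc n}"
  define \<phi> where "\<phi> y = (\<Sum>p\<in>?A. f (SOME w. w \<in> cyl p) * lam (fst y) (snd y) (fst (last p)) (snd (last p)))" for y
  have approx: "\<bar>integral\<^sup>L (param_measure y) f - \<phi> y\<bar> \<le> e / 3" if y: "y \<in> topspace param_space" for y
    using integral_cylinder_approx[OF param_measure_represents(2)[OF y] f n] param_measure_represents(3)[OF y]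
    by (simp add: \<phi>_def)
  have "continuous_map param_space euclideanreal \<phi>"
    unfolding \<phi>_def using finite_FP_level FP_walk
    by (intro continuous_map_sum continuous_map_real_mult continuous_lam) auto
  from openin_continuous_map_preimage[OF this, of "ball (\<phi> y0) (e / 3)"]
  have "openin param_space {y \<in> topspace param_space. \<phi> y \<in> ball (\<phi> y0) (e / 3)}" by simp
  moreover have "{y \<in> topspace param_space. \<phi> y \<in> ball (\<phi> y0) (e / 3)} \<subseteq> {y \<in> topspace param_space. integral\<^sup>L (param_measure y) f \<in> U}"
  proof
    fix y assume "y \<in> {y \<in> topspace param_space. \<phi> y \<in> ball (\<phi> y0) (e / 3)}"
    then have y: "y \<in> topspace param_space" "\<bar>\<phi> y0 - \<phi> y\<bar> < e / 3" by (auto simp: dist_real_def)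
    then have "\<bar>integral\<^sup>L (param_measure y0) f - integral\<^sup>L (param_measure y) f\<bar> < e"
      using approx[OF y(1)] approx[OF y0(1)] by linarith
    then have "integral\<^sup>L (param_measure y) f \<in> U" using e(2) by (auto simp: dist_real_def)
    then show "y \<in> {y \<in> topspace param_space. integral\<^sup>L (param_measure y) f \<in> U}" using y(1) by blast
  qed
  ultimately show "\<exists>T. openin param_space T \<and> y0 \<in> T \<and> T \<subseteq> {y \<in> topspace param_space. integral\<^sup>L (param_measure y) f \<in> U}"
    using y0(1) e(1) by (intro exI[of _ "{y \<in> topspace param_space. \<phi> y \<in> ball (\<phi> y0) (e / 3)}"]) auto
qed

lemma param_measure_image: "param_measure ` topspace param_space = ergodic_central_measures E v0"
proof (intro equalityI subsetI)
  fix M assume "M \<in> param_measure ` topspace param_space"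
  then obtain \<omega> r where "(\<omega>, r) \<in> topspace param_space" "M = param_measure (\<omega>, r)" by auto
  then show "M \<in> ergodic_central_measures E v0" unfolding ergodic_eq by auto
next
  fix M assume "M \<in> ergodic_central_measures E v0"
  then obtain \<omega> r where "M = param_measure (\<omega>, r)" "(\<omega>, r) \<in> topspace param_space" unfolding ergodic_eq by auto
  then show "M \<in> param_measure ` topspace param_space" by (rule image_eqI)
qed

lemma ergodic_borel: "ergodic_central_measures E v0 \<subseteq> borel_prob_measures PT"
  unfolding param_measure_image[symmetric] using param_measure_represents(2) by blast

lemma topspace_ergodic: "topspace ergodic_space = ergodic_central_measures E v0"
  using ergodic_borel by auto

lemma continuous_param_measure: "continuous_map param_space ergodic_space param_measure"
  unfolding continuous_map_in_subtopology
proof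
  show "continuous_map param_space (weak_topology PT) param_measure"
    unfolding weak_topology_def
  proof (rule continuous_on_generated_topo)
    fix V assume "V \<in> {{M \<in> borel_prob_measures PT. integral\<^sup>L M f \<in> U} | (f :: _ \<Rightarrow> real) U.
        continuous_map PT euclideanreal f \<and> bounded (f ` topspace PT) \<and> open U}"
    then obtain f :: "_ \<Rightarrow> real" and U where V: "V = {M \<in> borel_prob_measures PT. integral\<^sup>L M f \<in> U}"
      and f: "continuous_map PT euclideanreal f" "bounded (f ` PS)" "open U" by auto
    have "param_measure -` V \<inter> topspace param_space = {y \<in> topspace param_space. integral\<^sup>L (param_measure y) f \<in> U}"
      using param_measure_represents(2) unfolding V by blast
    then show "openin param_space (param_measure -` V \<inter> topspace param_space)" using continuous_integral_param[OF f] by simp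
  next
    have "param_measure ` topspace param_space \<subseteq> topspace (weak_topology PT)" using param_measure_represents(2) by auto
    then show "param_measure ` topspace param_space \<subseteq> \<Union> {{M \<in> borel_prob_measures PT. integral\<^sup>L M f \<in> U} | (f :: _ \<Rightarrow> real) U.
        continuous_map PT euclideanreal f \<and> bounded (f ` topspace PT) \<and> open U}"
      unfolding weak_topology_def topology_generated_by_topspace .
  qed
  show "param_measure \<in> topspace param_space \<rightarrow> ergodic_central_measures E v0" using param_measure_image by blast
qed

section \<open>Recovering \<open>r\<close> and the end from the measure\<close>

definition some_path :: "nat \<Rightarrow> 'v \<Rightarrow> (nat \<times> 'v) list" where
  "some_path n v = (SOME p. p \<in> FP \<and> last p = (n, v))"

lemma some_path: "(E ^^ n) v0 v \<Longrightarrow> some_path n v \<in> FP \<and> last (some_path n v) = (n, v)"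
  unfolding some_path_def by (rule someI_ex) (use ex_FP in blast)

lemma measure_param_some_path:
  "y \<in> topspace param_space \<Longrightarrow> (E ^^ n) v0 v \<Longrightarrow> measure (param_measure y) (cyl (some_path n v)) = lam (fst y) (snd y) n v"
  using param_measure_represents(3)[of y "some_path n v"] some_path by simp

text \<open>
  The return probability after two steps is a multiple of \<open>r (1 - r)\<close>, which determines \<open>r \<ge> 1/2\<close>.
\<close>

definition par_r :: "(nat \<Rightarrow> nat \<times> 'v) measure \<Rightarrow> real" where
  "par_r M = 1 / 2 + sqrt (1 / 4 - q * measure M (cyl (some_path 2 v0)))"

lemma continuous_measure_some_path:
  "(E ^^ n) v0 v \<Longrightarrow> continuous_map ergodic_space euclideanreal (\<lambda>M. measure M (cyl (some_path n v)))"
  using some_path by (intro continuous_map_from_subtopology continuous_measure_cyl) auto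

lemma walk_2: "(E ^^ 2) v0 v0"
  by (simp add: walk_iff)

lemma continuous_par_r: "continuous_map ergodic_space euclideanreal par_r"
  unfolding par_r_def
  by (intro continuous_map_add continuous_map_sqrt continuous_map_diff continuous_map_real_mult
      continuous_measure_some_path[OF walk_2]) auto

lemma par_r_param_measure:
  assumes y: "y \<in> topspace param_space"
  shows "par_r (param_measure y) = snd y"
proof -
  let ?r = "snd y"
  have \<omega>: "fst y \<in> ends E" and r: "1 / 2 \<le> ?r" using y by auto
  have "lam (fst y) ?r 2 v0 = ?r ^ 1 * ((1 - ?r) / real q) ^ 1"
    using hgt_v0[OF \<omega>] by (intro lam_eqI[of _ _ 0]) auto
  then have "1 / 4 - q * measure (param_measure y) (cyl (some_path 2 v0)) = (?r - 1 / 2)\<^sup>2"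
    using measure_param_some_path[OF y walk_2] q_ge2 by (simp add: field_simps power2_eq_square)
  then show ?thesis using r by (simp add: par_r_def)
qed

text \<open>Height never exceeds distance from \<open>v0\<close>, and equality marks the vertices of
  the ray from \<open>v0\<close>. If the parent of \<open>u\<close> lies farther from
  \<open>v0\<close>, then \<open>u\<close> is the parent of its own lower neighbour, and the
  argument descends to \<open>v0\<close>.\<close>

lemma directed_away_iff:
  assumes \<omega>: "\<omega> \<in> ends E" and e: "E u v" and d: "dst v0 v = Suc (dst v0 u)"
  shows "end_directed \<omega> u v \<longleftrightarrow> hgt \<omega> v = int (dst v0 v)"
proof
  have "dst v0 (up \<omega> u) = Suc (dst v0 u) \<Longrightarrow> hgt \<omega> u = int (dst v0 u)" for u
  proof (induction "dst v0 u" arbitrary: u)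
    case 0
    then have "v0 = u" using dst_eq_0 by metis
    then show ?case using hgt_v0[OF \<omega>] by auto
  next
    case (Suc n)
    then have "v0 \<noteq> u" by auto
    then obtain y where y: "E u y" "dst v0 u = Suc (dst v0 y)" using lower_nbr by metis
    then have "y \<noteq> up \<omega> u" using Suc.prems by auto
    then have up: "up \<omega> y = u" using up_cases[OF \<omega> y(1)] by auto
    then have "hgt \<omega> y = int (dst v0 y)" using Suc.hyps(1)[of y] Suc.hyps(2) y(2) by simp
    then show ?case using hgt_up[OF \<omega>, of y] up y(2) by simp
  qed
  moreover assume "end_directed \<omega> u v"
  ultimately show "hgt \<omega> v = int (dst v0 v)"
    using d hgt_up[OF \<omega>, of u] by (simp add: end_directed_iff[OF \<omega>])
next
  assume h: "hgt \<omega> v = int (dst v0 v)"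
  show "end_directed \<omega> u v"
  proof (rule ccontr)
    assume "\<not> end_directed \<omega> u v"
    then have "u = up \<omega> v" using up_cases[OF \<omega> e] end_directed_iff[OF \<omega>] by blast
    then have "hgt \<omega> u = int (dst v0 u) + 2" using hgt_up[OF \<omega>, of v] h d by simp
    then show False using hgt_walk[OF \<omega> dst_walk[of v0 u]] by simp
  qed
qed

text \<open>The factor 3/4 may be any number strictly between 1/2 and 1. The strict separation makes
  lying on the ray and not lying on it both open conditions on the measure.\<close>

definition ray_test :: "'v \<Rightarrow> (nat \<Rightarrow> nat \<times> 'v) measure \<Rightarrow> real" where
  "ray_test v M = measure M (cyl (some_path (dst v0 v) v)) - 3 / 4 * par_r M ^ dst v0 v"

lemma continuous_ray_test: "continuous_map ergodic_space euclideanreal (ray_test v)"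
  unfolding ray_test_def
  by (intro continuous_map_diff continuous_map_real_mult continuous_map_real_pow
      continuous_measure_some_path[OF dst_walk] continuous_par_r) auto

text \<open>
  The geodesic from \<open>v0\<close> to \<open>v\<close> has probability \<open>r\<^sup>n\<close>, \<open>n\<close> its length, if \<open>v\<close> lies on the ray towards \<open>\<omega>\<close>;
  otherwise at least one factor \<open>r\<close> is replaced by \<open>(1 - r) / q \<le> r / 2\<close>.
\<close>

lemma ray_test_param_measure:
  assumes y: "y \<in> topspace param_space"
  shows "hgt (fst y) v = int (dst v0 v) \<Longrightarrow> 0 < ray_test v (param_measure y)"
    and "hgt (fst y) v \<noteq> int (dst v0 v) \<Longrightarrow> ray_test v (param_measure y) < 0"
proof -
  let ?r = "snd y" and ?n = "dst v0 v"
  have \<omega>: "fst y \<in> ends E" and r: "1 / 2 \<le> ?r" "?r \<le> 1" using y by auto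
  have t: "ray_test v (param_measure y) = lam (fst y) ?r ?n v - 3 / 4 * ?r ^ ?n"
    using measure_param_some_path[OF y dst_walk] par_r_param_measure[OF y] by (simp add: ray_test_def)
  have rn: "0 < ?r ^ ?n" using r by simp
  {
    assume "hgt (fst y) v = int ?n"
    then have "lam (fst y) ?r ?n v = ?r ^ ?n * ((1 - ?r) / real q) ^ 0" by (rule lam_eqI) auto
    then show "0 < ray_test v (param_measure y)" using t rn by simp
  next
    assume ne: "hgt (fst y) v \<noteq> int ?n"
    have k: "\<bar>hgt (fst y) v\<bar> \<le> int ?n" "even (int ?n + hgt (fst y) v)"
      using hgt_walk[OF \<omega> dst_walk[of v0 v]] by auto
    define a where "a = nat ((int ?n + hgt (fst y) v) div 2)"
    define b where "b = nat ((int ?n - hgt (fst y) v) div 2)"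
    have ab: "int ?n + hgt (fst y) v = 2 * int a" "int ?n - hgt (fst y) v = 2 * int b"
      using k by (auto simp: a_def b_def)
    have n: "?n = a + b" and "0 < b" using ab ne by linarith+
    then obtain c where b: "b = Suc c" by (metis gr0_implies_Suc)
    let ?s = "(1 - ?r) / real q"
    have s: "0 \<le> ?s" "?s \<le> ?r / 2" "?s \<le> ?r"
    proof -
      have "(1 - ?r) / real q \<le> (1 - ?r) / 2" using r q_ge2 by (intro divide_left_mono) auto
      moreover have "(1 - ?r) / 2 \<le> ?r / 2" using r by simp
      ultimately show "?s \<le> ?r / 2" "?s \<le> ?r" using r by linarith+
    qed (use r in simp)
    have "lam (fst y) ?r ?n v = ?r ^ a * ?s ^ b" using ab by (intro lam_eqI) auto
    also have "?s ^ b = ?s * ?s ^ c" by (simp add: b)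
    also have "?r ^ a * (?s * ?s ^ c) \<le> ?r ^ a * (?r / 2 * ?r ^ c)"
      using s r by (intro mult_left_mono mult_mono power_mono) auto
    also have "\<dots> = ?r ^ ?n / 2" unfolding n b by (simp add: power_add)
    finally show "ray_test v (param_measure y) < 0" using t rn by simp
  }
qed

lemma end_eqI:
  assumes "\<omega> \<in> ends E" "\<omega>' \<in> ends E" "\<And>u v. E u v \<Longrightarrow> end_directed \<omega> u v \<longleftrightarrow> end_directed \<omega>' u v"
  shows "\<omega> = \<omega>'"
proof -
  have "up \<omega> u = up \<omega>' u" for u
    using assms(3)[OF up_edge[OF assms(1), of u]] end_directed_iff[OF assms(1)] end_directed_iff[OF assms(2)] by simp
  then have "ray \<omega> v0 = ray \<omega>' v0" using ray_conv_up[OF assms(1)] ray_conv_up[OF assms(2)] by (metis ext)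
  then have "ray \<omega> v0 \<in> \<omega> \<inter> \<omega>'" using ray_in[OF assms(1), of v0] ray_in[OF assms(2), of v0] by simp
  then show ?thesis using quotient_disj[OF equiv_cofinal] assms(1,2) unfolding ends_def by blast
qed

text \<open>An edge leading towards \<open>v0\<close> is tested through its reversal, where the
  answer is negated by \<open>directed_flip\<close>.\<close>

lemma directed_iff_ray_test:
  assumes y: "y \<in> topspace param_space" and e: "E u v"
  shows "end_directed (fst y) u v \<longleftrightarrow>
    (if dst v0 v = Suc (dst v0 u) then 0 < ray_test v (param_measure y) else ray_test u (param_measure y) < 0)"
proof -
  have \<omega>: "fst y \<in> ends E" using y by auto
  show ?thesis
  proof (cases "dst v0 v = Suc (dst v0 u)")
    case True
    then show ?thesis using directed_away_iff[OF \<omega> e] ray_test_param_measure[OF y, of v] by (metis less_asym)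
  next
    case False
    then have "dst v0 u = Suc (dst v0 v)" using edge_dst_cases[OF e] by blast
    then show ?thesis
      using directed_away_iff[OF \<omega> E_sym[OF e]] directed_flip[OF \<omega> e] ray_test_param_measure[OF y, of u] False by (metis less_asym)
  qed
qed

lemma inj_param_measure: "inj_on param_measure (topspace param_space)"
proof (rule inj_onI)
  fix y y' assume y: "y \<in> topspace param_space" "y' \<in> topspace param_space" and eq: "param_measure y = param_measure y'"
  have "fst y = fst y'"
    using directed_iff_ray_test[OF y(1)] directed_iff_ray_test[OF y(2)] y unfolding eq
    by (intro end_eqI) auto
  moreover have "snd y = snd y'" using par_r_param_measure[OF y(1)] par_r_param_measure[OF y(2)] eq by simp
  ultimately show "y = y'" by (rule prod_eqI)
qed

definition param_inverse :: "(nat \<Rightarrow> nat \<times> 'v) measure \<Rightarrow> (nat \<Rightarrow> 'v) set \<times> real" where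
  "param_inverse = inv_into (topspace param_space) param_measure"

lemma param_inverse_measure: "y \<in> topspace param_space \<Longrightarrow> param_inverse (param_measure y) = y"
  unfolding param_inverse_def by (rule inv_into_f_f[OF inj_param_measure])

lemma param_measure_inverse: "M \<in> topspace ergodic_space \<Longrightarrow> param_measure (param_inverse M) = M" and param_inverse_in: "M \<in> topspace ergodic_space \<Longrightarrow> param_inverse M \<in> topspace param_space"
  using param_measure_image unfolding param_inverse_def topspace_ergodic by (metis f_inv_into_f, metis inv_into_into)

text \<open>The preimage of a generating set of ends is a strict sign condition on the continuous
  function \<open>ray_test\<close>, and the second coordinate is \<open>par_r\<close>.\<close>

lemma continuous_param_inverse: "continuous_map ergodic_space param_space param_inverse"
  unfolding continuous_map_pairwise
proof
  show "continuous_map ergodic_space (ends_topology E) (fst \<circ> param_inverse)"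
    unfolding ends_topology_def
  proof (rule continuous_on_generated_topo)
    fix V assume "V \<in> {{\<omega> \<in> ends E. end_directed \<omega> u v} | u v. E u v}"
    then obtain u v where V: "V = {\<omega> \<in> ends E. end_directed \<omega> u v}" and e: "E u v" by blast
    have "(fst \<circ> param_inverse) -` V \<inter> topspace ergodic_space = {M \<in> topspace ergodic_space. end_directed (fst (param_inverse M)) u v}"
    proof -
      have "fst (param_inverse M) \<in> ends E" if "M \<in> topspace ergodic_space" for M using param_inverse_in[OF that] by auto
      then show ?thesis unfolding V by auto
    qed
    also have "\<dots> = {M \<in> topspace ergodic_space. if dst v0 v = Suc (dst v0 u) then 0 < ray_test v M else ray_test u M < 0}"
      using directed_iff_ray_test[OF param_inverse_in e] param_measure_inverse by (intro Collect_cong conj_cong refl) metis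
    also have "openin ergodic_space \<dots>"
      using openin_greater_continuous_map[OF continuous_ray_test, of 0 v]
        openin_less_continuous_map[OF continuous_ray_test, of u 0]
      by (cases "dst v0 v = Suc (dst v0 u)") simp_all
    finally show "openin ergodic_space ((fst \<circ> param_inverse) -` V \<inter> topspace ergodic_space)" .
  next
    have "(fst \<circ> param_inverse) ` topspace ergodic_space \<subseteq> topspace (ends_topology E)" using param_inverse_in by fastforce
    then show "(fst \<circ> param_inverse) ` topspace ergodic_space \<subseteq> \<Union> {{\<omega> \<in> ends E. end_directed \<omega> u v} | u v. E u v}"
      unfolding ends_topology_def topology_generated_by_topspace .
  qed
  have "continuous_map ergodic_space euclideanreal (snd \<circ> param_inverse)"
  proof (rule continuous_map_eq[OF continuous_par_r])
    fix M assume M: "M \<in> topspace ergodic_space"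
    show "par_r M = (snd \<circ> param_inverse) M" using par_r_param_measure[OF param_inverse_in[OF M]] param_measure_inverse[OF M] by simp
  qed
  moreover have "(snd \<circ> param_inverse) M \<in> {1/2..1}" if "M \<in> topspace ergodic_space" for M using param_inverse_in[OF that] by auto
  ultimately show "continuous_map ergodic_space (top_of_set {1/2..1}) (snd \<circ> param_inverse)"
    unfolding continuous_map_in_subtopology by blast
qed

lemma ergodic_space_homeomorphic: "ergodic_space homeomorphic_space param_space"
  unfolding homeomorphic_space_def homeomorphic_maps_def
  using continuous_param_inverse continuous_param_measure param_inverse_measure param_measure_inverse by blast

end

theorem theorem1:
  fixes E :: "'v \<Rightarrow> 'v \<Rightarrow> bool" and v0 :: 'v and q :: nat
  assumes "2 \<le> q" and "homogeneous_tree (q + 1) E"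
  shows "ergodic_central_measures E v0 =
           {lambda_measure q E v0 \<omega> r | \<omega> r. \<omega> \<in> ends E \<and> r \<in> {1/2..1}}
         \<and> subtopology (weak_topology (path_topology E v0)) (ergodic_central_measures E v0)
             homeomorphic_space prod_topology (ends_topology E) (top_of_set {1/2..1::real})"
proof -
  interpret tree E v0 q using assms by unfold_locales
  show ?thesis using ergodic_eq ergodic_space_homeomorphic by blast
qed

end
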